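(* Let $\mathbf{k}$ be a commutative ring with $2$ invertible, and let $J,c,\tilde Q$, $RC_n$, $\mathcal{M}\mathcal{K}_n$, $R_{a,b}$ and $\mathcal{S}\mathcal{K}_n$ be as in the context. In $\mathcal{S}\mathcal{K}_n$ set $$\sigma_ae(\nu)=\begin{cases}\tilde\tau_ae(\nu)&\mathrm{pr}(\nu_a)\ne\mathrm{pr}(\nu_{a+1}),\\ (\tilde\tau_a-(y_a-y_{a+1})^{-1})e(\nu)&\nu_a=\nu_{a+1}\notin J^c,\\ (\tilde\tau_a+(y_a+y_{a+1})^{-1}\mathsf{c}_a\mathsf{c}_{a+1})e(\nu)&\nu_a=c\nu_{a+1}\notin J^c,\\ (\tilde\tau_a-(y_a-y_{a+1})^{-1}+(y_a+y_{a+1})^{-1}\mathsf{c}_a\mathsf{c}_{a+1})e(\nu)&\nu_a=\nu_{a+1}\in J^c,\end{cases}$$ and $\sigma_a=\sum_\nu\sigma_ae(\nu)$. Then the elements $y_p,\mathsf{c}_p,e(\nu)\in\mathcal{M}\mathcal{K}_n$ and $\sigma_a$ satisfy the defining relations of $RC_n$, and the resulting superalgebra homomorphism $RC_n\to\mathcal{S}\mathcal{K}_n$ is injective.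
   Context: $J$ is a finite set with involution $c$, $J^c$ its fixed points, $I=J/\!\sim$ where $j\sim j'\iff j'\in\{j,c(j)\}$, $\mathrm{pr}:J\to I$. $S_n$ acts on $J^n$ by permuting entries ($s_a=(a,a+1)$); $c_p$ applies $c$ to the $p$-th entry. $\tilde Q=(\tilde Q_{i,j}(u,v))_{i,j\in J}\subset\mathbf{k}[u,v]$ with $\tilde Q_{j,i}(u,v)=\tilde Q_{i,j}(v,u)$, $\tilde Q_{c(i),j}(-u,v)=\tilde Q_{i,c(j)}(u,-v)=\tilde Q_{i,j}(u,v)$, and $\tilde Q_{i,j}=0$ if $\mathrm{pr}(i)=\mathrm{pr}(j)$. $RC_n$ is generated by even $y_p$ ($1\le p\le n$), $\sigma_a$ ($1\le a<n$), $e(\nu)$ ($\nu\in J^n$) and odd $\mathsf{c}_p$ with relations: (1) $e(\mu)e(\nu)=\delta_{\mu\nu}e(\mu)$, $\sum e(\nu)=1$, $y_pe(\nu)=e(\nu)y_p$, $\mathsf{c}_pe(\nu)=e(c_p\nu)\mathsf{c}_p$; (2) $y_py_q=y_qy_p$, $\mathsf{c}_p\mathsf{c}_q+\mathsf{c}_q\mathsf{c}_p=2\delta_{pq}$; (3) $\mathsf{c}_py_q=(-1)^{\delta_{pq}}y_q\mathsf{c}_p$; (4) $\sigma_ae(\nu)=e(s_a\nu)\sigma_a$, $\sigma_a\mathsf{c}_p=\mathsf{c}_{s_a(p)}\sigma_a$; (5) $\sigma_ay_p=y_p\sigma_a$ ($p\ne a,a+1$); (6) $\sigma_ay_{a+1}-y_a\sigma_a=\sum_{\nu_a=\nu_{a+1}}e(\nu)-\sum_{\nu_a=c\nu_{a+1}}\mathsf{c}_a\mathsf{c}_{a+1}e(\nu)$;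 (7) $y_{a+1}\sigma_a-\sigma_ay_a=\sum_{\nu_a=\nu_{a+1}}e(\nu)+\sum_{\nu_a=c\nu_{a+1}}\mathsf{c}_a\mathsf{c}_{a+1}e(\nu)$; (8) $\sigma_a^2e(\nu)=\tilde Q_{\nu_a,\nu_{a+1}}(y_a,y_{a+1})e(\nu)$; (9) $\sigma_a\sigma_b=\sigma_b\sigma_a$ ($|a-b|>1$); (10) $\sigma_{a+1}\sigma_a\sigma_{a+1}-\sigma_a\sigma_{a+1}\sigma_a=\sum_{\nu_a=\nu_{a+2}}\frac{\tilde Q_{\nu_a,\nu_{a+1}}(y_{a+2},y_{a+1})-\tilde Q_{\nu_a,\nu_{a+1}}(y_a,y_{a+1})}{y_{a+2}-y_a}e(\nu)+\sum_{\nu_a=c\nu_{a+2}}\frac{\tilde Q_{\nu_a,\nu_{a+1}}(y_{a+2},y_{a+1})-\tilde Q_{\nu_a,\nu_{a+1}}(-y_a,y_{a+1})}{y_{a+2}+y_a}\mathsf{c}_a\mathsf{c}_{a+2}e(\nu)$. $\mathcal{M}\mathcal{A}_n$ is the superalgebra generated by $y_p$, $\mathsf{c}_p$, $e(\nu)$ with relations (1)–(3); $\mathcal{M}\mathcal{K}_n=\mathbf{k}[y_1,\dots,y_n][(y_a-y_b)^{-1},(y_a+y_b)^{-1};1\le a<b\le n]\otimes_{\mathbf{k}[y_1,\dots,y_n]}\mathcal{M}\mathcal{A}_n$. $S_n$ acts on $\mathcal{M}\mathcal{K}_n$ by $w(y_p)=y_{w(p)}$, $w(\mathsf{c}_p)=\mathsf{c}_{w(p)}$,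 $w(e(\nu))=e(w\nu)$. For $a\ne b$, $R_{a,b}=\sum_{\mathrm{pr}(\nu_a)\ne\mathrm{pr}(\nu_b)}\tilde Q_{\nu_a,\nu_b}(y_a,y_b)e(\nu)-\sum_{\nu_a=\nu_b\notin J^c}(y_a-y_b)^{-2}e(\nu)-\sum_{\nu_a=c\nu_b\notin J^c}(y_a+y_b)^{-2}e(\nu)-\sum_{\nu_a=\nu_b\in J^c}\frac{2(y_a^2+y_b^2)}{(y_a^2-y_b^2)^2}e(\nu)$. $\mathcal{S}\mathcal{K}_n$ is the superalgebra generated by $\mathcal{M}\mathcal{K}_n$ and even elements $\tilde\tau_1,\dots,\tilde\tau_{n-1}$ with relations: the $\tilde\tau_k$ satisfy the braid relations ($\tilde\tau_i\tilde\tau_j=\tilde\tau_j\tilde\tau_i$ for $|i-j|>1$, $\tilde\tau_{i+1}\tilde\tau_i\tilde\tau_{i+1}=\tilde\tau_i\tilde\tau_{i+1}\tilde\tau_i$), $\tilde\tau_k^2=R_{k,k+1}$, and $\tilde\tau_k\,m=s_k(m)\,\tilde\tau_k$ for $m\in\mathcal{M}\mathcal{K}_n$. *)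

theory Defs
  imports "HOL-Library.Poly_Mapping" "HOL-Computational_Algebra.Polynomial"
begin

datatype 'g word = Wd "'g list"

fun unWd :: "'g word \<Rightarrow> 'g list" where "unWd (Wd l) = l"

instantiation word :: (type) monoid_add
begin
definition zero_word_def: "0 = Wd []"
definition plus_word_def: "v + w = Wd (unWd v @ unWd w)"
instance
  by standard (auto simp: zero_word_def plus_word_def, metis unWd.simps word.exhaust,
               metis unWd.simps word.exhaust)
end

text \<open>The free algebra k<G>: finitely supported k-valued functions on words,
  with convolution product (concatenation of words).\<close>
type_synonym ('g, 'k) falg = "'g word \<Rightarrow>\<^sub>0 'k"

definition gen :: "'g \<Rightarrow> ('g, 'k::comm_ring_1) falg" where
  "gen g = Poly_Mapping.single (Wd [g]) 1"

definition sc :: "'k \<Rightarrow> ('g, 'k::comm_ring_1) falg" where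
  "sc a = Poly_Mapping.single 0 a"

definition fvalid :: "('g \<Rightarrow> bool) \<Rightarrow> ('g, 'k::comm_ring_1) falg \<Rightarrow> bool" where
  "fvalid P x \<longleftrightarrow> (\<forall>w \<in> Poly_Mapping.keys x. \<forall>g \<in> set (unWd w). P g)"

definition fhom :: "('g \<Rightarrow> ('h, 'k::comm_ring_1) falg) \<Rightarrow> ('g, 'k) falg \<Rightarrow> ('h, 'k) falg" where
  "fhom \<phi> x = (\<Sum>w \<in> Poly_Mapping.keys x. sc (Poly_Mapping.lookup x w) * prod_list (map \<phi> (unWd w)))"

inductive_set gen_ideal :: "('g \<Rightarrow> bool) \<Rightarrow> ('g, 'k::comm_ring_1) falg set \<Rightarrow> ('g, 'k) falg set"
  for P R where
  zero: "0 \<in> gen_ideal P R"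
| gen: "r \<in> R \<Longrightarrow> fvalid P a \<Longrightarrow> fvalid P b \<Longrightarrow> a * r * b \<in> gen_ideal P R"
| add: "x \<in> gen_ideal P R \<Longrightarrow> y \<in> gen_ideal P R \<Longrightarrow> x + y \<in> gen_ideal P R"

section \<open>Bivariate polynomials k[u,v] as 'k poly poly (outer variable v, inner u)\<close>

definition bcoeff :: "'k::comm_ring_1 poly poly \<Rightarrow> nat \<Rightarrow> nat \<Rightarrow> 'k" where
  "bcoeff q i j = coeff (coeff q j) i"

definition beval :: "'k::comm_ring_1 poly poly \<Rightarrow> ('g, 'k) falg \<Rightarrow> ('g, 'k) falg \<Rightarrow> ('g, 'k) falg" where
  "beval q X Y = (\<Sum>j\<le>degree q. \<Sum>i\<le>degree (coeff q j). sc (bcoeff q i j) * X ^ i * Y ^ j)"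

text \<open>the polynomial divided difference (q(Z,Y) - q(X,Y)) / (Z - X), evaluated at
  (commuting) elements Z, X, Y\<close>
definition bdd :: "'k::comm_ring_1 poly poly \<Rightarrow> ('g, 'k) falg \<Rightarrow> ('g, 'k) falg \<Rightarrow> ('g, 'k) falg \<Rightarrow> ('g, 'k) falg" where
  "bdd q Z X Y = (\<Sum>j\<le>degree q. \<Sum>i\<le>degree (coeff q j).
      sc (bcoeff q i j) * (\<Sum>m<i. Z ^ m * X ^ (i - 1 - m)) * Y ^ j)"

section \<open>Combinatorial data (indices are 0-based: positions 0..n-1)\<close>

definition Jn :: "nat \<Rightarrow> 'j list set" where "Jn n = {\<nu>. length \<nu> = n}"

definition pr_eq :: "('j \<Rightarrow> 'j) \<Rightarrow> 'j \<Rightarrow> 'j \<Rightarrow> bool" where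
  "pr_eq c i j \<longleftrightarrow> j = i \<or> j = c i"

definition sw :: "nat \<Rightarrow> nat \<Rightarrow> nat" where
  "sw a p = (if p = a then Suc a else if p = Suc a then a else p)"

definition lsw :: "nat \<Rightarrow> 'j list \<Rightarrow> 'j list" where
  "lsw a \<nu> = \<nu>[a := \<nu> ! Suc a, Suc a := \<nu> ! a]"

definition capp :: "('j \<Rightarrow> 'j) \<Rightarrow> nat \<Rightarrow> 'j list \<Rightarrow> 'j list" where
  "capp c p \<nu> = \<nu>[p := c (\<nu> ! p)]"

definition MA_rels :: "('j::finite \<Rightarrow> 'j) \<Rightarrow> nat \<Rightarrow> (nat \<Rightarrow> 'a::ring_1) \<Rightarrow> (nat \<Rightarrow> 'a)
    \<Rightarrow> ('j list \<Rightarrow> 'a) \<Rightarrow> 'a set" where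
  "MA_rels c n y cc e =
     {e \<mu> * e \<nu> - (if \<mu> = \<nu> then e \<mu> else 0) | \<mu> \<nu>. \<mu> \<in> Jn n \<and> \<nu> \<in> Jn n}
   \<union> {(\<Sum>\<nu>\<in>Jn n. e \<nu>) - 1}
   \<union> {y p * e \<nu> - e \<nu> * y p | p \<nu>. p < n \<and> \<nu> \<in> Jn n}
   \<union> {cc p * e \<nu> - e (capp c p \<nu>) * cc p | p \<nu>. p < n \<and> \<nu> \<in> Jn n}
   \<union> {y p * y q - y q * y p | p q. p < n \<and> q < n}
   \<union> {cc p * cc q + cc q * cc p - (if p = q then 2 else 0) | p q. p < n \<and> q < n}
   \<union> {cc p * y q - (if p = q then - 1 else 1) * y q * cc p | p q. p < n \<and> q < n}"

datatype 'j rgen = RY nat | RCl nat | RE "'j list" | RS nat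

fun rvalid :: "nat \<Rightarrow> 'j rgen \<Rightarrow> bool" where
  "rvalid n (RY p) = (p < n)"
| "rvalid n (RCl p) = (p < n)"
| "rvalid n (RE \<nu>) = (length \<nu> = n)"
| "rvalid n (RS a) = (Suc a < n)"

definition RC_rels :: "('j::finite \<Rightarrow> 'j) \<Rightarrow> ('j \<Rightarrow> 'j \<Rightarrow> 'k::comm_ring_1 poly poly) \<Rightarrow> nat
    \<Rightarrow> ('j rgen, 'k) falg set" where
  "RC_rels c Q n =
    (let y = (\<lambda>p. gen (RY p)); cc = (\<lambda>p. gen (RCl p)); e = (\<lambda>\<nu>. gen (RE \<nu>));
         s = (\<lambda>a. gen (RS a));
         Esum = (\<lambda>a. \<Sum>\<nu> \<in> {\<nu> \<in> Jn n. \<nu> ! a = \<nu> ! Suc a}. e \<nu>);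
         Csum = (\<lambda>a. \<Sum>\<nu> \<in> {\<nu> \<in> Jn n. \<nu> ! a = c (\<nu> ! Suc a)}. cc a * cc (Suc a) * e \<nu>)
     in MA_rels c n y cc e
      \<union> {s a * e \<nu> - e (lsw a \<nu>) * s a | a \<nu>. Suc a < n \<and> \<nu> \<in> Jn n}
      \<union> {s a * cc p - cc (sw a p) * s a | a p. Suc a < n \<and> p < n}
      \<union> {s a * y p - y p * s a | a p. Suc a < n \<and> p < n \<and> p \<noteq> a \<and> p \<noteq> Suc a}
      \<union> {s a * y (Suc a) - y a * s a - (Esum a - Csum a) | a. Suc a < n}
      \<union> {y (Suc a) * s a - s a * y a - (Esum a + Csum a) | a. Suc a < n}
      \<union> {s a * s a * e \<nu> - beval (Q (\<nu> ! a) (\<nu> ! Suc a)) (y a) (y (Suc a)) * e \<nu>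
          | a \<nu>. Suc a < n \<and> \<nu> \<in> Jn n}
      \<union> {s a * s b - s b * s a | a b. Suc a < n \<and> Suc b < n \<and> (a + 1 < b \<or> b + 1 < a)}
      \<union> {s (a + 1) * s a * s (a + 1) - s a * s (a + 1) * s a
          - (\<Sum>\<nu> \<in> {\<nu> \<in> Jn n. \<nu> ! a = \<nu> ! (a + 2)}.
               bdd (Q (\<nu> ! a) (\<nu> ! (a + 1))) (y (a + 2)) (y a) (y (a + 1)) * e \<nu>)
          - (\<Sum>\<nu> \<in> {\<nu> \<in> Jn n. \<nu> ! a = c (\<nu> ! (a + 2))}.
               bdd (Q (\<nu> ! a) (\<nu> ! (a + 1))) (y (a + 2)) (- y a) (y (a + 1))
                 * cc a * cc (a + 2) * e \<nu>)
          | a. a + 2 < n})"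

definition RC_ideal :: "('j::finite \<Rightarrow> 'j) \<Rightarrow> ('j \<Rightarrow> 'j \<Rightarrow> 'k::comm_ring_1 poly poly) \<Rightarrow> nat
    \<Rightarrow> ('j rgen, 'k) falg set" where
  "RC_ideal c Q n = gen_ideal (rvalid n) (RC_rels c Q n)"

text \<open>Generators: y_p, c_p, e(nu), Dm a b = (y_a - y_b)^-1, Dp a b = (y_a + y_b)^-1
  (a \<noteq> b), which together present MK_n, and tau_k.\<close>
datatype 'j sgen = SY nat | SCl nat | SE "'j list" | SDm nat nat | SDp nat nat | ST nat

fun svalid :: "nat \<Rightarrow> 'j sgen \<Rightarrow> bool" where
  "svalid n (SY p) = (p < n)"
| "svalid n (SCl p) = (p < n)"
| "svalid n (SE \<nu>) = (length \<nu> = n)"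
| "svalid n (SDm a b) = (a < n \<and> b < n \<and> a \<noteq> b)"
| "svalid n (SDp a b) = (a < n \<and> b < n \<and> a \<noteq> b)"
| "svalid n (ST k) = (Suc k < n)"

fun MKgen :: "'j sgen \<Rightarrow> bool" where
  "MKgen (ST k) = False"
| "MKgen _ = True"

fun sact :: "nat \<Rightarrow> 'j sgen \<Rightarrow> 'j sgen" where
  "sact k (SY p) = SY (sw k p)"
| "sact k (SCl p) = SCl (sw k p)"
| "sact k (SE \<nu>) = SE (lsw k \<nu>)"
| "sact k (SDm a b) = SDm (sw k a) (sw k b)"
| "sact k (SDp a b) = SDp (sw k a) (sw k b)"
| "sact k (ST j) = ST j"

definition Rab :: "('j::finite \<Rightarrow> 'j) \<Rightarrow> ('j \<Rightarrow> 'j \<Rightarrow> 'k::comm_ring_1 poly poly) \<Rightarrow> nat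
    \<Rightarrow> nat \<Rightarrow> nat \<Rightarrow> ('j sgen, 'k) falg" where
  "Rab c Q n a b =
    (let y = (\<lambda>p. gen (SY p)); e = (\<lambda>\<nu>. gen (SE \<nu>));
         dm = gen (SDm a b); dp = gen (SDp a b)
     in (\<Sum>\<nu> \<in> {\<nu> \<in> Jn n. \<not> pr_eq c (\<nu> ! a) (\<nu> ! b)}.
            beval (Q (\<nu> ! a) (\<nu> ! b)) (y a) (y b) * e \<nu>)
      - (\<Sum>\<nu> \<in> {\<nu> \<in> Jn n. \<nu> ! a = \<nu> ! b \<and> c (\<nu> ! a) \<noteq> \<nu> ! a}. dm ^ 2 * e \<nu>)
      - (\<Sum>\<nu> \<in> {\<nu> \<in> Jn n. \<nu> ! a = c (\<nu> ! b) \<and> c (\<nu> ! a) \<noteq> \<nu> ! a}. dp ^ 2 * e \<nu>)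
      - (\<Sum>\<nu> \<in> {\<nu> \<in> Jn n. \<nu> ! a = \<nu> ! b \<and> c (\<nu> ! a) = \<nu> ! a}.
            2 * (y a ^ 2 + y b ^ 2) * (dm ^ 2 * dp ^ 2) * e \<nu>))"

definition SK_rels :: "('j::finite \<Rightarrow> 'j) \<Rightarrow> ('j \<Rightarrow> 'j \<Rightarrow> 'k::comm_ring_1 poly poly) \<Rightarrow> nat
    \<Rightarrow> ('j sgen, 'k) falg set" where
  "SK_rels c Q n =
    (let y = (\<lambda>p. gen (SY p)); cc = (\<lambda>p. gen (SCl p)); e = (\<lambda>\<nu>. gen (SE \<nu>));
         dm = (\<lambda>a b. gen (SDm a b)); dp = (\<lambda>a b. gen (SDp a b)); t = (\<lambda>k. gen (ST k))
     in MA_rels c n y cc e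
      \<union> {dm a b * (y a - y b) - 1 | a b. a < n \<and> b < n \<and> a \<noteq> b}
      \<union> {(y a - y b) * dm a b - 1 | a b. a < n \<and> b < n \<and> a \<noteq> b}
      \<union> {dp a b * (y a + y b) - 1 | a b. a < n \<and> b < n \<and> a \<noteq> b}
      \<union> {(y a + y b) * dp a b - 1 | a b. a < n \<and> b < n \<and> a \<noteq> b}
      \<union> {t i * t j - t j * t i | i j. Suc i < n \<and> Suc j < n \<and> (i + 1 < j \<or> j + 1 < i)}
      \<union> {t (i + 1) * t i * t (i + 1) - t i * t (i + 1) * t i | i. i + 2 < n}
      \<union> {t k * t k - Rab c Q n k (Suc k) | k. Suc k < n}
      \<union> {t k * gen g - gen (sact k g) * t k | k g. Suc k < n \<and> svalid n g \<and> MKgen g})"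

definition SK_ideal :: "('j::finite \<Rightarrow> 'j) \<Rightarrow> ('j \<Rightarrow> 'j \<Rightarrow> 'k::comm_ring_1 poly poly) \<Rightarrow> nat
    \<Rightarrow> ('j sgen, 'k) falg set" where
  "SK_ideal c Q n = gen_ideal (svalid n) (SK_rels c Q n)"

definition sigma_img :: "('j::finite \<Rightarrow> 'j) \<Rightarrow> nat \<Rightarrow> nat \<Rightarrow> ('j sgen, 'k::comm_ring_1) falg" where
  "sigma_img c n a =
    (let t = gen (ST a); dm = gen (SDm a (Suc a)); dp = gen (SDp a (Suc a));
         ccc = gen (SCl a) * gen (SCl (Suc a))
     in \<Sum>\<nu> \<in> Jn n.
        (if \<not> pr_eq c (\<nu> ! a) (\<nu> ! Suc a) then t
         else if \<nu> ! a = \<nu> ! Suc a \<and> c (\<nu> ! a) \<noteq> \<nu> ! a then t - dm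
         else if \<nu> ! a = c (\<nu> ! Suc a) \<and> c (\<nu> ! a) \<noteq> \<nu> ! a then t + dp * ccc
         else t - dm + dp * ccc) * gen (SE \<nu>))"

fun RC_to_SK :: "('j::finite \<Rightarrow> 'j) \<Rightarrow> nat \<Rightarrow> 'j rgen \<Rightarrow> ('j sgen, 'k::comm_ring_1) falg" where
  "RC_to_SK c n (RY p) = gen (SY p)"
| "RC_to_SK c n (RCl p) = gen (SCl p)"
| "RC_to_SK c n (RE \<nu>) = gen (SE \<nu>)"
| "RC_to_SK c n (RS a) = sigma_img c n a"

end

(* The relations follow from writing sigma_a = tau_a + beta_{a,a+1} with
   beta_{pq} = -(b_{pq} + c_p b_{pq} c_q), where b_{pq} is (y_p - y_q)^{-1} times the sum of the
   e(nu) with nu_p = nu_q.  The beta_{pq} are permuted by the tau_a, are antisymmetric and satisfy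
   beta_{qr} beta_{pq} = beta_{pr} beta_{qr} + beta_{pq} beta_{pr}, and R_{pq} = Q_{pq} - beta_{pq}^2,
   where Q_{pq} is the sum of the Q(y_p, y_q) e(nu).  Hence the braid relation of the tau_a turns
   into sigma_{a+1} sigma_a sigma_{a+1} - sigma_a sigma_{a+1} sigma_a
   = beta_{a,a+2} (Q_{a+1,a+2} - Q_{a,a+1}), which is the divided difference in relation (10).

   For injectivity, RC_n is spanned by y^alpha c^eta e(nu) sigma_w with one reduced word for each
   permutation w.  Their images are independent because SK_n acts on functions on a set of points:
   a point assigns to each position a coordinate t^m or -t^m with distinct exponents m, and a label
   in J.  The coordinate differences and sums are units in k((t)), c_p flips a sign and tau_a swaps
   two neighbouring positions.  On functions supported on the dominant chamber, the values of
   sigma_w f on the chamber of v vanish for l(v) >= l(w), v /= w, and for v = w they are those of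
   f up to sign and relabelling. *)
theory Submission
  imports Defs "HOL-Computational_Algebra.Formal_Laurent_Series" "HOL-Library.Multiset"
begin

section \<open>The free algebra\<close>

text \<open>No basis of SK_n is established: injectivity needs only one module on which the images
  of the normal forms are independent, and this module may fail to be faithful. The obstacle is the
  ground ring, which may have zero divisors; R may be a zero divisor or even zero, so tau_a cannot
  be treated as invertible. Three choices deal with this. Distinct positions carry distinct
  exponents, so the sums and differences of their coordinates are units over any commutative ring.
  The factor R is put on one order of each pair of sites, the order that is never met while a point
  is sorted into the dominant chamber; hence the leading coefficients are 1 or -1. With powers of a
  large base as exponents, each y-monomial becomes plus or minus a single power of t, whose exponent
  determines the monomial. Invertibility of 2 enters through the relation 2 c_p^2 = 2.\<close>

lemma falg_induct [case_names zero single add]: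
  fixes x :: "'a \<Rightarrow>\<^sub>0 'b::comm_monoid_add"
  assumes "P 0" and s: "\<And>w a. P (Poly_Mapping.single w a)"
    and a: "\<And>x y. P x \<Longrightarrow> P y \<Longrightarrow> P (x + y)"
  shows "P x"
proof -
  have *: "P (\<Sum>w\<in>A. Poly_Mapping.single w (Poly_Mapping.lookup x w))" if "finite A" for A
    using that by (induction) (auto intro: assms)
  have "x = (\<Sum>w\<in>Poly_Mapping.keys x. Poly_Mapping.single w (Poly_Mapping.lookup x w))"
    by (rule poly_mapping_eqI) (simp add: lookup_sum lookup_single when_def in_keys_iff)
  then show ?thesis using *[of "Poly_Mapping.keys x"] by simp
qed

lemma unWd_zero [simp]: "unWd 0 = []" and unWd_plus [simp]: "unWd (v + w) = unWd v @ unWd w"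
  by (simp_all add: zero_word_def plus_word_def)

lemma sc_0 [simp]: "sc 0 = 0" and sc_1 [simp]: "sc 1 = 1"
  and sc_add: "sc (a + b) = sc a + sc b" and sc_mult: "sc (a * b) = sc a * sc b"
  and sc_minus: "sc (- a) = - sc a"
  by (simp_all add: sc_def single_add mult_single single_uminus)

lemma sc_commute: "sc a * x = x * sc a"
  unfolding sc_def by (induction x rule: falg_induct) (simp_all add: algebra_simps mult_single)

lemma fhom_0 [simp]: "fhom \<phi> 0 = 0"
  by (simp add: fhom_def)

lemma fhom_single: "fhom \<phi> (Poly_Mapping.single w a) = sc a * prod_list (map \<phi> (unWd w))"
  by (simp add: fhom_def)

lemma fhom_add [simp]: "fhom \<phi> (x + y) = fhom \<phi> x + fhom \<phi> y"
  unfolding fhom_def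
  by (rule setsum_keys_plus_distrib) (simp_all add: sc_add algebra_simps)

lemma fhom_mult [simp]: "fhom \<phi> (x * y) = fhom \<phi> x * fhom \<phi> y"
proof (induction x rule: falg_induct)
  case (single w a)
  show ?case
  proof (induction y rule: falg_induct)
    case (single v b)
    show ?case
      by (simp add: mult_single fhom_single sc_mult mult.assoc)
        (metis (no_types) mult.assoc sc_commute)
  qed (simp_all add: algebra_simps)
qed (simp_all add: algebra_simps)

lemma fhom_sc [simp]: "fhom \<phi> (sc a) = sc a"
  by (simp add: fhom_single sc_def)

lemma fhom_1 [simp]: "fhom \<phi> 1 = 1"
  using fhom_sc[of \<phi> 1] by simp

lemma fhom_gen [simp]: "fhom \<phi> (gen g) = \<phi> g"
  by (simp add: gen_def fhom_single)

lemma fhom_uminus [simp]: "fhom \<phi> (- x) = - fhom \<phi> x"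
  using fhom_add[of \<phi> x "- x"] by (simp add: eq_neg_iff_add_eq_0 add.commute)

lemma fhom_diff [simp]: "fhom \<phi> (x - y) = fhom \<phi> x - fhom \<phi> y"
  using fhom_add[of \<phi> x "- y"] by simp

lemma fhom_sum [simp]: "fhom \<phi> (\<Sum>i\<in>A. f i) = (\<Sum>i\<in>A. fhom \<phi> (f i))"
  by (induction A rule: infinite_finite_induct) auto

lemma fhom_power [simp]: "fhom \<phi> (x ^ i) = fhom \<phi> x ^ i"
  by (induction i) auto

lemma fhom_2 [simp]: "fhom \<phi> 2 = 2"
  by (metis fhom_1 fhom_add one_add_one)

lemma fhom_beval [simp]: "fhom \<phi> (beval q X Y) = beval q (fhom \<phi> X) (fhom \<phi> Y)"
  by (simp add: beval_def)

lemma fhom_bdd [simp]: "fhom \<phi> (bdd q Z X Y) = bdd q (fhom \<phi> Z) (fhom \<phi> X) (fhom \<phi> Y)"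
  by (simp add: bdd_def)

lemma fvalid_0 [simp]: "fvalid P 0"
  by (simp add: fvalid_def)

lemma fvalid_add [simp]: "fvalid P x \<Longrightarrow> fvalid P y \<Longrightarrow> fvalid P (x + y)"
  unfolding fvalid_def using keys_add[of x y] by blast

lemma fvalid_single: "(\<And>g. g \<in> set (unWd w) \<Longrightarrow> P g) \<Longrightarrow> fvalid P (Poly_Mapping.single w a)"
  by (auto simp: fvalid_def split: if_splits)

lemma fvalid_sc [simp]: "fvalid P (sc a)"
  by (auto simp: sc_def intro: fvalid_single)

lemma fvalid_1 [simp]: "fvalid P 1"
  using fvalid_sc[of P 1] by simp

lemma fvalid_gen [simp]: "P g \<Longrightarrow> fvalid P (gen g)"
  by (auto simp: gen_def intro: fvalid_single)

lemma fvalid_mult [simp]: "fvalid P x \<Longrightarrow> fvalid P y \<Longrightarrow> fvalid P (x * y)"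
  unfolding fvalid_def using keys_mult[of x y] by fastforce

lemma fvalid_uminus [simp]: "fvalid P x \<Longrightarrow> fvalid P (- x)"
  using fvalid_mult[OF fvalid_sc[of P "- 1"], of x] by (simp add: sc_minus)

lemma fvalid_diff [simp]: "fvalid P x \<Longrightarrow> fvalid P y \<Longrightarrow> fvalid P (x - y)"
  using fvalid_add[of P x "- y"] by simp

lemma fvalid_2 [simp]: "fvalid P 2"
  by (metis fvalid_1 fvalid_add one_add_one)

lemma fvalid_sum [simp]: "(\<And>i. i \<in> A \<Longrightarrow> fvalid P (f i)) \<Longrightarrow> fvalid P (\<Sum>i\<in>A. f i)"
  by (induction A rule: infinite_finite_induct) auto

lemma fvalid_power [simp]: "fvalid P x \<Longrightarrow> fvalid P (x ^ i)"
  by (induction i) auto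

lemma fvalid_prod_list [simp]: "(\<And>x. x \<in> set xs \<Longrightarrow> fvalid P x) \<Longrightarrow> fvalid P (prod_list xs)"
  by (induction xs) auto

lemma fvalid_beval [simp]: "fvalid P X \<Longrightarrow> fvalid P Y \<Longrightarrow> fvalid P (beval q X Y)"
  by (simp add: beval_def)

lemma fvalid_bdd [simp]: "fvalid P X \<Longrightarrow> fvalid P Y \<Longrightarrow> fvalid P Z \<Longrightarrow> fvalid P (bdd q Z X Y)"
  by (simp add: bdd_def)

lemma fvalid_fhom:
  assumes "fvalid P x" "\<And>g. P g \<Longrightarrow> fvalid P' (\<phi> g)"
  shows "fvalid P' (fhom \<phi> x)"
  using assms unfolding fhom_def fvalid_def[of P]
  by (auto intro!: fvalid_sum fvalid_mult fvalid_prod_list)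

text \<open>Reduces claims about classes in a quotient to products of generators.\<close>

lemma falg_as_sum: "x = (\<Sum>w\<in>Poly_Mapping.keys x. sc (Poly_Mapping.lookup x w) * prod_list (map gen (unWd w)))"
proof -
  have "fhom gen x = x"
  proof (induction x rule: falg_induct)
    case (single w a)
    have "prod_list (map gen l) = (Poly_Mapping.single (Wd l) 1 :: ('a,'b) falg)" for l
      by (induction l) (simp_all add: gen_def mult_single plus_word_def zero_word_def[symmetric])
    then have "prod_list (map gen (unWd w)) = (Poly_Mapping.single w 1 :: ('a,'b) falg)"
      by (metis unWd.simps word.exhaust)
    then show ?case by (simp add: fhom_single sc_def mult_single)
  qed auto
  then show ?thesis by (simp add: fhom_def)
qed

lemma fhom_cong_valid:
  assumes "fvalid P x" "\<And>g. P g \<Longrightarrow> \<phi> g = \<psi> g"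
  shows "fhom \<phi> x = fhom \<psi> x"
proof -
  have "map \<phi> (unWd w) = map \<psi> (unWd w)" if "w \<in> Poly_Mapping.keys x" for w
    using assms that by (auto simp: fvalid_def)
  then show ?thesis unfolding fhom_def by (metis (no_types, lifting) sum.cong)
qed

lemma fhom_gen_id: "fhom gen x = x"
  using falg_as_sum[of x] by (simp add: fhom_def)

section \<open>Two-sided ideals\<close>

lemma gen_ideal_mult:
  "x \<in> gen_ideal P R \<Longrightarrow> fvalid P u \<Longrightarrow> fvalid P v \<Longrightarrow> u * x * v \<in> gen_ideal P R"
proof (induction rule: gen_ideal.induct)
  case (gen r a b)
  then have "(u * a) * r * (b * v) \<in> gen_ideal P R" by (intro gen_ideal.gen) auto
  then show ?case by (simp add: mult.assoc)
next
  case (add x y)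
  then show ?case using gen_ideal.add by (fastforce simp: algebra_simps)
qed (simp add: gen_ideal.zero)

lemma gen_ideal_rel: "r \<in> R \<Longrightarrow> r \<in> gen_ideal P R"
  using gen_ideal.gen[of r R P 1 1] by simp

lemma gen_ideal_mono: "x \<in> gen_ideal P R \<Longrightarrow> (\<And>g. P g \<Longrightarrow> P' g) \<Longrightarrow> x \<in> gen_ideal P' R"
proof (induction rule: gen_ideal.induct)
  case (gen r a b)
  then show ?case by (auto intro!: gen_ideal.gen simp: fvalid_def)
qed (auto intro: gen_ideal.intros)

text \<open>The retraction sending the generators outside \<open>P\<close> to zero shows that allowing them as
  factors does not enlarge the ideal.\<close>
lemma gen_ideal_retract:
  assumes "x \<in> gen_ideal (\<lambda>_. True) R" "fvalid P x" "\<And>r. r \<in> R \<Longrightarrow> fvalid P r"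
  shows "x \<in> gen_ideal P R"
proof -
  define h where "h = fhom (\<lambda>g. if P g then gen g else (0::('a,'b) falg))"
  have h_id: "h z = z" if "fvalid P z" for z
    using fhom_cong_valid[OF that, of _ gen] fhom_gen_id[of z] by (simp add: h_def)
  have h_valid: "fvalid P (h z)" for z
    unfolding h_def by (rule fvalid_fhom[of "\<lambda>_. True"]) (auto simp: fvalid_def[of "\<lambda>_. True"])
  have "h x \<in> gen_ideal P R"
    using assms(1)
  proof (induction rule: gen_ideal.induct)
    case (gen r a b)
    then show ?case using gen_ideal.gen[OF gen(1) h_valid h_valid] h_id assms(3)
      by (simp add: h_def)
  qed (auto simp: h_def intro: gen_ideal.intros)
  then show ?thesis using h_id[OF assms(2)] by simp
qed

definition two_sided :: "'a::ring_1 set \<Rightarrow> bool" where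
  "two_sided I \<longleftrightarrow> 0 \<in> I \<and> (\<forall>x\<in>I. \<forall>y\<in>I. x + y \<in> I) \<and> (\<forall>x\<in>I. \<forall>a b. a * x * b \<in> I)"

lemma two_sided_gen_ideal: "two_sided (gen_ideal (\<lambda>_. True) R)"
  unfolding two_sided_def
  by (auto intro: gen_ideal.intros gen_ideal_mult simp: fvalid_def)

lemma two_sidedD:
  assumes "two_sided I"
  shows "0 \<in> I" "x \<in> I \<Longrightarrow> y \<in> I \<Longrightarrow> x + y \<in> I" "x \<in> I \<Longrightarrow> a * x \<in> I" "x \<in> I \<Longrightarrow> x * a \<in> I"
    "x \<in> I \<Longrightarrow> - x \<in> I" "x \<in> I \<Longrightarrow> y \<in> I \<Longrightarrow> x - y \<in> I"
proof -
  note I = assms[unfolded two_sided_def]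
  show "0 \<in> I" and add: "\<And>x y. x \<in> I \<Longrightarrow> y \<in> I \<Longrightarrow> x + y \<in> I"
    using I by auto
  show l: "a * x \<in> I" if "x \<in> I" for a x using I that by (metis mult.right_neutral)
  show "x * a \<in> I" if "x \<in> I" for a x using I that by (metis mult.left_neutral)
  show m: "- x \<in> I" if "x \<in> I" for x using l[OF that, of "- 1"] by simp
  show "x - y \<in> I" if "x \<in> I" "y \<in> I" for x y using add[OF that(1) m[OF that(2)]] by simp
qed

text \<open>The product of all quotients \<open>'a/I\<close>. An ideal that depends on parameters has no quotient
  type of its own, but its quotient is a (non-unital) factor of this ring.\<close>
quotient_type (overloaded) 'a quots = "'a::ring_1 set \<Rightarrow> 'a" /
  "\<lambda>f g. \<forall>I. two_sided I \<longrightarrow> f I - g I \<in> I"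
proof (rule equivpI)
  show "reflp (\<lambda>f g. \<forall>I. two_sided I \<longrightarrow> f I - g I \<in> I)"
    by (auto simp: reflp_def two_sided_def)
  show "symp (\<lambda>f g. \<forall>I. two_sided I \<longrightarrow> f I - g I \<in> I)"
    unfolding symp_def using two_sidedD(5) by (metis minus_diff_eq)
  show "transp (\<lambda>f g. \<forall>I. two_sided I \<longrightarrow> f I - g I \<in> I)"
    unfolding transp_def using two_sidedD(2) by (metis diff_add_cancel add_diff_eq)
qed

instantiation quots :: (ring_1) ring
begin

lift_definition zero_quots :: "'a quots" is "\<lambda>_. 0" .

lift_definition plus_quots :: "'a quots \<Rightarrow> 'a quots \<Rightarrow> 'a quots" is "\<lambda>f g I. f I + g I"
  using two_sidedD(2) by (metis add_diff_add)

lift_definition uminus_quots :: "'a quots \<Rightarrow> 'a quots" is "\<lambda>f I. - f I"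
  using two_sidedD(5) by (metis minus_diff_minus)

lift_definition minus_quots :: "'a quots \<Rightarrow> 'a quots \<Rightarrow> 'a quots" is "\<lambda>f g I. f I - g I"
proof goal_cases
  case (1 f g h k)
  have "f I - h I - (g I - k I) = (f I - g I) - (h I - k I)" for I by simp
  then show ?case using 1 two_sidedD(6) by metis
qed

lift_definition times_quots :: "'a quots \<Rightarrow> 'a quots \<Rightarrow> 'a quots" is "\<lambda>f g I. f I * g I"
proof goal_cases
  case (1 f g h k)
  have "f I * h I - g I * k I = (f I - g I) * h I + g I * (h I - k I)" for I
    by (simp add: algebra_simps)
  then show ?case using 1 two_sidedD(2,3,4) by metis
qed

instance
  by standard (transfer; simp add: algebra_simps two_sidedD(1))+

end

text \<open>Embeds the quotient by \<open>I\<close> as one factor of the product. The map is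
  additive and multiplicative but not unital: \<open>proj I 1\<close> is the unit of this factor
  only, which is why later identities carry an explicit local unit.\<close>

lift_definition proj :: "'a::ring_1 set \<Rightarrow> 'a \<Rightarrow> 'a quots" is "\<lambda>I x J. if J = I then x else 0" .

lemma proj_add: "proj I (x + y) = proj I x + proj I y"
  and proj_uminus: "proj I (- x) = - proj I x"
  and proj_diff: "proj I (x - y) = proj I x - proj I y"
  and proj_mult: "proj I (x * y) = proj I x * proj I y"
  and proj_0: "proj I 0 = 0"
  by (transfer; simp add: two_sidedD(1))+

lemma proj_sum: "proj I (\<Sum>i\<in>A. f i) = (\<Sum>i\<in>A. proj I (f i))"
  by (induction A rule: infinite_finite_induct) (auto simp: proj_add proj_0)

lemma proj_eq_0_iff: "two_sided I \<Longrightarrow> proj I x = 0 \<longleftrightarrow> x \<in> I"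
  by transfer (auto simp: two_sidedD(1))

lemma proj_one_left: "proj I 1 * proj I x = proj I x" "proj I 1 * (proj I x * z) = proj I x * z"
  and proj_one_right: "proj I x * proj I 1 = proj I x" "proj I x * (proj I 1 * z) = proj I x * z"
  by (simp_all flip: proj_mult mult.assoc)

section \<open>Linear operators\<close>

text \<open>A left action: \<open>foldr\<close> applies the last letter first. Multiplicativity
  needs linear operators for the generators, hence the locale \<open>linear_op\<close>.\<close>

definition act :: "('g \<Rightarrow> ('x \<Rightarrow> 'k::comm_ring_1 fls) \<Rightarrow> 'x \<Rightarrow> 'k fls) \<Rightarrow> ('g, 'k) falg
    \<Rightarrow> ('x \<Rightarrow> 'k fls) \<Rightarrow> 'x \<Rightarrow> 'k fls" where
  "act op x F p = (\<Sum>w\<in>Poly_Mapping.keys x. fls_const (Poly_Mapping.lookup x w) * foldr op (unWd w) F p)"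

lemma act_single: "act op (Poly_Mapping.single w a) F p = fls_const a * foldr op (unWd w) F p"
  by (simp add: act_def)

lemma act_0 [simp]: "act op 0 F p = 0"
  by (simp add: act_def)

lemma act_add [simp]: "act op (x + y) F p = act op x F p + act op y F p"
  unfolding act_def
  by (rule setsum_keys_plus_distrib) (simp_all add: algebra_simps flip: fls_plus_const)

lemma act_uminus [simp]: "act op (- x) F p = - act op x F p"
  using act_add[of op x "- x" F p] by (simp add: eq_neg_iff_add_eq_0 add.commute)

lemma act_diff [simp]: "act op (x - y) F p = act op x F p - act op y F p"
  using act_add[of op x "- y" F p] by simp

lemma act_sum [simp]: "act op (\<Sum>i\<in>A. f i) F p = (\<Sum>i\<in>A. act op (f i) F p)"
  by (induction A rule: infinite_finite_induct) auto

lemma act_sc [simp]: "act op (sc a) F p = fls_const a * F p"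
  by (simp add: sc_def act_single)

lemma act_gen [simp]: "act op (gen g) F = op g F"
  by (rule ext) (simp add: gen_def act_single)

lemma act_1 [simp]: "act op 1 F p = F p"
  using act_sc[of op 1 F p] by simp

lemma act_2 [simp]: "act op 2 F p = 2 * F p"
  using act_add[of op 1 1 F p] by simp

locale linear_op =
  fixes op :: "'g \<Rightarrow> ('x \<Rightarrow> 'k::comm_ring_1 fls) \<Rightarrow> 'x \<Rightarrow> 'k fls"
  assumes op_add: "op g (\<lambda>p. F p + G p) p = op g F p + op g G p"
    and op_scale: "op g (\<lambda>p. k * F p) p = k * op g F p"
begin

lemma foldr_add: "foldr op l (\<lambda>p. F p + G p) = (\<lambda>p. foldr op l F p + foldr op l G p)"
proof (induction l)
  case (Cons g l)
  show ?case by (rule ext) (simp add: Cons op_add)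
qed simp

lemma foldr_scale: "foldr op l (\<lambda>p. k * F p) = (\<lambda>p. k * foldr op l F p)"
proof (induction l)
  case (Cons g l)
  show ?case by (rule ext) (simp add: Cons op_scale)
qed simp

lemma foldr_0: "foldr op l (\<lambda>p. 0) = (\<lambda>p. 0)"
  using foldr_scale[of l 0 "\<lambda>p. 0"] by simp

lemma act_mult [simp]: "act op (x * y) F p = act op x (act op y F) p"
proof (induction x rule: falg_induct)
  case (single w a)
  show ?case
  proof (induction y rule: falg_induct)
    case zero
    have "act op 0 F = (\<lambda>p. 0)" by (rule ext) simp
    then show ?case by (simp add: act_single foldr_0)
  next
    case (single v b)
    have "act op (Poly_Mapping.single v b) F = (\<lambda>p. fls_const b * foldr op (unWd v) F p)"
      by (rule ext) (simp add: act_single)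
    then show ?case
      by (simp add: mult_single act_single foldr_scale algebra_simps flip: fls_const_mult_const)
  next
    case (add x y)
    have "act op (x + y) F = (\<lambda>p. act op x F p + act op y F p)" by (rule ext) simp
    then show ?case using add by (simp add: algebra_simps act_single foldr_add)
  qed
qed (simp_all add: algebra_simps)

end

section \<open>Units in the ring of Laurent series\<close>

text \<open>The ground ring need not be a field, so inverses are chosen where they exist; on
  non-units the value is arbitrary.\<close>

definition uinv :: "'a::comm_ring_1 \<Rightarrow> 'a" where
  "uinv r = (SOME z. z * r = 1)"

lemma uinv_eq: "z * r = 1 \<Longrightarrow> uinv r = z"
proof -
  assume z: "z * r = 1"
  then have "uinv r * r = 1" unfolding uinv_def by (rule someI)
  then have "uinv r * r * z = z" by simp
  then show ?thesis using z by (simp add: mult.assoc mult.commute[of r])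
qed

lemma uinv_mult: "\<exists>z. z * r = 1 \<Longrightarrow> uinv r * r = 1"
  using uinv_eq by metis

lemma uinv_uminus: "\<exists>z. z * r = 1 \<Longrightarrow> uinv (- r) = - uinv r"
  by (rule uinv_eq) (simp add: uinv_mult)

lemma fls_binomial_unit:
  fixes w :: "'k::comm_ring_1"
  assumes "0 < d"
  shows "\<exists>z. z * (1 + fls_const w * fls_X_intpow (int d)) = 1"
proof -
  let ?f = "1 + fps_const w * fps_X ^ d"
  have "fps_left_inverse ?f 1 * ?f = 1"
    using assms by (intro fps_left_inverse) simp
  then have "fps_to_fls (fps_left_inverse ?f 1) * fps_to_fls ?f = 1"
    by (metis fls_times_fps_to_fls fps_one_to_fls)
  moreover have "fps_to_fls ?f = 1 + fls_const w * fls_X_intpow (int d)"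
    by (simp add: fls_times_fps_to_fls fps_to_fls_power fls_X_power_conv_shift_1)
  ultimately show ?thesis by metis
qed

text \<open>Factor out the term of lower exponent, whose coefficient is its own inverse; what
  remains has the form 1 + w t^d with d > 0, a power series with constant coefficient 1.\<close>

lemma fls_X_intpow_sum_unit:
  fixes u v :: "'k::comm_ring_1"
  assumes "a \<noteq> b" "u * u = 1" "v * v = 1"
  shows "\<exists>z. z * (fls_const u * fls_X_intpow (int a) + fls_const v * fls_X_intpow (int b)) = 1"
proof -
  have *: "\<exists>z. z * (fls_const u * fls_X_intpow (int a) + fls_const v * fls_X_intpow (int b)) = 1"
    if "a < b" "u * u = 1" for a b :: nat and u v :: 'k
  proof -
    have "0 < b - a" using that by simp
    from fls_binomial_unit[OF this, of "u * v"]
    obtain z where z: "z * (1 + fls_const (u * v) * fls_X_intpow (int (b - a))) = 1" ..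
    have b: "fls_X_intpow (int b) = fls_X_intpow (int a) * (fls_X_intpow (int (b - a)) :: 'k fls)"
      using that unfolding fls_X_intpow_times_fls_X_intpow by (simp flip: of_nat_add)
    have uu: "fls_const u * fls_const u = (1 :: 'k fls)" using that by simp
    have i: "fls_X_intpow (- int a) * fls_X_intpow (int a) = (1 :: 'k fls)"
      unfolding fls_X_intpow_times_fls_X_intpow by simp
    have "(z * fls_const u * fls_X_intpow (- int a)) * (fls_const u * fls_X_intpow (int a) + fls_const v * fls_X_intpow (int b))
      = (fls_const u * fls_const u) * (fls_X_intpow (- int a) * fls_X_intpow (int a)) * z
        + (fls_X_intpow (- int a) * fls_X_intpow (int a)) * z * (fls_const (u * v) * fls_X_intpow (int (b - a)))"
      unfolding b by (simp add: algebra_simps flip: fls_const_mult_const)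
    also have "\<dots> = z * (1 + fls_const (u * v) * fls_X_intpow (int (b - a)))"
      unfolding uu i by (simp add: algebra_simps)
    finally show ?thesis using z by metis
  qed
  from assms(1) consider "a < b" | "b < a" by linarith
  then show ?thesis using *[of a b u v] *[of b a v u] assms by cases (auto simp: add.commute)
qed

section \<open>Evaluation of bivariate polynomials\<close>

text \<open>The ranges in \<open>beval\<close> and \<open>qval\<close> depend on the degrees of the
  polynomial. On a common square range two polynomials can be compared coefficient by
  coefficient.\<close>

lemma sum_bcoeff_square:
  assumes "\<And>i j. bcoeff q i j = 0 \<Longrightarrow> f i j = (0::'b::comm_monoid_add)"
  shows "\<exists>N0. \<forall>N\<ge>N0. (\<Sum>j\<le>degree q. \<Sum>i\<le>degree (coeff q j). f i j) = (\<Sum>j\<le>N. \<Sum>i\<le>N. f i j)"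
proof (intro exI allI impI)
  fix N assume N: "degree q + (\<Sum>j\<le>degree q. degree (coeff q j)) \<le> N"
  have "(\<Sum>i\<le>degree (coeff q j). f i j) = (\<Sum>i\<le>N. f i j)" if "j \<le> degree q" for j
  proof (rule sum.mono_neutral_left)
    have "degree (coeff q j) \<le> (\<Sum>j\<le>degree q. degree (coeff q j))"
      using that by (intro member_le_sum) auto
    then show "{..degree (coeff q j)} \<subseteq> {..N}" using N by auto
  qed (use assms in \<open>auto simp: bcoeff_def coeff_eq_0\<close>)
  then have "(\<Sum>j\<le>degree q. \<Sum>i\<le>degree (coeff q j). f i j) = (\<Sum>j\<le>degree q. \<Sum>i\<le>N. f i j)"
    by (rule sum.cong[OF refl]) simp
  also have "\<dots> = (\<Sum>j\<le>N. \<Sum>i\<le>N. f i j)"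
    using N assms by (intro sum.mono_neutral_left) (auto simp: bcoeff_def coeff_eq_0)
  finally show "(\<Sum>j\<le>degree q. \<Sum>i\<le>degree (coeff q j). f i j) = (\<Sum>j\<le>N. \<Sum>i\<le>N. f i j)" .
qed

text \<open>The alternative with exchanged indices serves the symmetry between \<open>Q i j\<close>
  and \<open>Q j i\<close>, the other one the sign rules under \<open>c\<close>.\<close>

lemma sum_bcoeff_eq:
  assumes "\<And>i j. bcoeff q i j = 0 \<Longrightarrow> f i j = (0::'b::comm_monoid_add)"
    and "\<And>i j. bcoeff q' i j = 0 \<Longrightarrow> g i j = 0"
    and "(\<forall>i j. f i j = g i j) \<or> (\<forall>i j. f i j = g j i)"
  shows "(\<Sum>j\<le>degree q. \<Sum>i\<le>degree (coeff q j). f i j) = (\<Sum>j\<le>degree q'. \<Sum>i\<le>degree (coeff q' j). g i j)"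
proof -
  obtain N1 where N1: "\<forall>N\<ge>N1. (\<Sum>j\<le>degree q. \<Sum>i\<le>degree (coeff q j). f i j) = (\<Sum>j\<le>N. \<Sum>i\<le>N. f i j)"
    using sum_bcoeff_square[of q f] assms(1) by blast
  obtain N2 where N2: "\<forall>N\<ge>N2. (\<Sum>j\<le>degree q'. \<Sum>i\<le>degree (coeff q' j). g i j) = (\<Sum>j\<le>N. \<Sum>i\<le>N. g i j)"
    using sum_bcoeff_square[of q' g] assms(2) by blast
  define N where "N = max N1 N2"
  have "(\<Sum>j\<le>N. \<Sum>i\<le>N. f i j) = (\<Sum>j\<le>N. \<Sum>i\<le>N. g i j)"
    using assms(3)
  proof
    assume "\<forall>i j. f i j = g j i"
    then have "(\<Sum>j\<le>N. \<Sum>i\<le>N. f i j) = (\<Sum>j\<le>N. \<Sum>i\<le>N. g j i)" by simp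
    then show ?thesis by (subst (asm) (2) sum.swap) simp
  qed simp
  moreover have "N1 \<le> N" "N2 \<le> N" by (simp_all add: N_def)
  ultimately show ?thesis using N1[rule_format, of N] N2[rule_format, of N] by (simp only:)
qed

definition qval :: "'k::comm_ring_1 poly poly \<Rightarrow> 'k fls \<Rightarrow> 'k fls \<Rightarrow> 'k fls" where
  "qval q u v = (\<Sum>j\<le>degree q. \<Sum>i\<le>degree (coeff q j). fls_const (bcoeff q i j) * u ^ i * v ^ j)"

lemma qval_swap:
  assumes "\<And>a b. bcoeff q a b = bcoeff q' b a"
  shows "qval q u v = qval q' v u"
  unfolding qval_def using assms by (intro sum_bcoeff_eq) (auto simp: algebra_simps)

lemma qval_uminus_left:
  assumes "\<And>a b. (- 1) ^ a * bcoeff q a b = bcoeff q' a b"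
  shows "qval q (- u) v = qval q' u v"
proof -
  have "fls_const (bcoeff q a b) * (- u) ^ a = fls_const (bcoeff q' a b) * u ^ a" for a b
    using assms[of a b, symmetric] by (cases "even a") (auto simp: fls_const_uminus)
  then show ?thesis
    unfolding qval_def by (intro sum_bcoeff_eq) auto
qed

section \<open>A representation by weighted permutations of points\<close>

text \<open>A site \<open>(m, s, j)\<close> carries the coordinate \<open>t^m\<close> or \<open>- t^m\<close> (the latter if \<open>s\<close>) and the
  label \<open>j\<close>; a point is a list of sites.\<close>
type_synonym 'j site = "nat \<times> bool \<times> 'j"

definition sneg :: "'j site \<Rightarrow> bool" where "sneg s = fst (snd s)"

definition slab :: "'j site \<Rightarrow> 'j" where "slab s = snd (snd s)"

definition sval :: "'j site \<Rightarrow> 'k::comm_ring_1 fls" where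
  "sval s = (if sneg s then - fls_X_intpow (int (fst s)) else fls_X_intpow (int (fst s)))"

text \<open>The geometric part of c_p: negating the coordinate makes c_p anticommute with y_p, and
  applying \<open>c\<close> to the label accounts for its effect on e(nu).\<close>

definition sflip :: "('j \<Rightarrow> 'j) \<Rightarrow> 'j site \<Rightarrow> 'j site" where
  "sflip c s = (fst s, \<not> sneg s, c (slab s))"

definition ssgn :: "'j site \<Rightarrow> 'k::comm_ring_1 fls" where
  "ssgn s = (if sneg s then - 1 else 1)"

definition pts :: "nat \<Rightarrow> 'j site list set" where
  "pts n = {x. length x = n \<and> distinct (map fst x)}"

text \<open>The Jordan--Wigner sign makes flips at different positions anticommute.\<close>
definition jw :: "nat \<Rightarrow> 'j site list \<Rightarrow> 'k::comm_ring_1 fls" where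
  "jw p x = (\<Prod>q<p. ssgn (x ! q))"

text \<open>The value of R at two sites with coordinates u and v. A fixed label needs no separate
  case: both pole terms are then present, and their sum is 2(u^2+v^2)/(u^2-v^2)^2. On equivalent
  labels the polynomial vanishes.\<close>

definition R_weight :: "('j \<Rightarrow> 'j) \<Rightarrow> ('j \<Rightarrow> 'j \<Rightarrow> 'k::comm_ring_1 poly poly) \<Rightarrow> 'j site \<Rightarrow> 'j site \<Rightarrow> 'k fls" where
  "R_weight c Q s t = qval (Q (slab s) (slab t)) (sval s) (sval t)
     - (if slab s = slab t then uinv (sval s - sval t) ^ 2 else 0)
     - (if slab s = c (slab t) then uinv (sval s + sval t) ^ 2 else 0)"

text \<open>The sign is that of a swap of fermions. Since the positions \<open>m\<close> are distinct, the factor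
  \<open>R = \<tau>\<^sup>2\<close> can be placed on just one of the two orders of \<open>s\<close> and \<open>t\<close>.\<close>
definition tau_weight :: "('j \<Rightarrow> 'j) \<Rightarrow> ('j \<Rightarrow> 'j \<Rightarrow> 'k::comm_ring_1 poly poly) \<Rightarrow> 'j site \<Rightarrow> 'j site \<Rightarrow> 'k fls" where
  "tau_weight c Q s t = (if sneg s \<and> sneg t then - 1 else 1) * (if fst s < fst t then R_weight c Q s t else 1)"

text \<open>The relations are claimed only at points of \<open>pts n\<close>, where exponents at
  distinct positions differ; elsewhere the chosen inverses may be meaningless.\<close>

fun sop :: "('j \<Rightarrow> 'j) \<Rightarrow> ('j \<Rightarrow> 'j \<Rightarrow> 'k::comm_ring_1 poly poly) \<Rightarrow> 'j sgen
    \<Rightarrow> ('j site list \<Rightarrow> 'k fls) \<Rightarrow> 'j site list \<Rightarrow> 'k fls" where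
  "sop c Q (SY p) F x = sval (x ! p) * F x"
| "sop c Q (SCl p) F x = jw p x * F (x[p := sflip c (x ! p)])"
| "sop c Q (SE \<nu>) F x = (if map slab x = \<nu> then F x else 0)"
| "sop c Q (SDm a b) F x = uinv (sval (x ! a) - sval (x ! b)) * F x"
| "sop c Q (SDp a b) F x = uinv (sval (x ! a) + sval (x ! b)) * F x"
| "sop c Q (ST k) F x = tau_weight c Q (x ! k) (x ! Suc k) * F (lsw k x)"

interpretation sop: linear_op "sop c Q" for c :: "'j \<Rightarrow> 'j" and Q :: "'j \<Rightarrow> 'j \<Rightarrow> 'k::comm_ring_1 poly poly"
proof
  show "sop c Q g (\<lambda>p. F p + G p) p = sop c Q g F p + sop c Q g G p" for g F G p
    by (cases g) (simp_all add: algebra_simps)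
  show "sop c Q g (\<lambda>p. k * F p) p = k * sop c Q g F p" for g k F p
    by (cases g) (simp_all add: algebra_simps)
qed

section \<open>Effect of swaps and flips on points and signs\<close>

lemma finite_Jn [simp]: "finite (Jn n :: 'j::finite list set)"
  using finite_lists_length_eq[of "UNIV :: 'j set" n] by (simp add: Jn_def)

lemma length_lsw [simp]: "length (lsw k x) = length x"
  by (simp add: lsw_def)

lemma length_capp [simp]: "length (capp c p x) = length x"
  by (simp add: capp_def)

lemma nth_lsw: "Suc k < length x \<Longrightarrow> p < length x \<Longrightarrow> lsw k x ! p = x ! sw k p"
  by (auto simp: lsw_def sw_def nth_list_update)

lemma sw_less: "Suc k < n \<Longrightarrow> p < n \<Longrightarrow> sw k p < n"
  by (auto simp: sw_def)

lemma sw_sw [simp]: "sw k (sw k p) = p"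
  by (auto simp: sw_def)

lemma map_lsw: "Suc k < length x \<Longrightarrow> map f (lsw k x) = lsw k (map f x)"
  by (simp add: lsw_def map_update)

lemma lsw_lsw [simp]: "Suc k < length x \<Longrightarrow> lsw k (lsw k x) = x"
  by (rule nth_equalityI) (auto simp: nth_lsw sw_less)

lemma lsw_update: "Suc k < length x \<Longrightarrow> p < length x \<Longrightarrow> lsw k (x[p := z]) = (lsw k x)[sw k p := z]"
  by (rule nth_equalityI) (auto simp: nth_lsw sw_less nth_list_update)

lemma lsw_far:
  "Suc i < length x \<Longrightarrow> Suc j < length x \<Longrightarrow> i + 1 < j \<or> j + 1 < i \<Longrightarrow> lsw j (lsw i x) = lsw i (lsw j x)"
  by (rule nth_equalityI) (simp_all add: nth_lsw sw_less, auto simp: sw_def)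

lemma lsw_braid:
  "Suc (Suc i) < length x \<Longrightarrow> lsw (Suc i) (lsw i (lsw (Suc i) x)) = lsw i (lsw (Suc i) (lsw i x))"
  by (rule nth_equalityI) (simp_all add: nth_lsw sw_less, auto simp: sw_def)

lemma pts_lsw: "x \<in> pts n \<Longrightarrow> Suc k < n \<Longrightarrow> lsw k x \<in> pts n"
  using distinct_swap[of k "map fst x" "Suc k"] by (auto simp: pts_def map_lsw) (simp add: lsw_def)

lemma map_fst_flip: "map fst (p[q := sflip c (p ! q)]) = map fst p"
  by (simp add: map_update sflip_def) (metis list_update_id list_update_beyond map_update nth_map not_less length_map)

lemma pts_flip: "x \<in> pts n \<Longrightarrow> x[p := sflip c (x ! p)] \<in> pts n"
  unfolding pts_def mem_Collect_eq map_fst_flip by simp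

lemma ssgn_square [simp]: "ssgn s * ssgn s = 1"
  by (simp add: ssgn_def)

lemma jw_square [simp]: "jw p x * jw p x = 1"
  by (simp add: jw_def flip: prod.distrib)

lemma fst_sflip [simp]: "fst (sflip c s) = fst s"
  and slab_sflip [simp]: "slab (sflip c s) = c (slab s)"
  and sneg_sflip [simp]: "sneg (sflip c s) = (\<not> sneg s)"
  and sval_sflip [simp]: "sval (sflip c s) = - sval s"
  and ssgn_sflip [simp]: "ssgn (sflip c s) = - ssgn s"
  by (simp_all add: sflip_def slab_def sneg_def sval_def ssgn_def)

text \<open>A single factor of the sign product changes, and it is present only if the flipped
  position precedes \<open>q\<close>.\<close>

lemma jw_update:
  assumes "p < length x"
  shows "jw q (x[p := sflip c (x ! p)]) = (if p < q then - jw q x else jw q x)"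
proof (cases "p < q")
  case True
  have *: "(\<Prod>i<q. ssgn (y ! i)) = ssgn (y ! p) * (\<Prod>i\<in>{..<q} - {p}. ssgn (y ! i))" for y :: "'a site list"
    using True by (intro prod.remove) auto
  have "(\<Prod>i\<in>{..<q} - {p}. ssgn (x[p := sflip c (x ! p)] ! i)) = (\<Prod>i\<in>{..<q} - {p}. ssgn (x ! i))"
    by (rule prod.cong) auto
  then show ?thesis
    unfolding jw_def *[of x] *[of "x[p := sflip c (x ! p)]"] using True assms by simp
next
  case False
  then show ?thesis unfolding jw_def by (auto intro!: prod.cong)
qed

text \<open>The product of the first \<open>p\<close> signs notices a swap only if it ends between
  the two exchanged positions, that is, for \<open>p = Suc k\<close>.\<close>

lemma jw_lsw:
  assumes "Suc k < length x" "p < length x"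
  shows "jw p (lsw k x) = (if p = Suc k then jw k x * ssgn (x ! Suc k) else jw p x)"
proof -
  have low: "jw q (lsw k x) = jw q x" if "q \<le> k" for q
    unfolding jw_def using that assms by (intro prod.cong) (auto simp: nth_lsw sw_def)
  have Suc_jw: "jw (Suc q) y = jw q y * ssgn (y ! q)" for q and y :: "'a site list"
    by (simp add: jw_def)
  have high: "q < length x \<Longrightarrow> jw q (lsw k x) = jw q x" if "Suc (Suc k) \<le> q" for q
    using that
  proof (induction q rule: dec_induct)
    case base
    then show ?case using assms by (simp add: Suc_jw low nth_lsw) (simp add: sw_def)
  next
    case (step q)
    then show ?case using assms by (simp add: Suc_jw nth_lsw) (simp add: sw_def)
  qed
  consider "p \<le> k" | "p = Suc k" | "Suc (Suc k) \<le> p" by linarith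
  then show ?thesis using assms
    by cases (auto simp: low high Suc_jw nth_lsw, simp add: sw_def)
qed

lemma sval_diff_unit:
  fixes s t :: "'j site"
  assumes "fst s \<noteq> fst t"
  shows "\<exists>z. z * (sval s - sval t :: 'k::comm_ring_1 fls) = 1" "\<exists>z. z * (sval s + sval t :: 'k fls) = 1"
proof -
  have *: "(sval s :: 'k fls) = fls_const (if sneg s then - 1 else 1) * fls_X_intpow (int (fst s))" for s :: "'j site"
    by (simp add: sval_def)
  have **: "(sval s - sval t :: 'k fls) = sval s + fls_const (if sneg t then 1 else - 1) * fls_X_intpow (int (fst t))"
    by (simp add: sval_def)
  show "\<exists>z. z * (sval s - sval t :: 'k::comm_ring_1 fls) = 1" 
    unfolding ** unfolding * using assms by (intro fls_X_intpow_sum_unit) auto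
  show "\<exists>z. z * (sval s + sval t :: 'k::comm_ring_1 fls) = 1" 
    unfolding * using assms by (intro fls_X_intpow_sum_unit) auto
qed

section \<open>The operators on points satisfy the relations of SK_n\<close>

locale rc_data =
  fixes c :: "'j::finite \<Rightarrow> 'j"
    and Q :: "'j \<Rightarrow> 'j \<Rightarrow> 'k::comm_ring_1 poly poly"
    and n :: nat
  assumes two_inv: "\<exists>u::'k. 2 * u = 1"
    and c_inv [simp]: "c (c j) = j"
    and Q_swap: "bcoeff (Q j i) a b = bcoeff (Q i j) b a"
    and Q_c1: "(- 1) ^ a * bcoeff (Q (c i) j) a b = bcoeff (Q i j) a b"
    and Q_c2: "(- 1) ^ b * bcoeff (Q i (c j)) a b = bcoeff (Q i j) a b"
    and Q_zero: "pr_eq c i j \<Longrightarrow> Q i j = 0"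
begin

lemma c_eq_iff: "c i = j \<longleftrightarrow> i = c j"
  by (metis c_inv)

lemma capp_capp [simp]: "capp c p (capp c p \<nu>) = \<nu>"
  by (cases "p < length \<nu>") (simp_all add: capp_def not_less list_update_beyond)

lemma sflip_sflip [simp]: "sflip c (sflip c s) = s"
  by (simp add: sflip_def sneg_def slab_def)

lemma qval_Q_swap: "qval (Q j i) v u = qval (Q i j) u v"
  by (rule qval_swap) (rule Q_swap)

lemma qval_Q_c1: "qval (Q (c i) j) (- u) v = qval (Q i j) u v"
  by (rule qval_uminus_left) (rule Q_c1)

lemma R_weight_commute:
  assumes "fst s \<noteq> fst t"
  shows "R_weight c Q s t = R_weight c Q t s"
proof -
  have "uinv (sval t - sval s :: 'k fls) = - uinv (sval s - sval t)"
    using uinv_uminus[OF sval_diff_unit(1)[OF assms]] by simp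
  then show ?thesis
    by (auto simp: R_weight_def qval_Q_swap[of "slab t"] add.commute)
qed

text \<open>A flip negates the coordinate and applies \<open>c\<close> to the label, which exchanges
  the pole terms of difference and sum; the resulting signs disappear in the squares.\<close>

lemma R_weight_flip_left:
  assumes "fst s \<noteq> fst t"
  shows "R_weight c Q (sflip c s) t = R_weight c Q s t"
proof -
  have "uinv (- sval s - sval t :: 'k fls) = - uinv (sval s + sval t)"
    using uinv_uminus[OF sval_diff_unit(2)[OF assms]] by simp
  moreover have "uinv (- sval s + sval t :: 'k fls) = - uinv (sval s - sval t)"
    using uinv_uminus[OF sval_diff_unit(1)[OF assms]] by simp
  ultimately show ?thesis
    by (auto simp: R_weight_def qval_Q_c1 c_eq_iff)
qed

lemma R_weight_flip_right:
  assumes "fst s \<noteq> fst t"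
  shows "R_weight c Q s (sflip c t) = R_weight c Q s t"
  using R_weight_flip_left[of t s] R_weight_commute[of s t] R_weight_commute[of s "sflip c t"] assms
  by (metis fst_sflip)

text \<open>Exactly one of the two orders carries R, and the fermionic sign squares to 1.\<close>

lemma tau_weight_mult:
  assumes "fst s \<noteq> fst t"
  shows "tau_weight c Q s t * tau_weight c Q t s = R_weight c Q s t"
  using assms R_weight_commute[OF assms] by (auto simp: tau_weight_def)

text \<open>Flipping one site changes whether both are negative exactly when the other one is
  negative. This sign has to balance the change of \<open>jw\<close> when tau_k passes c_p.\<close>

lemma tau_weight_flip:
  assumes "fst s \<noteq> fst t"
  shows "tau_weight c Q (sflip c s) t = ssgn t * tau_weight c Q s t"
    and "tau_weight c Q s (sflip c t) = ssgn s * tau_weight c Q s t"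
  using assms R_weight_flip_left[OF assms] R_weight_flip_right[OF assms]
  by (auto simp: tau_weight_def ssgn_def)

lemma sop_power_Y: "act (sop c Q) (gen (SY a) ^ i) F x = sval (x ! a) ^ i * F x"
  by (induction i arbitrary: x) simp_all

lemma sop_beval:
  "act (sop c Q) (beval q (gen (SY a)) (gen (SY b))) F x = qval q (sval (x ! a)) (sval (x ! b)) * F x"
  by (simp add: beval_def qval_def sop_power_Y sum_distrib_right mult.assoc)

lemma pts_fst_neq: "x \<in> pts n \<Longrightarrow> a < n \<Longrightarrow> b < n \<Longrightarrow> a \<noteq> b \<Longrightarrow> fst (x ! a) \<noteq> fst (x ! b)"
  by (auto simp: pts_def distinct_conv_nth)

lemma pts_length: "x \<in> pts n \<Longrightarrow> length x = n"
  by (simp add: pts_def)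

lemma sum_Jn_delta:
  fixes x :: "'j site list"
  assumes "x \<in> pts n"
  shows "(\<Sum>\<nu> \<in> {\<nu> \<in> Jn n. P \<nu>}. if map slab x = \<nu> then f \<nu> else 0) = (if P (map slab x) then f (map slab x) else 0)"
proof -
  have "finite {\<nu> \<in> Jn n. P \<nu>}" by simp
  then have "(\<Sum>\<nu> \<in> {\<nu> \<in> Jn n. P \<nu>}. if map slab x = \<nu> then f \<nu> else 0)
      = (if map slab x \<in> {\<nu> \<in> Jn n. P \<nu>} then f (map slab x) else 0)"
    by (rule sum.delta')
  then show ?thesis using assms by (simp add: pts_def Jn_def)
qed

lemma sop_Rab:
  assumes x: "x \<in> pts n" and ab: "a < n" "b < n" "a \<noteq> b"
  shows "act (sop c Q) (Rab c Q n a b) F x = R_weight c Q (x ! a) (x ! b) * F x"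
proof -
  define u v where "u = (sval (x ! a) :: 'k fls)" and "v = (sval (x ! b) :: 'k fls)"
  have D: "uinv (u - v) * (u - v) = 1" "uinv (u + v) * (u + v) = 1"
    unfolding u_def v_def
    by (rule uinv_mult[OF sval_diff_unit(1)[OF pts_fst_neq[OF x ab]]],
        rule uinv_mult[OF sval_diff_unit(2)[OF pts_fst_neq[OF x ab]]])
  \<comment> \<open>Partial fractions: this merges the case of a fixed label with the two pole terms
    of \<open>R_weight\<close>.\<close>
  have id: "2 * (u\<^sup>2 + v\<^sup>2) * (d\<^sup>2 * p\<^sup>2) = d\<^sup>2 + p\<^sup>2" if "d * (u - v) = 1" "p * (u + v) = 1" for d p
  proof -
    have "2 * (u\<^sup>2 + v\<^sup>2) * (d\<^sup>2 * p\<^sup>2) = d\<^sup>2 * (p * (u + v))\<^sup>2 + (d * (u - v))\<^sup>2 * p\<^sup>2"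
      by (simp add: algebra_simps power2_eq_square)
    then show ?thesis using that by simp
  qed
  have len: "length x = n" using x by (rule pts_length)
  have Q0: "qval (Q i j) u v = 0" if "pr_eq c i j" for i j
    using Q_zero[OF that] by (simp add: qval_def bcoeff_def)
  let ?i = "slab (x ! a)" and ?j = "slab (x ! b)"
  have t1: "act (sop c Q) (beval q (gen (SY a)) (gen (SY b)) * gen (SE \<nu>)) F x
      = (if map slab x = \<nu> then qval q u v * F x else 0)" for q \<nu>
    by (simp add: sop_beval u_def v_def)
  have t2: "act (sop c Q) (gen (SDm a b) ^ 2 * gen (SE \<nu>)) F x
      = (if map slab x = \<nu> then uinv (u - v) * (uinv (u - v) * F x) else 0)" for \<nu>
    by (simp add: power2_eq_square u_def v_def)
  have t3: "act (sop c Q) (gen (SDp a b) ^ 2 * gen (SE \<nu>)) F x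
      = (if map slab x = \<nu> then uinv (u + v) * (uinv (u + v) * F x) else 0)" for \<nu>
    by (simp add: power2_eq_square u_def v_def)
  have t4: "act (sop c Q) (2 * (gen (SY a) ^ 2 + gen (SY b) ^ 2) * (gen (SDm a b) ^ 2 * gen (SDp a b) ^ 2) * gen (SE \<nu>)) F x
      = (if map slab x = \<nu> then 2 * (u\<^sup>2 + v\<^sup>2) * ((uinv (u - v))\<^sup>2 * (uinv (u + v))\<^sup>2) * F x else 0)" for \<nu>
    by (simp add: power2_eq_square u_def v_def algebra_simps)
  have "act (sop c Q) (Rab c Q n a b) F x
     = (if \<not> pr_eq c ?i ?j then qval (Q ?i ?j) u v * F x else 0)
       - (if ?i = ?j \<and> c ?i \<noteq> ?i then uinv (u - v) * (uinv (u - v) * F x) else 0)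
       - (if ?i = c ?j \<and> c ?i \<noteq> ?i then uinv (u + v) * (uinv (u + v) * F x) else 0)
       - (if ?i = ?j \<and> c ?i = ?i then 2 * (u\<^sup>2 + v\<^sup>2) * ((uinv (u - v))\<^sup>2 * (uinv (u + v))\<^sup>2) * F x else 0)"
    unfolding Rab_def Let_def act_diff act_sum t1 t2 t3 t4 sum_Jn_delta[OF x]
    using ab len by (simp add: u_def v_def power2_eq_square mult.assoc)
  also have "\<dots> = R_weight c Q (x ! a) (x ! b) * F x"
    unfolding id[OF D] R_weight_def u_def[symmetric] v_def[symmetric]
    using Q0[of ?i ?j] by (auto simp: pr_eq_def power2_eq_square algebra_simps)
  finally show ?thesis .
qed

lemma unit_cancel:
  fixes u v d f :: "'a::comm_ring_1"
  shows "d * (u - v) = 1 \<Longrightarrow> d * (u * f - v * f) = f"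
    and "d * (u - v) = 1 \<Longrightarrow> u * (d * f) - v * (d * f) = f"
    and "d * (u + v) = 1 \<Longrightarrow> d * (u * f + v * f) = f"
    and "d * (u + v) = 1 \<Longrightarrow> u * (d * f) + v * (d * f) = f"
proof -
  have "d * (u * f - v * f) = (d * (u - v)) * f" "u * (d * f) - v * (d * f) = (d * (u - v)) * f"
    "d * (u * f + v * f) = (d * (u + v)) * f" "u * (d * f) + v * (d * f) = (d * (u + v)) * f"
    by (simp_all add: algebra_simps)
  then show "d * (u - v) = 1 \<Longrightarrow> d * (u * f - v * f) = f"
    and "d * (u - v) = 1 \<Longrightarrow> u * (d * f) - v * (d * f) = f"
    and "d * (u + v) = 1 \<Longrightarrow> d * (u * f + v * f) = f"
    and "d * (u + v) = 1 \<Longrightarrow> u * (d * f) + v * (d * f) = f"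
    by simp_all
qed

lemma SK_rels_act:
  assumes r: "r \<in> SK_rels c Q n" and x: "x \<in> pts n"
  shows "act (sop c Q) r F x = 0"
proof -
  note len = pts_length[OF x]
  have U: "uinv (sval (x ! a) - sval (x ! b) :: 'k fls) * (sval (x ! a) - sval (x ! b)) = 1"
    "uinv (sval (x ! a) + sval (x ! b) :: 'k fls) * (sval (x ! a) + sval (x ! b)) = 1"
    if "a < n" "b < n" "a \<noteq> b" for a b
    by (rule uinv_mult[OF sval_diff_unit(1)[OF pts_fst_neq[OF x that]]],
        rule uinv_mult[OF sval_diff_unit(2)[OF pts_fst_neq[OF x that]]])
  \<comment> \<open>Cases 1 to 7 are the relations of MA_n, 8 to 11 the inverses, 12 and 13 the
    braid relations, 14 the square of tau_k, and 15 the passage of tau_k past the other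
    generators.\<close>
  show ?thesis
    using r unfolding SK_rels_def MA_rels_def Let_def
  proof (elim UnE, goal_cases)
    case 1
    then show ?case by auto
  next
    case 2
    then show ?case using sum_Jn_delta[OF x, where P = "\<lambda>_. True" and f = "\<lambda>_. F x"] by auto
  next
    case 3
    then show ?case by auto
  next
    case 4
    have "map slab (x[p := sflip c (x ! p)]) = \<nu> \<longleftrightarrow> map slab x = capp c p \<nu>" if "p < n" for p \<nu>
    proof -
      have "map slab (x[p := sflip c (x ! p)]) = capp c p (map slab x)"
        using that len by (simp add: capp_def map_update)
      then show ?thesis by (metis capp_capp)
    qed
    with 4 show ?case by auto
  next
    case 5
    then show ?case by (auto simp: mult.left_commute)
  next
    case 6
    then show ?case by (auto simp: len jw_update list_update_swap mult.assoc[symmetric])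
  next
    case 7
    then show ?case by (auto simp: len)
  next
    case 8
    then show ?case using unit_cancel(1)[OF U(1)] by auto
  next
    case 9
    then show ?case using unit_cancel(2)[OF U(1)] by auto
  next
    case 10
    then show ?case using unit_cancel(3)[OF U(2)] by auto
  next
    case 11
    then show ?case using unit_cancel(4)[OF U(2)] by auto
  next
    case 12
    then obtain i j where ij: "r = gen (ST i) * gen (ST j) - gen (ST j) * gen (ST i)"
      "Suc i < n" "Suc j < n" "i + 1 < j \<or> j + 1 < i" by auto
    moreover have "lsw j (lsw i x) = lsw i (lsw j x)"
      using ij lsw_far[where i = i and j = j and x = x] len by auto
    ultimately show ?case
      by (simp add: len nth_lsw sw_less) (auto simp: sw_def)
  next
    case 13
    then obtain i where i: "r = gen (ST (i + 1)) * gen (ST i) * gen (ST (i + 1)) - gen (ST i) * gen (ST (i + 1)) * gen (ST i)"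
      "i + 2 < n" by auto
    moreover have "lsw (Suc i) (lsw i (lsw (Suc i) x)) = lsw i (lsw (Suc i) (lsw i x))"
      using i lsw_braid[where i = i and x = x] len by auto
    ultimately show ?case
      by (simp add: len nth_lsw sw_less) (simp add: sw_def)
  next
    case 14
    then show ?case
      using tau_weight_mult[OF pts_fst_neq[OF x]]
      by (auto simp: len sop_Rab[OF x] nth_lsw mult.assoc[symmetric]) (simp add: sw_def)
  next
    case 15
    then obtain k g where kg: "r = gen (ST k) * gen g - gen (sact k g) * gen (ST k)"
      "Suc k < n" "svalid n g" "MKgen g" by auto
    show ?case
    proof (cases g)
      \<comment> \<open>For \<open>p = k\<close> and \<open>p = Suc k\<close> the sign by which
        \<open>jw\<close> changes under the swap cancels against the sign of
        \<open>tau_weight\<close> under the flip; at other positions neither changes.\<close>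
      case (SCl p)
      have ne: "fst (x ! k) \<noteq> fst (x ! Suc k)" using pts_fst_neq[OF x, of k "Suc k"] kg by simp
      have jS: "jw (Suc k) x = jw k x * ssgn (x ! k)" by (simp add: jw_def)
      have "p < n" using kg SCl by simp
      have L: "lsw k (x[sw k p := z]) = (lsw k x)[p := z]" for z
        using lsw_update[of k x "sw k p" z] kg \<open>p < n\<close> len by (simp add: sw_less)
      have X: "lsw k x ! p = x ! sw k p" using \<open>p < n\<close> kg len by (simp add: nth_lsw)
      consider "p = k" | "p = Suc k" | "p \<noteq> k" "p \<noteq> Suc k" by blast
      then show ?thesis
      proof cases
        case 1
        then have "sw k p = Suc k" by (simp add: sw_def)
        then show ?thesis using 1 kg SCl len L X
          by (simp add: jw_lsw jS tau_weight_flip[OF ne] mult.assoc[symmetric])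
            (simp add: algebra_simps)
      next
        case 2
        then have "sw k p = k" by (simp add: sw_def)
        then show ?thesis using 2 kg SCl len L X
          by (simp add: jw_lsw jS tau_weight_flip[OF ne] mult.assoc[symmetric])
      next
        case 3
        then have "sw k p = p" by (simp add: sw_def)
        then show ?thesis using 3 kg SCl len L X \<open>p < n\<close>
          by (simp add: jw_lsw)
      qed
    next
      case (SE \<nu>)
      have "lsw k (map slab x) = \<nu> \<longleftrightarrow> map slab x = lsw k \<nu>"
      proof -
        have "Suc k < length (map slab x)" "Suc k < length \<nu>" using kg SE len by auto
        then show ?thesis using lsw_lsw by metis
      qed
      then show ?thesis using kg SE by (simp add: len map_lsw)
    qed (use kg in \<open>simp_all add: len nth_lsw sw_less mult.left_commute\<close>)
  qed
qed

text \<open>A relation acts by zero only at points of \<open>pts n\<close>. Elements of the ideal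
  multiply it from the left as well, so vanishing on \<open>pts n\<close> must survive the valid
  generators.\<close>

lemma sop_zero:
  assumes "\<And>x. x \<in> pts n \<Longrightarrow> F x = 0" "svalid n g" "x \<in> pts n"
  shows "sop c Q g F x = 0"
  using assms by (cases g) (auto simp: pts_flip pts_lsw)

lemma act_sop_zero:
  assumes "\<And>x. x \<in> pts n \<Longrightarrow> F x = 0" "fvalid (svalid n) a" "x \<in> pts n"
  shows "act (sop c Q) a F x = 0"
proof -
  have *: "foldr (sop c Q) l F x = 0" if "\<And>g. g \<in> set l \<Longrightarrow> svalid n g" "x \<in> pts n" for l x
    using that
  proof (induction l arbitrary: x)
    case (Cons g l)
    then show ?case using sop_zero[of "foldr (sop c Q) l F" g x] by auto
  qed (use assms in auto)
  show ?thesis using * assms(2,3) by (auto simp: act_def fvalid_def intro!: sum.neutral)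
qed

lemma SK_ideal_act:
  assumes "r \<in> SK_ideal c Q n" and x: "x \<in> pts n"
  shows "act (sop c Q) r F x = 0"
  using assms(1) unfolding SK_ideal_def
proof (induction rule: gen_ideal.induct)
  case (gen r a b)
  have "act (sop c Q) a (act (sop c Q) r (act (sop c Q) b F)) x = 0"
    by (rule act_sop_zero[OF SK_rels_act[OF gen(1)] gen(2) x])
  then show ?case by simp
qed auto

end

section \<open>Identities in rings without unit\<close>

text \<open>Turns a rule for a product of two factors into one that also applies inside a
  right-associated product.\<close>

lemma mult_assoc_left: "a * b = x \<Longrightarrow> a * (b * z) = x * (z :: 'a::semigroup_mult)"
  by (simp flip: mult.assoc)

text \<open>Evaluate \<open>d' * u * x * d\<close> in two ways: what intertwines two elements
  intertwines their inverses. \<open>\<epsilon>\<close> plays the unit of the factor. With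
  \<open>u\<close> a unit as well, this gives uniqueness of inverses.\<close>

lemma inverse_intertwine:
  fixes u x x' d d' \<epsilon> :: "'a::ring"
  assumes "x * d = \<epsilon>" "d' * x' = \<epsilon>" "u * x = x' * u" "u * \<epsilon> = u" "\<epsilon> * u = u"
  shows "u * d = d' * u"
proof -
  have "d' * (u * x) * d = d' * (x' * u) * d" using assms(3) by simp
  then have "d' * (u * (x * d)) = (d' * x') * u * d" by (simp add: mult.assoc)
  then show ?thesis using assms by simp
qed

text \<open>Here \<open>a\<close>, \<open>b\<close>, \<open>d\<close> stand for b_{01}, b_{12},
  b_{02} and the primed letters for their counterparts with poles at sums. Conjugating
  \<open>yb\<close> by \<open>c0\<close>, \<open>c1\<close>, \<open>c2\<close> gives
  \<open>y0\<close>, \<open>y1\<close>, \<open>y2\<close>. After the Clifford generators are moved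
  to the right, the components of the claim at 1, \<open>c0 * c1\<close>, \<open>c1 * c2\<close> and
  \<open>c0 * c2\<close> are exactly these four identities.\<close>

lemma clifford_yang_baxter:
  fixes c0 c1 c2 a b d a' b' d' \<epsilon> :: "'a::ring"
  assumes cc: "c1 * c0 = - (c0 * c1)" "c2 * c0 = - (c0 * c2)" "c2 * c1 = - (c1 * c2)"
    "c0 * c0 = \<epsilon>" "c1 * c1 = \<epsilon>" "c2 * c2 = \<epsilon>"
    and unit: "\<And>z. z \<in> {c0, c1, c2} \<Longrightarrow> \<epsilon> * z = z"
      "\<And>z. z \<in> {c0, c1, c2, a, b, d, a', b', d'} \<Longrightarrow> z * \<epsilon> = z"
    and c0: "c0 * a = - (a' * c0)" "c0 * a' = - (a * c0)" "c0 * d = - (d' * c0)" "c0 * d' = - (d * c0)"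
      "c0 * b = b * c0" "c0 * b' = b' * c0"
    and c1: "c1 * a = a' * c1" "c1 * a' = a * c1" "c1 * b = - (b' * c1)" "c1 * b' = - (b * c1)"
      "c1 * d = d * c1" "c1 * d' = d' * c1"
    and c2: "c2 * b = b' * c2" "c2 * b' = b * c2" "c2 * d = d' * c2" "c2 * d' = d * c2"
      "c2 * a = a * c2" "c2 * a' = a' * c2"
    and yb: "b * a = d * b + a * d"
  shows "(- b + b' * c1 * c2) * (- a + a' * c0 * c1)
    = (- d + d' * c0 * c2) * (- b + b' * c1 * c2) + (- a + a' * c0 * c1) * (- d + d' * c0 * c2)"
proof -
  note ccs = cc(1-3) cc[THEN mult_assoc_left]
  note cbs = c0 c1 c2 c0[THEN mult_assoc_left] c1[THEN mult_assoc_left] c2[THEN mult_assoc_left]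
  have eps: "\<epsilon> * c0 = c0" "\<epsilon> * c1 = c1" "\<epsilon> * c2 = c2" "z * (\<epsilon> * c0) = z * c0"
    "\<epsilon> * (c0 * z) = c0 * z" "\<epsilon> * (c1 * z) = c1 * z" "\<epsilon> * (c2 * z) = c2 * z" for z
    using unit(1) by (simp_all flip: mult.assoc)
  have r: "z * (w * \<epsilon>) = z * w" if "w \<in> {c0, c1, c2, a, b, d, a', b', d'}" for z w
    using unit(2)[OF that] by simp
  have y0: "b * a' = d' * b - a' * d'"
  proof -
    have "c0 * (b * a) * c0 = - (b * a')" "c0 * (d * b + a * d) * c0 = a' * d' - d' * b"
      by (simp_all add: algebra_simps cbs cc r)
    then show ?thesis using yb by (simp add: algebra_simps)
  qed
  have y1: "b' * a' = d * b' - a' * d"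
  proof -
    have "c1 * (b * a) * c1 = - (b' * a')" "c1 * (d * b + a * d) * c1 = a' * d - d * b'"
      by (simp_all add: algebra_simps cbs cc r)
    then show ?thesis using yb by (simp add: algebra_simps)
  qed
  have y2: "b' * a = d' * b' + a * d'"
  proof -
    have "c2 * (b * a) * c2 = b' * a" "c2 * (d * b + a * d) * c2 = a * d' + d' * b'"
      by (simp_all add: algebra_simps cbs cc r)
    then show ?thesis using yb by (simp add: algebra_simps)
  qed
  note ys = yb y0 y1 y2
  show ?thesis
    by (simp add: algebra_simps cbs ccs cc(4-6) eps r ys ys[THEN mult_assoc_left])
qed

text \<open>The mixed terms of the square cancel because \<open>c0 * c1\<close> anticommutes with
  \<open>a\<close> and \<open>a'\<close>. The remaining \<open>a * a + a' * a'\<close> is invariant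
  under the exchange of \<open>a\<close> and \<open>a'\<close> caused by \<open>c0\<close>, and
  \<open>c2\<close> commutes with both.\<close>

lemma clifford_square_central:
  fixes c0 c1 c2 a d a' d' \<epsilon> :: "'a::ring"
  assumes cc: "c1 * c0 = - (c0 * c1)" "c0 * c0 = \<epsilon>" "c1 * c1 = \<epsilon>"
    and unit: "\<epsilon> * c1 = c1" "\<And>z. z \<in> {a, a'} \<Longrightarrow> z * \<epsilon> = z"
    and c: "c0 * a = - (a' * c0)" "c0 * a' = - (a * c0)" "c1 * a = a' * c1" "c1 * a' = a * c1"
      "c2 * a = a * c2" "c2 * a' = a' * c2"
    and comm: "a' * a = a * a'" "d * a = a * d" "d' * a = a * d'" "d * a' = a' * d" "d' * a' = a' * d'"
  shows "(- d + d' * c0 * c2) * ((- a + a' * c0 * c1) * (- a + a' * c0 * c1))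
    = ((- a + a' * c0 * c1) * (- a + a' * c0 * c1)) * (- d + d' * c0 * c2)"
proof -
  have sq: "(- a + a' * c0 * c1) * (- a + a' * c0 * c1) = a * a + a' * a'"
    using unit unit(2)[THEN mult_assoc_left] by (simp add: algebra_simps cc cc[THEN mult_assoc_left] c c[THEN mult_assoc_left] comm comm[THEN mult_assoc_left])
  show ?thesis unfolding sq
    by (simp add: algebra_simps c c[THEN mult_assoc_left] comm comm[THEN mult_assoc_left])
qed

text \<open>Move \<open>s\<close> and \<open>t\<close> to the right and sort by their number. The
  cubic part cancels by the braid relation, the quadratic part is
  \<open>w * (t * t - s * s)\<close>, and the linear part vanishes by \<open>yb\<close>. The rest,
  \<open>v * u * v - u * v * u\<close>, equals \<open>w * v * v - u * u * w\<close> by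
  \<open>yb\<close>; it cancels the squares contributed by \<open>sq\<close>, up to moving
  \<open>w\<close> past \<open>u * u\<close>.\<close>

lemma braid_defect:
  fixes s t u v w q r :: "'a::ring"
  assumes br: "t * s * t = s * t * s"
    and s: "s * u = - (u * s)" "s * v = w * s" "s * w = v * s"
    and t: "t * v = - (v * t)" "t * u = w * t" "t * w = u * t"
    and yb: "v * u = w * v + u * w" "u * v = v * w + w * u"
    and central: "w * (u * u) = u * u * w"
    and sq: "s * s = q - u * u" "t * t = r - v * v"
  shows "(t + v) * (s + u) * (t + v) - (s + u) * (t + v) * (s + u) = w * (r - q)"
proof -
  note st = s t
  have br': "t * (s * t) = s * (t * s)" using br by (simp add: mult.assoc)
  have "(t + v) * (s + u) * (t + v) - (s + u) * (t + v) * (s + u)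
    = w * (t * t) - w * (s * s) + (v * u - w * v - u * w) * t - (u * v - v * w - w * u) * s
      + v * u * v - u * (v * u)"
    by (simp add: algebra_simps br' st st[THEN mult_assoc_left])
  also have "\<dots> = w * (r - v * v) - w * (q - u * u) + v * u * v - u * (v * u)"
    by (simp add: yb sq algebra_simps)
  also have "\<dots> = w * (r - q) + w * (u * u) - u * u * w"
    by (simp add: yb(1) algebra_simps)
  also have "\<dots> = w * (r - q)" using central by simp
  finally show ?thesis .
qed

section \<open>The quiver Hecke--Clifford relations in the localized algebra\<close>

lemma MA_relsI:
  "\<mu> \<in> Jn n \<Longrightarrow> \<nu> \<in> Jn n \<Longrightarrow> e \<mu> * e \<nu> - (if \<mu> = \<nu> then e \<mu> else 0) \<in> MA_rels c n y cc e"
  "(\<Sum>\<nu>\<in>Jn n. e \<nu>) - 1 \<in> MA_rels c n y cc e"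
  "p < n \<Longrightarrow> \<nu> \<in> Jn n \<Longrightarrow> y p * e \<nu> - e \<nu> * y p \<in> MA_rels c n y cc e"
  "p < n \<Longrightarrow> \<nu> \<in> Jn n \<Longrightarrow> cc p * e \<nu> - e (capp c p \<nu>) * cc p \<in> MA_rels c n y cc e"
  "p < n \<Longrightarrow> q < n \<Longrightarrow> y p * y q - y q * y p \<in> MA_rels c n y cc e"
  "p < n \<Longrightarrow> q < n \<Longrightarrow> cc p * cc q + cc q * cc p - (if p = q then 2 else 0) \<in> MA_rels c n y cc e"
  "p < n \<Longrightarrow> q < n \<Longrightarrow> cc p * y q - (if p = q then - 1 else 1) * y q * cc p \<in> MA_rels c n y cc e"
  unfolding MA_rels_def by blast+

lemma SK_relsI:
  fixes c :: "'j::finite \<Rightarrow> 'j" and Q :: "'j \<Rightarrow> 'j \<Rightarrow> 'k::comm_ring_1 poly poly"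
  shows "r \<in> MA_rels c n (\<lambda>p. gen (SY p)) (\<lambda>p. gen (SCl p)) (\<lambda>\<nu>. gen (SE \<nu>)) \<Longrightarrow> r \<in> SK_rels c Q n"
  "a < n \<Longrightarrow> b < n \<Longrightarrow> a \<noteq> b \<Longrightarrow> gen (SDm a b) * (gen (SY a) - gen (SY b)) - 1 \<in> SK_rels c Q n"
  "a < n \<Longrightarrow> b < n \<Longrightarrow> a \<noteq> b \<Longrightarrow> (gen (SY a) - gen (SY b)) * gen (SDm a b) - 1 \<in> SK_rels c Q n"
  "a < n \<Longrightarrow> b < n \<Longrightarrow> a \<noteq> b \<Longrightarrow> gen (SDp a b) * (gen (SY a) + gen (SY b)) - 1 \<in> SK_rels c Q n"
  "a < n \<Longrightarrow> b < n \<Longrightarrow> a \<noteq> b \<Longrightarrow> (gen (SY a) + gen (SY b)) * gen (SDp a b) - 1 \<in> SK_rels c Q n"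
  "Suc i < n \<Longrightarrow> Suc j < n \<Longrightarrow> i + 1 < j \<or> j + 1 < i \<Longrightarrow>
     gen (ST i) * gen (ST j) - gen (ST j) * gen (ST i) \<in> SK_rels c Q n"
  "i + 2 < n \<Longrightarrow> gen (ST (i + 1)) * gen (ST i) * gen (ST (i + 1))
     - gen (ST i) * gen (ST (i + 1)) * gen (ST i) \<in> SK_rels c Q n"
  "Suc k < n \<Longrightarrow> gen (ST k) * gen (ST k) - Rab c Q n k (Suc k) \<in> SK_rels c Q n"
  "Suc k < n \<Longrightarrow> svalid n g \<Longrightarrow> MKgen g \<Longrightarrow> gen (ST k) * gen g - gen (sact k g) * gen (ST k) \<in> SK_rels c Q n"
  unfolding SK_rels_def Let_def by blast+

section \<open>Commutation rules modulo the relations of SK_n\<close>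

context rc_data
begin

definition T :: "('j sgen, 'k) falg \<Rightarrow> ('j sgen, 'k) falg quots" where
  "T = proj (gen_ideal (\<lambda>_. True) (SK_rels c Q n))"

lemma T_add [simp]: "T (x + y) = T x + T y"
  and T_uminus [simp]: "T (- x) = - T x"
  and T_diff [simp]: "T (x - y) = T x - T y"
  and T_mult [simp]: "T (x * y) = T x * T y"
  and T_0 [simp]: "T 0 = 0"
  and T_sum: "T (\<Sum>i\<in>A. f i) = (\<Sum>i\<in>A. T (f i))"
  by (simp_all add: T_def proj_add proj_uminus proj_diff proj_mult proj_0 proj_sum)

lemma T_one [simp]: "T 1 * T x = T x" "T 1 * (T x * z) = T x * z" "T x * T 1 = T x" "T x * (T 1 * z) = T x * z"
  by (simp_all only: T_def proj_one_left proj_one_right)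

lemma T_eq_0_iff: "T x = 0 \<longleftrightarrow> x \<in> gen_ideal (\<lambda>_. True) (SK_rels c Q n)"
  unfolding T_def by (rule proj_eq_0_iff) (rule two_sided_gen_ideal)

lemma T_rel: "r \<in> SK_rels c Q n \<Longrightarrow> T r = 0"
  using T_eq_0_iff gen_ideal_rel by blast

lemma T_sc_commute: "T (sc a) * T x = T x * T (sc a)"
  by (metis T_mult sc_commute)

abbreviation "tY p \<equiv> T (gen (SY p))"
abbreviation "tC p \<equiv> T (gen (SCl p))"
abbreviation "tE \<nu> \<equiv> T (gen (SE \<nu>))"
abbreviation "tM a b \<equiv> T (gen (SDm a b))"
abbreviation "tP a b \<equiv> T (gen (SDp a b))"
abbreviation "tT k \<equiv> T (gen (ST k))"

text \<open>Sums of the e(nu) indexed by a predicate: their products become conjunctions, and moving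
  them past c_p or tau_k becomes a substitution in the predicate.\<close>

definition esum :: "('j list \<Rightarrow> bool) \<Rightarrow> ('j sgen, 'k) falg" where
  "esum P = (\<Sum>\<nu>\<in>{\<nu> \<in> Jn n. P \<nu>}. gen (SE \<nu>))"

abbreviation "tS P \<equiv> T (esum P)"

lemmas T_MA_rel = T_rel[OF SK_relsI(1)]

lemma tE_tE: "\<mu> \<in> Jn n \<Longrightarrow> \<nu> \<in> Jn n \<Longrightarrow> tE \<mu> * tE \<nu> = (if \<mu> = \<nu> then tE \<mu> else 0)"
  by (drule (1) T_MA_rel[OF MA_relsI(1)]) (simp split: if_splits)

lemma tS_True: "tS (\<lambda>_. True) = T 1"
  using T_MA_rel[OF MA_relsI(2)] by (simp add: esum_def)

lemma tY_tE: "p < n \<Longrightarrow> \<nu> \<in> Jn n \<Longrightarrow> tY p * tE \<nu> = tE \<nu> * tY p"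
  by (drule (1) T_MA_rel[OF MA_relsI(3)]) simp

lemma tC_tE: "p < n \<Longrightarrow> \<nu> \<in> Jn n \<Longrightarrow> tC p * tE \<nu> = tE (capp c p \<nu>) * tC p"
  by (drule (1) T_MA_rel[OF MA_relsI(4)]) simp

lemma tY_tY: "p < n \<Longrightarrow> q < n \<Longrightarrow> tY p * tY q = tY q * tY p"
  by (drule (1) T_MA_rel[OF MA_relsI(5)]) simp

lemma tC_tC: "p < n \<Longrightarrow> q < n \<Longrightarrow> p \<noteq> q \<Longrightarrow> tC p * tC q = - (tC q * tC p)"
  by (drule (1) T_MA_rel[OF MA_relsI(6)]) (simp add: eq_neg_iff_add_eq_0)

text \<open>The relation for p = q only says 2 c_p^2 = 2, so the inverse of 2 is needed.\<close>

lemma tC_square: "p < n \<Longrightarrow> tC p * tC p = T 1"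
proof -
  assume p: "p < n"
  obtain u :: 'k where "2 * u = 1" using two_inv by blast
  then have u: "sc u + sc u = (1 :: ('j sgen, 'k) falg)"
    by (metis mult_2 sc_1 sc_add)
  have half: "T (sc u) * (T x + T x) = T x" for x
    by (metis T_add T_mult T_one(1) distrib_left distrib_right u)
  have "T (gen (SCl p) * gen (SCl p)) + T (gen (SCl p) * gen (SCl p)) = T 1 + T 1"
    using T_MA_rel[OF MA_relsI(6)[OF p p]] T_add[of 1 1] by simp
  then show ?thesis using half by (metis T_mult)
qed

lemma tC_tY: "p < n \<Longrightarrow> q < n \<Longrightarrow> tC p * tY q = (if p = q then - (tY q * tC p) else tY q * tC p)"
  by (drule (1) T_MA_rel[OF MA_relsI(7)]) (simp add: eq_neg_iff_add_eq_0 split: if_splits)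

lemma tM_inv: 
  assumes "a < n" "b < n" "a \<noteq> b"
  shows "tM a b * (tY a - tY b) = T 1" "(tY a - tY b) * tM a b = T 1"
    "tP a b * (tY a + tY b) = T 1" "(tY a + tY b) * tP a b = T 1"
  using SK_relsI(2-5)[OF assms, THEN T_rel] by simp_all

lemma tT_gen: "Suc k < n \<Longrightarrow> svalid n g \<Longrightarrow> MKgen g \<Longrightarrow> tT k * T (gen g) = T (gen (sact k g)) * tT k"
  by (drule (2) SK_relsI(9)[THEN T_rel]) simp

lemma tT_far: "Suc i < n \<Longrightarrow> Suc j < n \<Longrightarrow> i + 1 < j \<or> j + 1 < i \<Longrightarrow> tT i * tT j = tT j * tT i"
  by (drule (2) SK_relsI(6)[THEN T_rel]) simp

lemma tT_braid: "i + 2 < n \<Longrightarrow> tT (Suc i) * tT i * tT (Suc i) = tT i * tT (Suc i) * tT i"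
  by (drule SK_relsI(7)[THEN T_rel]) simp

lemma tT_square: "Suc k < n \<Longrightarrow> tT k * tT k = T (Rab c Q n k (Suc k))"
  by (drule SK_relsI(8)[THEN T_rel]) simp

lemma esum_cong: "(\<And>\<nu>. \<nu> \<in> Jn n \<Longrightarrow> P \<nu> = P' \<nu>) \<Longrightarrow> esum P = esum P'"
  unfolding esum_def by (rule sum.cong) auto

lemma tS_mult: "tS P * tS P' = tS (\<lambda>\<nu>. P \<nu> \<and> P' \<nu>)"
proof -
  have "tS P * tS P' = (\<Sum>\<mu>\<in>{\<nu>\<in>Jn n. P \<nu>}. \<Sum>\<nu>\<in>{\<nu>\<in>Jn n. P' \<nu>}. if \<mu> = \<nu> then tE \<mu> else 0)"
    unfolding esum_def T_sum sum_product by (intro sum.cong refl) (auto simp: tE_tE)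
  also have "\<dots> = (\<Sum>\<mu>\<in>{\<nu>\<in>Jn n. P \<nu>}. if P' \<mu> then tE \<mu> else 0)"
    by (intro sum.cong refl) (simp add: sum.delta')
  also have "\<dots> = tS (\<lambda>\<nu>. P \<nu> \<and> P' \<nu>)"
    unfolding esum_def T_sum by (subst sum.inter_filter[symmetric]) (auto intro!: sum.cong)
  finally show ?thesis .
qed

lemma tS_commute: "tS P * tS P' = tS P' * tS P"
  by (simp add: tS_mult conj_commute)

lemma tE_eq_tS: "\<nu> \<in> Jn n \<Longrightarrow> tE \<nu> = tS (\<lambda>\<mu>. \<mu> = \<nu>)"
proof -
  assume "\<nu> \<in> Jn n"
  then have "{\<mu> \<in> Jn n. \<mu> = \<nu>} = {\<nu>}" by auto
  then show ?thesis by (simp add: esum_def)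
qed

lemma tY_tS: "p < n \<Longrightarrow> tY p * tS P = tS P * tY p"
  unfolding esum_def T_sum sum_distrib_left sum_distrib_right
  by (rule sum.cong) (auto simp: tY_tE)

lemma capp_Jn [simp]: "capp c p \<nu> \<in> Jn n \<longleftrightarrow> \<nu> \<in> Jn n"
  and lsw_Jn [simp]: "lsw k \<nu> \<in> Jn n \<longleftrightarrow> \<nu> \<in> Jn n"
  by (simp_all add: Jn_def)

lemma lsw_lsw_Jn: "Suc k < n \<Longrightarrow> \<nu> \<in> Jn n \<Longrightarrow> lsw k (lsw k \<nu>) = \<nu>"
  by (simp add: Jn_def)

lemma tC_tS: "p < n \<Longrightarrow> tC p * tS P = tS (\<lambda>\<nu>. P (capp c p \<nu>)) * tC p"
proof -
  assume "p < n"
  then have "tC p * tS P = (\<Sum>\<nu>\<in>{\<nu>\<in>Jn n. P \<nu>}. tE (capp c p \<nu>) * tC p)"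
    unfolding esum_def T_sum sum_distrib_left by (intro sum.cong) (auto simp: tC_tE)
  also have "\<dots> = (\<Sum>\<nu>\<in>{\<nu>\<in>Jn n. P (capp c p \<nu>)}. tE \<nu> * tC p)"
    by (rule sum.reindex_bij_witness[where i = "capp c p" and j = "capp c p"]) auto
  finally show ?thesis by (simp add: esum_def T_sum sum_distrib_right)
qed

lemma tT_tS: "Suc k < n \<Longrightarrow> tT k * tS P = tS (\<lambda>\<nu>. P (lsw k \<nu>)) * tT k"
proof -
  assume k: "Suc k < n"
  have "tT k * tS P = (\<Sum>\<nu>\<in>{\<nu>\<in>Jn n. P \<nu>}. tE (lsw k \<nu>) * tT k)"
    unfolding esum_def T_sum sum_distrib_left using tT_gen[OF k, of "SE _"]
    by (intro sum.cong) (auto simp: Jn_def)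
  also have "\<dots> = (\<Sum>\<nu>\<in>{\<nu>\<in>Jn n. P (lsw k \<nu>)}. tE \<nu> * tT k)"
    using k by (intro sum.reindex_bij_witness[where i = "lsw k" and j = "lsw k"]) (auto simp: lsw_lsw_Jn)
  finally show ?thesis by (simp add: esum_def T_sum sum_distrib_right)
qed

text \<open>Each rule for moving an element past y_a - y_b or y_a + y_b passes to the inverses. The
  six forms cover commutation, the exchange of difference and sum, and this exchange with a sign;
  the last two kinds arise from c_b and c_a.\<close>

lemma tM_intertwine:
  assumes ab: "a < n" "b < n" "a \<noteq> b"
  shows "(T u * (tY a - tY b) = (tY a - tY b) * T u) \<Longrightarrow> T u * tM a b = tM a b * T u"
    and "(T u * (tY a + tY b) = (tY a + tY b) * T u) \<Longrightarrow> T u * tP a b = tP a b * T u"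
    and "(T u * (tY a - tY b) = (tY a + tY b) * T u) \<Longrightarrow> T u * tM a b = tP a b * T u"
    and "(T u * (tY a + tY b) = (tY a - tY b) * T u) \<Longrightarrow> T u * tP a b = tM a b * T u"
    and "(T u * (tY a - tY b) = - (tY a + tY b) * T u) \<Longrightarrow> T u * tM a b = - tP a b * T u"
    and "(T u * (tY a + tY b) = - (tY a - tY b) * T u) \<Longrightarrow> T u * tP a b = - tM a b * T u"
proof goal_cases
  case 1
  then show ?case by (intro inverse_intertwine[OF tM_inv(2,1)[OF ab]]) simp_all
next
  case 2
  then show ?case by (intro inverse_intertwine[OF tM_inv(4,3)[OF ab]]) simp_all
next
  case 3
  then show ?case by (intro inverse_intertwine[OF tM_inv(2,3)[OF ab]]) simp_all
next
  case 4
  then show ?case by (intro inverse_intertwine[OF tM_inv(4,1)[OF ab]]) simp_all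
next
  case 5
  moreover have "- tP a b * - (tY a + tY b) = T 1" using tM_inv(3)[OF ab] by (simp only: minus_mult_minus)
  ultimately show ?case by (intro inverse_intertwine[OF tM_inv(2)[OF ab]]) (assumption | simp)+
next
  case 6
  moreover have "- tM a b * - (tY a - tY b) = T 1" using tM_inv(1)[OF ab] by (simp only: minus_mult_minus)
  ultimately show ?case by (intro inverse_intertwine[OF tM_inv(4)[OF ab]]) (assumption | simp)+
qed

lemma tY_tM:
  assumes "a < n" "b < n" "a \<noteq> b" "r < n"
  shows "tY r * tM a b = tM a b * tY r" "tY r * tP a b = tP a b * tY r"
  by (rule tM_intertwine[OF assms(1-3)], simp add: algebra_simps tY_tY[OF \<open>r < n\<close>] assms)+

lemma tS_tM:
  assumes "a < n" "b < n" "a \<noteq> b"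
  shows "tS P * tM a b = tM a b * tS P" "tS P * tP a b = tP a b * tS P"
  by (rule tM_intertwine[OF assms(1-3)], simp add: algebra_simps tY_tS assms)+

lemma tM_tM:
  assumes "a < n" "b < n" "a \<noteq> b" "d < n" "e < n" "d \<noteq> e"
  shows "tM d e * tM a b = tM a b * tM d e" "tP d e * tM a b = tM a b * tP d e"
    "tP d e * tP a b = tP a b * tP d e"
  by (rule tM_intertwine[OF assms(1-3)], simp add: algebra_simps tY_tM assms)+

lemma tC_tM:
  assumes ab: "a < n" "b < n" "a \<noteq> b" and "r < n"
  shows "tC a * tM a b = - tP a b * tC a" "tC a * tP a b = - tM a b * tC a"
    "tC b * tM a b = tP a b * tC b" "tC b * tP a b = tM a b * tC b"
    "r \<noteq> a \<Longrightarrow> r \<noteq> b \<Longrightarrow> tC r * tM a b = tM a b * tC r"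
    "r \<noteq> a \<Longrightarrow> r \<noteq> b \<Longrightarrow> tC r * tP a b = tP a b * tC r"
  by (rule tM_intertwine[OF ab], use assms in \<open>simp add: algebra_simps tC_tY\<close>)+

lemma tT_tM:
  assumes ab: "a < n" "b < n" "a \<noteq> b" and "Suc k < n"
  shows "tT k * tM a b = tM (sw k a) (sw k b) * tT k" "tT k * tP a b = tP (sw k a) (sw k b) * tT k"
  using tT_gen[of k "SDm a b"] tT_gen[of k "SDp a b"] assms by simp_all

text \<open>Uniqueness of inverses, obtained by intertwining with the local unit.\<close>

lemma tM_swap:
  assumes ab: "a < n" "b < n" "a \<noteq> b"
  shows "tM b a = - tM a b" "tP b a = tP a b"
proof -
  have "T 1 * tM b a = - tM a b * T 1"
    by (rule inverse_intertwine[of "tY b - tY a" "tM b a" "T 1" "- tM a b" "tY b - tY a"])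
      (use tM_inv[of a b] tM_inv[of b a] ab in \<open>simp_all add: algebra_simps\<close>)
  then show "tM b a = - tM a b" by simp
  have "T 1 * tP b a = tP a b * T 1"
    by (rule inverse_intertwine[of "tY b + tY a" "tP b a" "T 1" "tP a b" "tY b + tY a"])
      (use tM_inv[of a b] tM_inv[of b a] ab in \<open>simp_all add: algebra_simps\<close>)
  then show "tP b a = tP a b" by simp
qed

section \<open>The elements beta_{pq} and their Yang-Baxter identity\<close>

definition bb :: "nat \<Rightarrow> nat \<Rightarrow> ('j sgen, 'k) falg" where
  "bb a b = gen (SDm a b) * esum (\<lambda>\<nu>. \<nu> ! a = \<nu> ! b)"

text \<open>The conjugate of \<open>bb a b\<close> by c_b, equally minus its conjugate by c_a:
  flipping one of the two sites turns the pole at the difference into one at the sum.\<close>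

definition bt :: "nat \<Rightarrow> nat \<Rightarrow> ('j sgen, 'k) falg" where
  "bt a b = gen (SDp a b) * esum (\<lambda>\<nu>. \<nu> ! a = c (\<nu> ! b))"

abbreviation "tB a b \<equiv> T (bb a b)"
abbreviation "tD a b \<equiv> T (bt a b)"

definition beta :: "nat \<Rightarrow> nat \<Rightarrow> ('j sgen, 'k) falg" where
  "beta a b = - bb a b + bt a b * gen (SCl a) * gen (SCl b)"

lemma T_beta: "T (beta a b) = - tB a b + tD a b * tC a * tC b"
  by (simp add: beta_def)

lemma nth_capp: "p < length \<nu> \<Longrightarrow> capp c p \<nu> ! q = (if q = p then c (\<nu> ! p) else \<nu> ! q)"
  by (auto simp: capp_def)

lemma Jn_length: "\<nu> \<in> Jn n \<Longrightarrow> length \<nu> = n"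
  by (simp add: Jn_def)

context
  fixes a b assumes ab: "a < n" "b < n" "a \<noteq> b"
begin

lemma tY_tB: "r < n \<Longrightarrow> tY r * tB a b = tB a b * tY r" "r < n \<Longrightarrow> tY r * tD a b = tD a b * tY r"
  by (simp_all add: bb_def bt_def tY_tM[OF ab] tY_tM[OF ab, THEN mult_assoc_left] tY_tS mult.assoc)

lemma tS_tB: "tS P * tB a b = tB a b * tS P" "tS P * tD a b = tD a b * tS P"
  by (simp_all add: bb_def bt_def tS_tM[OF ab] tS_tM[OF ab, THEN mult_assoc_left] tS_commute mult.assoc)

lemma tC_tB:
  "tC a * tB a b = - (tD a b * tC a)" "tC a * tD a b = - (tB a b * tC a)"
  "tC b * tB a b = tD a b * tC b" "tC b * tD a b = tB a b * tC b"
  "r < n \<Longrightarrow> r \<noteq> a \<Longrightarrow> r \<noteq> b \<Longrightarrow> tC r * tB a b = tB a b * tC r"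
  "r < n \<Longrightarrow> r \<noteq> a \<Longrightarrow> r \<noteq> b \<Longrightarrow> tC r * tD a b = tD a b * tC r"
proof -
  note M = tC_tM[OF ab] tC_tM[OF ab, THEN mult_assoc_left]
  have e: "esum (\<lambda>\<nu>. capp c a \<nu> ! a = capp c a \<nu> ! b) = esum (\<lambda>\<nu>. \<nu> ! a = c (\<nu> ! b))"
    "esum (\<lambda>\<nu>. capp c a \<nu> ! a = c (capp c a \<nu> ! b)) = esum (\<lambda>\<nu>. \<nu> ! a = \<nu> ! b)"
    "esum (\<lambda>\<nu>. capp c b \<nu> ! a = capp c b \<nu> ! b) = esum (\<lambda>\<nu>. \<nu> ! a = c (\<nu> ! b))"
    "esum (\<lambda>\<nu>. capp c b \<nu> ! a = c (capp c b \<nu> ! b)) = esum (\<lambda>\<nu>. \<nu> ! a = \<nu> ! b)"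
    using ab by (auto intro!: esum_cong simp: nth_capp Jn_length c_eq_iff[symmetric])
  show "tC a * tB a b = - (tD a b * tC a)" "tC a * tD a b = - (tB a b * tC a)"
    "tC b * tB a b = tD a b * tC b" "tC b * tD a b = tB a b * tC b"
    using ab by (simp_all add: bb_def bt_def M mult.assoc tC_tS e)
  assume r: "r < n" "r \<noteq> a" "r \<noteq> b"
  have e: "esum (\<lambda>\<nu>. capp c r \<nu> ! a = capp c r \<nu> ! b) = esum (\<lambda>\<nu>. \<nu> ! a = \<nu> ! b)"
    "esum (\<lambda>\<nu>. capp c r \<nu> ! a = c (capp c r \<nu> ! b)) = esum (\<lambda>\<nu>. \<nu> ! a = c (\<nu> ! b))"
    using ab r by (auto intro!: esum_cong simp: nth_capp Jn_length)
  show "tC r * tB a b = tB a b * tC r" "tC r * tD a b = tD a b * tC r"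
    using ab r by (simp_all add: bb_def bt_def M mult.assoc tC_tS e)
qed

lemma tB_tB:
  assumes de: "d < n" "e < n" "d \<noteq> e"
  shows "tB d e * tB a b = tB a b * tB d e" "tD d e * tB a b = tB a b * tD d e"
    "tB d e * tD a b = tD a b * tB d e" "tD d e * tD a b = tD a b * tD d e"
proof -
  have *: "tM d e * tB a b = tB a b * tM d e" "tP d e * tB a b = tB a b * tP d e"
    "tM d e * tD a b = tD a b * tM d e" "tP d e * tD a b = tD a b * tP d e"
    by (simp_all add: bb_def bt_def mult.assoc tS_tM[OF de] tM_tM[OF ab de, THEN mult_assoc_left]
        tM_tM(2)[OF de ab, THEN mult_assoc_left, symmetric])
      (simp_all flip: mult.assoc add: tM_tM[OF ab de] tM_tM[OF de ab])
  show "tB d e * tB a b = tB a b * tB d e" "tD d e * tB a b = tB a b * tD d e"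
    "tB d e * tD a b = tD a b * tB d e" "tD d e * tD a b = tD a b * tD d e"
    unfolding bb_def[of d e] bt_def[of d e]
    by (simp_all add: mult.assoc tS_tB *[THEN mult_assoc_left])
qed

lemma tT_tB:
  assumes "Suc k < n"
  shows "tT k * tB a b = tB (sw k a) (sw k b) * tT k" "tT k * tD a b = tD (sw k a) (sw k b) * tT k"
proof -
  have e: "esum (\<lambda>\<nu>. lsw k \<nu> ! a = lsw k \<nu> ! b) = esum (\<lambda>\<nu>. \<nu> ! (sw k a) = \<nu> ! (sw k b))"
    "esum (\<lambda>\<nu>. lsw k \<nu> ! a = c (lsw k \<nu> ! b)) = esum (\<lambda>\<nu>. \<nu> ! (sw k a) = c (\<nu> ! (sw k b)))"
    using ab assms by (auto intro!: esum_cong simp: nth_lsw Jn_length)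
  show "tT k * tB a b = tB (sw k a) (sw k b) * tT k" "tT k * tD a b = tD (sw k a) (sw k b) * tT k"
    by (simp_all add: bb_def bt_def e mult.assoc tT_tS assms tT_tM[OF ab assms, THEN mult_assoc_left])
qed

lemma tB_swap: "tB b a = - tB a b" "tD b a = tD a b"
proof -
  have e: "esum (\<lambda>\<nu>. \<nu> ! b = \<nu> ! a) = esum (\<lambda>\<nu>. \<nu> ! a = \<nu> ! b)"
    "esum (\<lambda>\<nu>. \<nu> ! b = c (\<nu> ! a)) = esum (\<lambda>\<nu>. \<nu> ! a = c (\<nu> ! b))"
    by (intro esum_cong, metis c_inv)+
  show "tB b a = - tB a b" "tD b a = tD a b"
    by (simp_all add: bb_def bt_def e tM_swap[OF ab])
qed

lemma beta_swap: "T (beta b a) = - T (beta a b)"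
  using ab by (simp add: T_beta tB_swap mult.assoc tC_tC[of b a])

lemma tT_beta: "Suc k < n \<Longrightarrow> tT k * T (beta a b) = T (beta (sw k a) (sw k b)) * tT k"
  using ab tT_gen[of k "SCl a"] tT_gen[of k "SCl b"]
  by (simp add: T_beta algebra_simps tT_tB tT_tB[THEN mult_assoc_left] mult_assoc_left[of "tT k" "tC a"])

text \<open>Both \<open>bb a b\<close> and \<open>bt a b\<close> change sign when moved past c_a
  c_b, so the mixed terms cancel; (c_a c_b)^2 = -1 compensates the sign of the last square.\<close>

lemma beta_square: "T (beta a b) * T (beta a b) = tB a b * tB a b + tD a b * tD a b"
  using ab tC_tC[of b a]
  by (simp add: T_beta algebra_simps tC_tB tC_tB[THEN mult_assoc_left] tB_tB(2)[OF ab, THEN mult_assoc_left] mult_assoc_left[of "tC b" "tC a"]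
      tC_square tC_square[THEN mult_assoc_left])

end

text \<open>Partial fractions: multiply by (y_p - y_r)(y_p - y_r)^{-1} and split y_p - y_r at y_q.
  Each product requires two of the three label equalities, and any two imply the third, so all three
  products carry the same idempotent.\<close>

lemma tB_yang_baxter:
  assumes "p < n" "q < n" "r < n" "p \<noteq> q" "q \<noteq> r" "p \<noteq> r"
  shows "tB q r * tB p q = tB p r * tB q r + tB p q * tB p r"
proof -
  define S where "S = esum (\<lambda>\<nu>. \<nu> ! p = \<nu> ! q \<and> \<nu> ! q = \<nu> ! r)"
  have S: "T S = tS (\<lambda>\<nu>. \<nu> ! q = \<nu> ! r) * tS (\<lambda>\<nu>. \<nu> ! p = \<nu> ! q)"
    "T S = tS (\<lambda>\<nu>. \<nu> ! p = \<nu> ! r) * tS (\<lambda>\<nu>. \<nu> ! q = \<nu> ! r)"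
    "T S = tS (\<lambda>\<nu>. \<nu> ! p = \<nu> ! q) * tS (\<lambda>\<nu>. \<nu> ! p = \<nu> ! r)"
    unfolding S_def tS_mult by (rule arg_cong[of _ _ T], rule esum_cong, auto)+
  have *: "tB a b * tB d e = tM a b * tM d e * (tS (\<lambda>\<nu>. \<nu> ! a = \<nu> ! b) * tS (\<lambda>\<nu>. \<nu> ! d = \<nu> ! e))"
    if "d < n" "e < n" "d \<noteq> e" for a b d e
    by (simp add: bb_def mult.assoc tS_tM(1)[OF that, THEN mult_assoc_left])
  have "tM q r * tM p q = tM q r * tM p q * ((tY p - tY q) + (tY q - tY r)) * tM p r"
    using tM_inv(2)[of p r] assms by (simp add: mult.assoc)
  also have "\<dots> = tM q r * (tM p q * (tY p - tY q)) * tM p r + (tM q r * (tY q - tY r)) * tM p q * tM p r"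
    using assms by (simp add: algebra_simps tY_tM tY_tM[THEN mult_assoc_left])
  also have "\<dots> = tM p r * tM q r + tM p q * tM p r"
    using tM_inv(1)[of p q] tM_inv(1)[of q r] tM_tM(1)[of p r q r] assms by simp
  finally have "tM q r * tM p q = tM p r * tM q r + tM p q * tM p r" .
  then show ?thesis using assms by (simp add: * S[symmetric] distrib_right)
qed

lemma beta_yang_baxter:
  assumes "p < n" "q < n" "r < n" "p \<noteq> q" "q \<noteq> r" "p \<noteq> r"
  shows "T (beta q r) * T (beta p q) = T (beta p r) * T (beta q r) + T (beta p q) * T (beta p r)"
  unfolding T_beta
  by (rule clifford_yang_baxter[where \<epsilon> = "T 1"])
    (use assms tC_tC[of q p] tC_tC[of r p] tC_tC[of r q] in
      \<open>auto simp: tC_square tC_tB tB_yang_baxter\<close>)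

section \<open>The square and braid relations for sigma_a\<close>

definition Qsum :: "nat \<Rightarrow> nat \<Rightarrow> ('j sgen, 'k) falg" where
  "Qsum a b = (\<Sum>\<nu>\<in>Jn n. beval (Q (\<nu> ! a) (\<nu> ! b)) (gen (SY a)) (gen (SY b)) * gen (SE \<nu>))"

lemma tS_filter: "X * tS P = (\<Sum>\<nu>\<in>Jn n. if P \<nu> then X * tE \<nu> else 0)"
  unfolding esum_def T_sum sum_distrib_left by (rule sum.inter_filter) simp

text \<open>Compare label by label. At a fixed label both terms of beta^2 occur, and
  \<open>AB\<close> identifies their sum with the fraction in R. \<open>Qsum\<close> may run over
  all labels because Q vanishes on equivalent ones.\<close>

lemma T_Rab:
  assumes ab: "a < n" "b < n" "a \<noteq> b"
  shows "T (Rab c Q n a b) = T (Qsum a b) - T (beta a b) * T (beta a b)"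
proof -
  define A where "A = tM a b * tM a b"
  define B where "B = tP a b * tP a b"
  have AB: "T (2 * (gen (SY a) ^ 2 + gen (SY b) ^ 2) * (gen (SDm a b) ^ 2 * gen (SDp a b) ^ 2)) = A + B"
  proof -
    define u v d p where "u = tY a" and "v = tY b" and "d = tM a b" and "p = tP a b"
    have c: "v * u = u * v" "u * d = d * u" "v * d = d * v" "u * p = p * u" "v * p = p * v" "p * d = d * p"
      using ab by (simp_all add: u_def v_def d_def p_def tY_tY tY_tM tM_tM)
    have i: "d * (u - v) = T 1" "p * (u + v) = T 1"
      using tM_inv[OF ab] by (simp_all add: u_def v_def d_def p_def)
    have "(u * u + v * v) * (d * d * (p * p)) + (u * u + v * v) * (d * d * (p * p))
        = d * d * ((p * (u + v)) * (p * (u + v))) + (d * (u - v)) * (d * (u - v)) * (p * p)"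
      by (simp add: algebra_simps c c[THEN mult_assoc_left])
    also have "\<dots> = A + B" unfolding i by (simp add: A_def B_def d_def p_def mult.assoc)
    finally show ?thesis
      by (simp add: mult_2 power2_eq_square u_def v_def d_def p_def distrib_right distrib_left add_ac)
  qed
  have BB: "T (beta a b) * T (beta a b) = A * tS (\<lambda>\<nu>. \<nu> ! a = \<nu> ! b) + B * tS (\<lambda>\<nu>. \<nu> ! a = c (\<nu> ! b))"
    unfolding beta_square[OF ab] A_def B_def bb_def bt_def
    by (simp add: mult.assoc tS_tM[OF ab, THEN mult_assoc_left] tS_mult)
  have R: "T (Rab c Q n a b) =
      (\<Sum>\<nu>\<in>Jn n. if \<not> pr_eq c (\<nu> ! a) (\<nu> ! b) then T (beval (Q (\<nu> ! a) (\<nu> ! b)) (gen (SY a)) (gen (SY b))) * tE \<nu> else 0)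
      - (\<Sum>\<nu>\<in>Jn n. if \<nu> ! a = \<nu> ! b \<and> c (\<nu> ! a) \<noteq> \<nu> ! a then A * tE \<nu> else 0)
      - (\<Sum>\<nu>\<in>Jn n. if \<nu> ! a = c (\<nu> ! b) \<and> c (\<nu> ! a) \<noteq> \<nu> ! a then B * tE \<nu> else 0)
      - (\<Sum>\<nu>\<in>Jn n. if \<nu> ! a = \<nu> ! b \<and> c (\<nu> ! a) = \<nu> ! a then (A + B) * tE \<nu> else 0)"
    unfolding Rab_def Let_def T_diff T_sum T_mult[of _ "gen (SE _)"] AB
    by (simp add: sum.inter_filter power2_eq_square flip: A_def B_def)
  have Q0: "T (beval (Q i j) X Y) = 0" if "pr_eq c i j" for i j X Y
    using Q_zero[OF that] by (simp add: beval_def bcoeff_def)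
  show ?thesis
    unfolding R BB tS_filter Qsum_def T_sum T_mult sum_subtractf[symmetric] sum.distrib[symmetric]
  proof (rule sum.cong[OF refl])
    fix \<nu> :: "'j list"
    let ?i = "\<nu> ! a" and ?j = "\<nu> ! b"
    consider "?i = ?j" "c ?j = ?j" | "?i = ?j" "c ?j \<noteq> ?j" | "?i = c ?j" "c ?j \<noteq> ?j" | "\<not> pr_eq c ?i ?j" "?i \<noteq> ?j" "?i \<noteq> c ?j"
      unfolding pr_eq_def by (metis c_inv)
    note cs = this
    show "(if \<not> pr_eq c ?i ?j then T (beval (Q ?i ?j) (gen (SY a)) (gen (SY b))) * tE \<nu> else 0)
        - (if ?i = ?j \<and> c ?i \<noteq> ?i then A * tE \<nu> else 0)
        - (if ?i = c ?j \<and> c ?i \<noteq> ?i then B * tE \<nu> else 0)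
        - (if ?i = ?j \<and> c ?i = ?i then (A + B) * tE \<nu> else 0)
      = T (beval (Q ?i ?j) (gen (SY a)) (gen (SY b))) * tE \<nu>
        - ((if ?i = ?j then A * tE \<nu> else 0) + (if ?i = c ?j then B * tE \<nu> else 0))"
      by (cases rule: cs) (use Q0[of ?i ?j] in \<open>simp_all add: pr_eq_def distrib_right\<close>)
  qed
qed

abbreviation "tsig a \<equiv> T (sigma_img c n a)"

text \<open>In \<open>beta\<close> the idempotent stands to the left of c_a c_{a+1}, in
  \<open>sigma_img\<close> to the right. Flipping both labels preserves the condition nu_a = c
  nu_{a+1}, so it can be moved across.\<close>

lemma tsig:
  assumes a: "Suc a < n"
  shows "tsig a = tT a + T (beta a (Suc a))"
proof -
  have ab: "a < n" "Suc a < n" "a \<noteq> Suc a" using a by auto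
  let ?dm = "tM a (Suc a)" and ?dp = "tP a (Suc a)" and ?cc = "tC a * tC (Suc a)"
  have D: "tD a (Suc a) * ?cc = ?dp * ?cc * tS (\<lambda>\<nu>. \<nu> ! a = c (\<nu> ! Suc a))"
  proof -
    have "esum (\<lambda>\<nu>. capp c (Suc a) (capp c a \<nu>) ! a = c (capp c (Suc a) (capp c a \<nu>) ! Suc a))
      = esum (\<lambda>\<nu>. \<nu> ! a = c (\<nu> ! Suc a))"
      using a by (intro esum_cong) (auto simp: nth_capp Jn_length c_eq_iff[symmetric])
    then show ?thesis
      using ab by (simp add: bt_def mult.assoc tC_tS tC_tS[THEN mult_assoc_left])
  qed
  have "tsig a = (\<Sum>\<nu>\<in>Jn n. tT a * tE \<nu> - (if \<nu> ! a = \<nu> ! Suc a then ?dm * tE \<nu> else 0)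
      + (if \<nu> ! a = c (\<nu> ! Suc a) then ?dp * ?cc * tE \<nu> else 0))"
    unfolding sigma_img_def Let_def T_sum
  proof (rule sum.cong[OF refl])
    fix \<nu> :: "'j list"
    let ?i = "\<nu> ! a" and ?j = "\<nu> ! Suc a"
    consider "?i = ?j" "c ?j = ?j" | "?i = ?j" "c ?j \<noteq> ?j" | "?i = c ?j" "c ?j \<noteq> ?j" | "\<not> pr_eq c ?i ?j" "?i \<noteq> ?j" "?i \<noteq> c ?j"
      unfolding pr_eq_def by (metis c_inv)
    note cs = this
    show "T ((if \<not> pr_eq c ?i ?j then gen (ST a)
         else if ?i = ?j \<and> c ?i \<noteq> ?i then gen (ST a) - gen (SDm a (Suc a))
         else if ?i = c ?j \<and> c ?i \<noteq> ?i then gen (ST a) + gen (SDp a (Suc a)) * (gen (SCl a) * gen (SCl (Suc a)))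
         else gen (ST a) - gen (SDm a (Suc a)) + gen (SDp a (Suc a)) * (gen (SCl a) * gen (SCl (Suc a)))) * gen (SE \<nu>))
       = tT a * tE \<nu> - (if ?i = ?j then ?dm * tE \<nu> else 0) + (if ?i = c ?j then ?dp * ?cc * tE \<nu> else 0)"
      by (cases rule: cs) (simp_all add: pr_eq_def algebra_simps)
  qed
  also have "\<dots> = tT a * tS (\<lambda>_. True) - ?dm * tS (\<lambda>\<nu>. \<nu> ! a = \<nu> ! Suc a) + ?dp * ?cc * tS (\<lambda>\<nu>. \<nu> ! a = c (\<nu> ! Suc a))"
    unfolding tS_filter by (simp add: sum.distrib sum_subtractf)
  also have "\<dots> = tT a + T (beta a (Suc a))"
    unfolding D[symmetric] T_beta tS_True by (simp add: bb_def mult.assoc)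
  finally show ?thesis .
qed

lemma tT_anti_beta: "Suc a < n \<Longrightarrow> tT a * T (beta a (Suc a)) = - (T (beta a (Suc a)) * tT a)"
  using tT_beta[of a "Suc a" a] beta_swap[of a "Suc a"] by (simp add: sw_def)

text \<open>tau_a anticommutes with beta_{a,a+1}, so no mixed terms survive, and the square of beta
  cancels the one subtracted in R.\<close>

lemma tsig_square:
  assumes a: "Suc a < n"
  shows "tsig a * tsig a = T (Qsum a (Suc a))"
  using a by (simp add: tsig algebra_simps tT_anti_beta tT_square T_Rab)

lemma tsig_braid:
  assumes a: "a + 2 < n"
  shows "tsig (a + 1) * tsig a * tsig (a + 1) - tsig a * tsig (a + 1) * tsig a
    = T (beta a (a + 2)) * (T (Qsum (a + 1) (a + 2)) - T (Qsum a (a + 1)))"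
proof -
  have ab: "a < n" "Suc a < n" "Suc (Suc a) < n" using a by auto
  show ?thesis
    using ab
    apply (simp add: tsig)
    \<comment> \<open>The variables \<open>s\<close>, \<open>t\<close> are tau_a, tau_{a+1}, and
      \<open>u\<close>, \<open>v\<close>, \<open>w\<close> are beta_{a,a+1}, beta_{a+1,a+2},
      beta_{a,a+2}.\<close>
    apply (rule braid_defect)
    subgoal using tT_braid[of a] by simp
    subgoal by (simp add: tT_anti_beta)
    subgoal using tT_beta[of "Suc a" "Suc (Suc a)" a] by (simp add: sw_def)
    subgoal using tT_beta[of a "Suc (Suc a)" a] by (simp add: sw_def)
    subgoal by (simp add: tT_anti_beta)
    subgoal using tT_beta[of a "Suc a" "Suc a"] by (simp add: sw_def)
    subgoal using tT_beta[of a "Suc (Suc a)" "Suc a"] by (simp add: sw_def)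
    subgoal using beta_yang_baxter[of a "Suc a" "Suc (Suc a)"] by simp
    \<comment> \<open>The second identity is the first one for the reversed triple; the antisymmetry
      signs cancel in pairs.\<close>
    subgoal using beta_yang_baxter[of "Suc (Suc a)" "Suc a" a]
      by (simp add: beta_swap[of a "Suc a"] beta_swap[of "Suc a" "Suc (Suc a)"] beta_swap[of a "Suc (Suc a)"] add.commute)
    subgoal unfolding T_beta
      by (rule clifford_square_central[where ?c0.0 = "tC a" and ?c1.0 = "tC (Suc a)" and \<epsilon> = "T 1"])
        (use ab tC_tC[of "Suc a" a] in \<open>auto simp: tC_square tC_tB tB_tB(1,2,4)\<close>)
    subgoal using tT_square[of a] by (simp add: T_Rab)
    subgoal using tT_square[of "Suc a"] by (simp add: T_Rab)
    done
qed

section \<open>Polynomials in the y_p and divided differences\<close>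

lemma T_power_comm:
  assumes "T u * T X = T X' * T u"
  shows "T u * T (X ^ i) = T (X' ^ i) * T u"
proof (induction i)
  case (Suc i)
  then show ?case by (simp add: mult.assoc assms[THEN mult_assoc_left])
qed simp

lemma T_beval: "T (beval q X Y) = (\<Sum>j\<le>degree q. \<Sum>i\<le>degree (coeff q j). T (sc (bcoeff q i j)) * T (X ^ i) * T (Y ^ j))"
  by (simp add: beval_def T_sum)

lemma T_beval_comm:
  assumes "T u * T X = T X' * T u" "T u * T Y = T Y' * T u"
  shows "T u * T (beval q X Y) = T (beval q X' Y') * T u"
  unfolding T_beval sum_distrib_left sum_distrib_right
  by (intro sum.cong refl)
    (simp add: mult.assoc T_power_comm[OF assms(2)] T_power_comm[OF assms(1), THEN mult_assoc_left]
      T_sc_commute[symmetric, THEN mult_assoc_left])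

lemma T_beval_swap:
  assumes "T X * T Y = T Y * T X"
  shows "T (beval (Q j i) X Y) = T (beval (Q i j) Y X)"
proof -
  have "T (X ^ a) * T (Y ^ b) = T (Y ^ b) * T (X ^ a)" for a b
    using T_power_comm[of "X ^ a" Y Y b] T_power_comm[of Y X X a] assms by simp
  then show ?thesis
    unfolding T_beval by (intro sum_bcoeff_eq) (auto simp: Q_swap[of j i] mult.assoc)
qed

lemma beval_Q_c2: "beval (Q i (c j)) X (- Y) = beval (Q i j) X (Y :: ('g, 'k) falg)"
proof -
  have "sc (bcoeff (Q i (c j)) a b) * X ^ a * (- Y) ^ b = sc (bcoeff (Q i j) a b) * X ^ a * Y ^ b" for a b
    using Q_c2[of b i j a, symmetric] by (cases "even b") (auto simp: sc_minus)
  then show ?thesis unfolding beval_def by (intro sum_bcoeff_eq) auto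
qed

text \<open>Characterises the divided difference without a division: the geometric sum telescopes to
  \<open>Z ^ i - X ^ i\<close>. The inverse of \<open>Z - X\<close> is applied only
  afterwards.\<close>

lemma T_bdd:
  assumes "T Z * T X = T X * T Z"
  shows "T (Z - X) * T (bdd q Z X Y) = T (beval q Z Y) - T (beval q X Y)"
proof -
  have *: "T (Z - X) * T (\<Sum>m<i. Z ^ m * X ^ (i - 1 - m)) = T (Z ^ i) - T (X ^ i)" for i
  proof (induction i)
    case (Suc i)
    have "(\<Sum>m<i. Z ^ m * X ^ (i - m)) = (\<Sum>m<i. Z ^ m * X ^ (i - 1 - m)) * X"
      unfolding sum_distrib_right
    proof (rule sum.cong[OF refl])
      fix m assume "m \<in> {..<i}"
      then have "i - m = Suc (i - 1 - m)" by auto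
      then show "Z ^ m * X ^ (i - m) = Z ^ m * X ^ (i - 1 - m) * X"
        by (simp add: power_commutes mult.assoc)
    qed
    then have "T (Z - X) * T (\<Sum>m<Suc i. Z ^ m * X ^ (Suc i - 1 - m))
       = (T (Z ^ i) - T (X ^ i)) * T X + (T Z - T X) * T (Z ^ i)"
      using Suc by (simp add: distrib_left flip: mult.assoc)
    also have "\<dots> = T (Z ^ Suc i) - T (X ^ Suc i)"
    proof -
      have a: "T (Z ^ Suc i) = T Z * T (Z ^ i)" "T (X ^ Suc i) = T (X ^ i) * T X"
        by (simp, simp only: power_Suc2 T_mult)
      show ?thesis
        unfolding a left_diff_distrib T_power_comm[OF assms[symmetric]] by simp
    qed
    finally show ?case .
  qed simp
  have "T (Z - X) * T (bdd q Z X Y)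
    = (\<Sum>j\<le>degree q. \<Sum>i\<le>degree (coeff q j). T (sc (bcoeff q i j)) * (T (Z - X) * T (\<Sum>m<i. Z ^ m * X ^ (i - 1 - m))) * T (Y ^ j))"
  proof -
    have "T (bdd q Z X Y)
      = (\<Sum>j\<le>degree q. \<Sum>i\<le>degree (coeff q j). T (sc (bcoeff q i j)) * T (\<Sum>m<i. Z ^ m * X ^ (i - 1 - m)) * T (Y ^ j))"
      by (simp only: bdd_def T_sum[of _ "{.._}"] T_mult)
    then show ?thesis
      by (simp only: sum_distrib_left mult.assoc T_sc_commute[symmetric, THEN mult_assoc_left])
  qed
  also have "\<dots> = T (beval q Z Y) - T (beval q X Y)"
    unfolding * T_beval by (simp add: algebra_simps sum_subtractf)
  finally show ?thesis .
qed

lemma T_one_decomp: "T x = (\<Sum>\<nu>\<in>Jn n. T x * tE \<nu>)"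
  using tS_filter[of "T x" "\<lambda>_. True"] by (simp add: tS_True)

text \<open>The e(nu) sum to the unit, so an identity can be checked on one label sequence at a
  time.\<close>

lemma T_eqI:
  assumes "\<And>\<nu>. \<nu> \<in> Jn n \<Longrightarrow> T x * tE \<nu> = T y * tE \<nu>"
  shows "T x = T y"
  using T_one_decomp[of x] T_one_decomp[of y] assms by simp

lemma sum_tE_mult:
  assumes "\<nu> \<in> Jn n"
  shows "(\<Sum>\<mu>\<in>{\<mu> \<in> Jn n. P \<mu>}. f \<mu> * tE \<mu>) * tE \<nu> = (if P \<nu> then f \<nu> * tE \<nu> else 0)"
proof -
  have "(\<Sum>\<mu>\<in>{\<mu> \<in> Jn n. P \<mu>}. f \<mu> * tE \<mu>) * tE \<nu> = (\<Sum>\<mu>\<in>{\<mu> \<in> Jn n. P \<mu>}. if \<mu> = \<nu> then f \<mu> * tE \<mu> else 0)"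
    unfolding sum_distrib_right using assms by (intro sum.cong refl) (auto simp: mult.assoc tE_tE)
  also have "\<dots> = (if P \<nu> then f \<nu> * tE \<nu> else 0)"
    using assms by (simp add: sum.delta)
  finally show ?thesis .
qed

lemma tS_tE: "\<nu> \<in> Jn n \<Longrightarrow> tS P * tE \<nu> = (if P \<nu> then tE \<nu> else 0)"
  using sum_tE_mult[where P = P and f = "\<lambda>_. T 1"] by (simp add: esum_def T_sum)

lemma Qsum_tE:
  "\<nu> \<in> Jn n \<Longrightarrow> T (Qsum a b) * tE \<nu> = T (beval (Q (\<nu> ! a) (\<nu> ! b)) (gen (SY a)) (gen (SY b))) * tE \<nu>"
  using sum_tE_mult[where P = "\<lambda>_. True"] by (simp add: Qsum_def T_sum)

text \<open>Fix the labels i, j, k at a, b, d. If i = k, symmetry turns Q_{j,k}(y_b, y_d) into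
  Q_{i,j}(y_d, y_b), so the bracket is a difference of values of one polynomial at y_d and y_a, and
  beta divides by y_d - y_a. If i = c k, moving c_a c_d across the bracket first negates y_a and
  y_d, and the sign rule for Q in its second label brings back y_d; the divisor is y_d +
  y_a.\<close>

lemma beta_Qsum:
  assumes abd: "a < n" "b < n" "d < n" "a \<noteq> b" "a \<noteq> d" "b \<noteq> d"
  shows "T (beta a d) * (T (Qsum b d) - T (Qsum a b))
    = (\<Sum>\<nu> \<in> {\<nu> \<in> Jn n. \<nu> ! a = \<nu> ! d}.
         T (bdd (Q (\<nu> ! a) (\<nu> ! b)) (gen (SY d)) (gen (SY a)) (gen (SY b))) * tE \<nu>)
    + (\<Sum>\<nu> \<in> {\<nu> \<in> Jn n. \<nu> ! a = c (\<nu> ! d)}.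
         T (bdd (Q (\<nu> ! a) (\<nu> ! b)) (gen (SY d)) (- gen (SY a)) (gen (SY b))) * tC a * tC d * tE \<nu>)"
proof -
  let ?r = "(\<Sum>\<nu> \<in> {\<nu> \<in> Jn n. \<nu> ! a = \<nu> ! d}.
         bdd (Q (\<nu> ! a) (\<nu> ! b)) (gen (SY d)) (gen (SY a)) (gen (SY b)) * gen (SE \<nu>))
    + (\<Sum>\<nu> \<in> {\<nu> \<in> Jn n. \<nu> ! a = c (\<nu> ! d)}.
         bdd (Q (\<nu> ! a) (\<nu> ! b)) (gen (SY d)) (- gen (SY a)) (gen (SY b)) * gen (SCl a) * gen (SCl d) * gen (SE \<nu>))"
  let ?l = "beta a d * (Qsum b d - Qsum a b)"
  have "T ?l = T ?r"
  proof (rule T_eqI)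
    fix \<nu> :: "'j list" assume \<nu>: "\<nu> \<in> Jn n"
    define i j k where "i = \<nu> ! a" and "j = \<nu> ! b" and "k = \<nu> ! d"
    let ?y = "\<lambda>p. gen (SY p) :: ('j sgen, 'k) falg"
    let ?B1 = "beval (Q j k) (?y b) (?y d)" and ?B2 = "beval (Q i j) (?y a) (?y b)"
    \<comment> \<open>What becomes of the two polynomials when c_a c_d is moved past them.\<close>
    let ?C1 = "beval (Q j k) (?y b) (- ?y d)" and ?C2 = "beval (Q i j) (- ?y a) (?y b)"
    have ad: "a < n" "d < n" "a \<noteq> d" using abd by auto
    have S: "tS P * T ?B1 = T ?B1 * tS P" "tS P * T ?B2 = T ?B2 * tS P"
      "tS P * T ?C1 = T ?C1 * tS P" "tS P * T ?C2 = T ?C2 * tS P" for P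
      using abd by (intro T_beval_comm; simp add: tY_tS)+
    have cB: "tC d * T ?B1 = T ?C1 * tC d" "tC a * T ?C1 = T ?C1 * tC a"
      "tC d * T ?B2 = T ?B2 * tC d" "tC a * T ?B2 = T ?C2 * tC a"
      using abd by (intro T_beval_comm; simp add: tC_tY)+
    have E: "(T (Qsum b d) - T (Qsum a b)) * tE \<nu> = (T ?B1 - T ?B2) * tE \<nu>"
      using Qsum_tE[OF \<nu>] by (simp add: i_def j_def k_def left_diff_distrib)
    have cc: "tS (\<lambda>\<nu>. \<nu> ! a = c (\<nu> ! d)) * (tC a * tC d) = tC a * tC d * tS (\<lambda>\<nu>. \<nu> ! a = c (\<nu> ! d))"
    proof -
      have "esum (\<lambda>\<nu>. capp c d (capp c a \<nu>) ! a = c (capp c d (capp c a \<nu>) ! d))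
        = esum (\<lambda>\<nu>. \<nu> ! a = c (\<nu> ! d))"
        using abd by (intro esum_cong) (auto simp: nth_capp Jn_length c_eq_iff[symmetric])
      then show ?thesis using abd by (simp add: mult.assoc tC_tS tC_tS[THEN mult_assoc_left])
    qed
    have p1: "tB a d * ((T ?B1 - T ?B2) * tE \<nu>) = (if i = k then tM a d * (T ?B1 - T ?B2) * tE \<nu> else 0)"
    proof -
      have "tB a d * ((T ?B1 - T ?B2) * tE \<nu>) = tM a d * (T ?B1 - T ?B2) * (tS (\<lambda>\<nu>. \<nu> ! a = \<nu> ! d) * tE \<nu>)"
        by (simp add: bb_def algebra_simps S[THEN mult_assoc_left])
      then show ?thesis using \<nu> by (simp add: tS_tE i_def k_def)
    qed
    have p2: "tD a d * tC a * tC d * ((T ?B1 - T ?B2) * tE \<nu>)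
        = (if i = c k then tP a d * (T ?C1 - T ?C2) * (tC a * tC d * tE \<nu>) else 0)"
    proof -
      have "tD a d * tC a * tC d * ((T ?B1 - T ?B2) * tE \<nu>)
         = tD a d * ((T ?C1 - T ?C2) * (tC a * tC d * tE \<nu>))"
        by (simp add: algebra_simps cB[THEN mult_assoc_left])
      also have "\<dots> = tP a d * (T ?C1 - T ?C2) * (tS (\<lambda>\<nu>. \<nu> ! a = c (\<nu> ! d)) * (tC a * tC d) * tE \<nu>)"
        by (simp add: bt_def algebra_simps S[THEN mult_assoc_left])
      also have "\<dots> = tP a d * (T ?C1 - T ?C2) * (tC a * tC d * (tS (\<lambda>\<nu>. \<nu> ! a = c (\<nu> ! d)) * tE \<nu>))"
        unfolding cc by (simp add: mult.assoc)
      finally show ?thesis using \<nu> by (simp add: tS_tE i_def k_def)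
    qed
    have q1: "tM a d * (T ?B1 - T ?B2) = - T (bdd (Q i j) (?y d) (?y a) (?y b))" if "i = k"
    proof -
      have "T ?B1 = T (beval (Q i j) (?y d) (?y b))"
        using T_beval_swap[of "?y b" "?y d" j i] that abd by (simp add: tY_tY[of b d])
      then have "T ?B1 - T ?B2 = - ((tY a - tY d) * T (bdd (Q i j) (?y d) (?y a) (?y b)))"
        using T_bdd[of "?y d" "?y a" "Q i j" "?y b"] abd by (simp add: tY_tY[of d a] algebra_simps)
      then show ?thesis using tM_inv(1)[OF ad] by (simp flip: mult.assoc)
    qed
    have q2: "tP a d * (T ?C1 - T ?C2) = T (bdd (Q i j) (?y d) (- ?y a) (?y b))" if "i = c k"
    proof -
      have "T ?C1 = T (beval (Q j i) (?y b) (?y d))"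
        using that beval_Q_c2[of j i "?y b" "?y d"] by simp
      also have "\<dots> = T (beval (Q i j) (?y d) (?y b))"
        using T_beval_swap[of "?y b" "?y d" j i] abd by (simp add: tY_tY[of b d])
      finally have "T ?C1 - T ?C2 = (tY a + tY d) * T (bdd (Q i j) (?y d) (- ?y a) (?y b))"
        using T_bdd[of "?y d" "- ?y a" "Q i j" "?y b"] abd by (simp add: tY_tY[of d a] algebra_simps)
      then show ?thesis using tM_inv(3)[OF ad] by (simp flip: mult.assoc)
    qed
    have "T ?l * tE \<nu> = - (tB a d * ((T ?B1 - T ?B2) * tE \<nu>)) + tD a d * tC a * tC d * ((T ?B1 - T ?B2) * tE \<nu>)"
    proof -
      have "T ?l * tE \<nu> = T (beta a d) * ((T (Qsum b d) - T (Qsum a b)) * tE \<nu>)"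
        by (simp add: mult.assoc)
      then show ?thesis
        unfolding E T_beta by (simp only: distrib_right mult.assoc minus_mult_left)
    qed
    also have "\<dots> = (if i = k then T (bdd (Q i j) (?y d) (?y a) (?y b)) * tE \<nu> else 0)
        + (if i = c k then T (bdd (Q i j) (?y d) (- ?y a) (?y b)) * (tC a * tC d * tE \<nu>) else 0)"
      unfolding p1 p2 using q1 q2 by simp
    also have "\<dots> = T ?r * tE \<nu>"
    proof -
      have "T ?r * tE \<nu> = (\<Sum>\<mu> \<in> {\<nu> \<in> Jn n. \<nu> ! a = \<nu> ! d}.
          T (bdd (Q (\<mu> ! a) (\<mu> ! b)) (?y d) (?y a) (?y b)) * tE \<mu>) * tE \<nu>
        + (\<Sum>\<mu> \<in> {\<nu> \<in> Jn n. \<nu> ! a = c (\<nu> ! d)}.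
          (T (bdd (Q (\<mu> ! a) (\<mu> ! b)) (?y d) (- ?y a) (?y b)) * tC a * tC d) * tE \<mu>) * tE \<nu>"
        by (simp only: T_add T_sum T_mult distrib_right)
      then show ?thesis
        unfolding sum_tE_mult[OF \<nu>] by (simp only: i_def j_def k_def mult.assoc)
    qed
    finally show "T ?l * tE \<nu> = T ?r * tE \<nu>" .
  qed
  then show ?thesis by (simp add: T_sum)
qed

text \<open>If nu_a = nu_{a+1}, the swap fixes nu; if nu_a = c nu_{a+1}, the swap agrees with
  flipping both labels, which is what c_a c_{a+1} does. So both parts of beta move e(nu) in the same
  way as tau_a, or annihilate it.\<close>

lemma tsig_tE:
  assumes a: "Suc a < n" and \<nu>: "\<nu> \<in> Jn n"
  shows "tsig a * tE \<nu> = tE (lsw a \<nu>) * tsig a"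
proof -
  let ?b = "Suc a"
  have ab: "a < n" "?b < n" "a \<noteq> ?b" using a by auto
  define \<nu>' where "\<nu>' = capp c a (capp c ?b \<nu>)"
  have len: "length \<nu> = n" using \<nu> by (rule Jn_length)
  have J: "\<nu>' \<in> Jn n" "lsw a \<nu> \<in> Jn n" using \<nu> by (simp_all add: \<nu>'_def)
  have comm: "tE \<mu> * tB a ?b = tB a ?b * tE \<mu>" "tE \<mu> * tD a ?b = tD a ?b * tE \<mu>" if "\<mu> \<in> Jn n" for \<mu>
    using tS_tB[OF ab] tE_eq_tS[OF that] by simp_all
  have B: "tB a ?b * tE \<mu> = (if \<mu> ! a = \<mu> ! ?b then tM a ?b * tE \<mu> else 0)"
    "tD a ?b * tE \<mu> = (if \<mu> ! a = c (\<mu> ! ?b) then tP a ?b * tE \<mu> else 0)" if "\<mu> \<in> Jn n" for \<mu>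
    using that by (simp_all add: bb_def bt_def mult.assoc tS_tE)
  have n1: "\<nu>' ! a = c (\<nu> ! a)" "\<nu>' ! ?b = c (\<nu> ! ?b)" "lsw a \<nu> ! a = \<nu> ! ?b" "lsw a \<nu> ! ?b = \<nu> ! a"
    using len ab by (simp_all add: \<nu>'_def nth_capp nth_lsw) (simp_all add: sw_def)
  have l1: "lsw a \<nu> = \<nu>" if "\<nu> ! a = \<nu> ! ?b"
    using that len ab by (auto intro!: nth_equalityI simp: nth_lsw sw_def)
  have l2: "lsw a \<nu> = \<nu>'" if "\<nu> ! a = c (\<nu> ! ?b)"
    using that len ab by (auto intro!: nth_equalityI simp: nth_lsw sw_def \<nu>'_def nth_capp)
  have "tB a ?b * tE \<nu> = tB a ?b * tE (lsw a \<nu>)"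
    unfolding B(1)[OF \<nu>] B(1)[OF J(2)] n1 using l1 by auto
  moreover have "tD a ?b * tE \<nu>' = tD a ?b * tE (lsw a \<nu>)"
  proof (cases "\<nu> ! a = c (\<nu> ! ?b)")
    case True
    then show ?thesis using l2 by simp
  next
    case False
    then have "c (\<nu> ! a) \<noteq> c (c (\<nu> ! ?b))" "\<nu> ! ?b \<noteq> c (\<nu> ! a)" by (metis c_inv)+
    then show ?thesis unfolding B(2)[OF J(1)] B(2)[OF J(2)] n1 by simp
  qed
  moreover have "tC a * tC ?b * tE \<nu> = tE \<nu>' * (tC a * tC ?b)"
    using ab \<nu> by (simp add: mult.assoc tC_tE tC_tE[THEN mult_assoc_left] \<nu>'_def)
  ultimately have "T (beta a ?b) * tE \<nu> = tE (lsw a \<nu>) * T (beta a ?b)"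
    by (simp add: T_beta distrib_left distrib_right left_diff_distrib right_diff_distrib mult.assoc comm[OF J(2)] comm[OF J(2), THEN mult_assoc_left])
      (simp flip: mult.assoc)
  then show ?thesis
    using tT_gen[of a "SE \<nu>"] a len by (simp add: tsig algebra_simps)
qed

lemma tsig_tC:
  assumes a: "Suc a < n" and p: "p < n"
  shows "tsig a * tC p = tC (sw a p) * tsig a"
proof -
  let ?b = "Suc a"
  have ab: "a < n" "?b < n" "a \<noteq> ?b" using a by auto
  note cs = tC_tB[OF ab] tC_tB[OF ab, THEN mult_assoc_left] tC_square tC_square[THEN mult_assoc_left]
  have "T (beta a ?b) * tC p = tC (sw a p) * T (beta a ?b)"
  proof -
    consider "p = a" | "p = ?b" | "p \<noteq> a" "p \<noteq> ?b" by blast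
    then show ?thesis
    proof cases
      case 1
      then show ?thesis
        using ab tC_tC[of ?b a] mult_assoc_left[OF tC_tC[of ?b a]] by (simp add: sw_def T_beta algebra_simps cs)
    next
      case 2
      then show ?thesis
        using ab tC_tC[of ?b a] mult_assoc_left[OF tC_tC[of ?b a]] by (simp add: sw_def T_beta algebra_simps cs)
    next
      case 3
      then show ?thesis
        using ab p tC_tC[of p a] tC_tC[of p ?b] mult_assoc_left[OF tC_tC[of p a]]
        by (simp add: sw_def T_beta algebra_simps cs)
    qed
  qed
  then show ?thesis using tT_gen[of a "SCl p"] a p by (simp add: tsig algebra_simps)
qed

text \<open>tau_a permutes the y_p without correction, so the right-hand sides come from beta: y_a -
  y_{a+1} and y_a + y_{a+1} cancel the denominators of \<open>bb\<close> and
  \<open>bt\<close>.\<close>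

lemma tsig_tY:
  assumes a: "Suc a < n" and p: "p < n"
  shows "p \<noteq> a \<Longrightarrow> p \<noteq> Suc a \<Longrightarrow> tsig a * tY p = tY p * tsig a"
    and "tsig a * tY (Suc a) - tY a * tsig a
      = tS (\<lambda>\<nu>. \<nu> ! a = \<nu> ! Suc a) - tC a * tC (Suc a) * tS (\<lambda>\<nu>. \<nu> ! a = c (\<nu> ! Suc a))"
    and "tY (Suc a) * tsig a - tsig a * tY a
      = tS (\<lambda>\<nu>. \<nu> ! a = \<nu> ! Suc a) + tC a * tC (Suc a) * tS (\<lambda>\<nu>. \<nu> ! a = c (\<nu> ! Suc a))"
proof -
  let ?b = "Suc a"
  let ?E = "tS (\<lambda>\<nu>. \<nu> ! a = \<nu> ! ?b)" and ?C = "tS (\<lambda>\<nu>. \<nu> ! a = c (\<nu> ! ?b))"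
  have ab: "a < n" "?b < n" "a \<noteq> ?b" using a by auto
  have tt: "tT a * tY q = tY (sw a q) * tT a" if "q < n" for q
    using tT_gen[of a "SY q"] a that by simp
  have C: "tC a * tC ?b * ?C = ?C * (tC a * tC ?b)"
  proof -
    have "esum (\<lambda>\<nu>. capp c ?b (capp c a \<nu>) ! a = c (capp c ?b (capp c a \<nu>) ! ?b))
      = esum (\<lambda>\<nu>. \<nu> ! a = c (\<nu> ! ?b))"
      using a by (intro esum_cong) (auto simp: nth_capp Jn_length c_eq_iff[symmetric])
    then show ?thesis using ab by (simp add: mult.assoc tC_tS tC_tS[THEN mult_assoc_left])
  qed
  have cy: "tC a * tC ?b * tY a = - (tY a * (tC a * tC ?b))" "tC a * tC ?b * tY ?b = - (tY ?b * (tC a * tC ?b))"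
    using ab by (simp_all add: mult.assoc tC_tY tC_tY[THEN mult_assoc_left])
  have B: "tY a * tB a ?b - tY ?b * tB a ?b = ?E" "tY a * tD a ?b + tY ?b * tD a ?b = ?C"
    using tM_inv(2,4)[OF ab]
    by (simp_all add: bb_def bt_def flip: mult.assoc left_diff_distrib distrib_right)
  have beta: "T (beta a ?b) = - tB a ?b + tD a ?b * (tC a * tC ?b)"
    by (simp add: T_beta mult.assoc)
  { assume "p \<noteq> a" "p \<noteq> Suc a"
    then show "tsig a * tY p = tY p * tsig a"
      using ab p tt[OF p]
      by (simp add: tsig T_beta algebra_simps tY_tB[OF ab] tY_tB[OF ab, THEN mult_assoc_left] tC_tY sw_def
         tC_tY[THEN mult_assoc_left]) }
  have "T (beta a ?b) * tY ?b - tY a * T (beta a ?b)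
     = (tY a * tB a ?b - tY ?b * tB a ?b) - (tY a * tD a ?b + tY ?b * tD a ?b) * (tC a * tC ?b)"
    unfolding beta using ab
    by (simp add: distrib_left distrib_right left_diff_distrib right_diff_distrib mult.assoc cy[unfolded mult.assoc] tY_tB[OF ab]
        tY_tB[OF ab, THEN mult_assoc_left])
  then show "tsig a * tY ?b - tY a * tsig a = ?E - tC a * tC ?b * ?C"
    unfolding B C using a tt[of ?b] by (simp add: tsig algebra_simps sw_def)
  have "tY ?b * T (beta a ?b) - T (beta a ?b) * tY a
     = (tY a * tB a ?b - tY ?b * tB a ?b) + (tY a * tD a ?b + tY ?b * tD a ?b) * (tC a * tC ?b)"
    unfolding beta using ab
    by (simp add: distrib_left distrib_right left_diff_distrib right_diff_distrib mult.assoc cy[unfolded mult.assoc] tY_tB[OF ab]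
        tY_tB[OF ab, THEN mult_assoc_left])
  then show "tY ?b * tsig a - tsig a * tY a = ?E + tC a * tC ?b * ?C"
    unfolding B C using a tt[of a] by (simp add: tsig algebra_simps sw_def)
qed

text \<open>A distant c_r passes both Clifford generators of beta_{a,a+1}, and the two signs cancel;
  hence the beta of disjoint pairs commute.\<close>

lemma tsig_far:
  assumes ab: "Suc a < n" "Suc b < n" "a + 1 < b \<or> b + 1 < a"
  shows "tsig a * tsig b = tsig b * tsig a"
proof -
  have a: "a < n" "Suc a < n" "a \<noteq> Suc a" and b: "b < n" "Suc b < n" "b \<noteq> Suc b" using ab by auto
  have ne: "a \<noteq> b" "Suc a \<noteq> b" "a \<noteq> Suc b" "b \<noteq> Suc a" using ab by auto
  have c: "tC r * T (beta a (Suc a)) = T (beta a (Suc a)) * tC r" if "r < n" "r \<noteq> a" "r \<noteq> Suc a" for r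
    using that tC_tC[of r a] tC_tC[of r "Suc a"] mult_assoc_left[OF tC_tC[of r a]] a
    by (simp add: T_beta algebra_simps tC_tB(5,6)[OF a] tC_tB(5,6)[OF a, THEN mult_assoc_left])
  have B: "tB b (Suc b) * T (beta a (Suc a)) = T (beta a (Suc a)) * tB b (Suc b)"
    "tD b (Suc b) * T (beta a (Suc a)) = T (beta a (Suc a)) * tD b (Suc b)"
    using ne a b
    by (simp_all add: T_beta algebra_simps tC_tB(5,6)[OF b] tC_tB(5,6)[OF b, THEN mult_assoc_left])
      (simp_all flip: mult.assoc add: tB_tB[OF a b])
  have bb: "T (beta b (Suc b)) * T (beta a (Suc a)) = T (beta a (Suc a)) * T (beta b (Suc b))"
    unfolding T_beta[of b] using ne a b
    by (simp add: distrib_left distrib_right left_diff_distrib right_diff_distrib mult.assoc c B c[THEN mult_assoc_left] B[THEN mult_assoc_left])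
  have t: "tT a * T (beta b (Suc b)) = T (beta b (Suc b)) * tT a" "tT b * T (beta a (Suc a)) = T (beta a (Suc a)) * tT b"
    using tT_beta[OF b, of a] tT_beta[OF a, of b] ab by (auto simp: sw_def split: if_splits)
  show ?thesis
    using ab tT_far[OF ab] by (simp add: tsig algebra_simps t bb)
qed

lemma fhom_RC_rel:
  assumes r: "r \<in> RC_rels c Q n"
  shows "T (fhom (RC_to_SK c n) r) = 0"
  using r unfolding RC_rels_def MA_rels_def Let_def
proof (elim UnE, goal_cases)
  \<comment> \<open>Cases 1 to 7 are the relations of MA_n, 8 and 9 move sigma_a past e(nu) and c_p,
    10 to 12 past y_p, 13 is the square, 14 distant commutation, and 15 the braid relation.\<close>
  case 1
  then show ?case by (auto simp: tE_tE)
next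
  case 2
  then show ?case using tS_True by (auto simp: esum_def)
next
  case 3
  then show ?case by (auto simp: tY_tE)
next
  case 4
  then show ?case by (auto simp: tC_tE)
next
  case 5
  then obtain p q where "r = gen (RY p) * gen (RY q) - gen (RY q) * gen (RY p)" "p < n" "q < n" by auto
  then show ?case using tY_tY[of p q] by simp
next
  case 6
  then obtain p q where "r = gen (RCl p) * gen (RCl q) + gen (RCl q) * gen (RCl p) - (if p = q then 2 else 0)"
    "p < n" "q < n" by auto
  then show ?case using tC_tC[of p q] tC_square[of p] T_add[of 1 1] by auto
next
  case 7
  then show ?case by (auto simp: tC_tY)
next
  case 8
  then show ?case by (auto simp: tsig_tE)
next
  case 9
  then show ?case by (auto simp: tsig_tC)
next
  case 10
  then show ?case by (auto simp: tsig_tY(1))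
next
  case 11
  then obtain a where a: "Suc a < n" "r = gen (RS a) * gen (RY (Suc a)) - gen (RY a) * gen (RS a)
     - ((\<Sum>\<nu> \<in> {\<nu> \<in> Jn n. \<nu> ! a = \<nu> ! Suc a}. gen (RE \<nu>))
       - (\<Sum>\<nu> \<in> {\<nu> \<in> Jn n. \<nu> ! a = c (\<nu> ! Suc a)}. gen (RCl a) * gen (RCl (Suc a)) * gen (RE \<nu>)))" by auto
  show ?case
    using tsig_tY(2)[OF a(1)] a(1) by (simp add: a(2) esum_def T_sum sum_distrib_left)
next
  case 12
  then obtain a where a: "Suc a < n" "r = gen (RY (Suc a)) * gen (RS a) - gen (RS a) * gen (RY a)
     - ((\<Sum>\<nu> \<in> {\<nu> \<in> Jn n. \<nu> ! a = \<nu> ! Suc a}. gen (RE \<nu>))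
       + (\<Sum>\<nu> \<in> {\<nu> \<in> Jn n. \<nu> ! a = c (\<nu> ! Suc a)}. gen (RCl a) * gen (RCl (Suc a)) * gen (RE \<nu>)))" by auto
  show ?case
    using tsig_tY(3)[OF a(1)] a(1) by (simp add: a(2) esum_def T_sum sum_distrib_left)
next
  case 13
  then show ?case by (auto simp: tsig_square Qsum_tE)
next
  case 14
  then obtain a b where "r = gen (RS a) * gen (RS b) - gen (RS b) * gen (RS a)"
    "Suc a < n" "Suc b < n" "a + 1 < b \<or> b + 1 < a" by auto
  then show ?case using tsig_far[of a b] by simp
next
  case 15
  then obtain a where a: "a + 2 < n" "r = gen (RS (a + 1)) * gen (RS a) * gen (RS (a + 1)) - gen (RS a) * gen (RS (a + 1)) * gen (RS a)
          - (\<Sum>\<nu> \<in> {\<nu> \<in> Jn n. \<nu> ! a = \<nu> ! (a + 2)}.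
               bdd (Q (\<nu> ! a) (\<nu> ! (a + 1))) (gen (RY (a + 2))) (gen (RY a)) (gen (RY (a + 1))) * gen (RE \<nu>))
          - (\<Sum>\<nu> \<in> {\<nu> \<in> Jn n. \<nu> ! a = c (\<nu> ! (a + 2))}.
               bdd (Q (\<nu> ! a) (\<nu> ! (a + 1))) (gen (RY (a + 2))) (- gen (RY a)) (gen (RY (a + 1)))
                 * gen (RCl a) * gen (RCl (a + 2)) * gen (RE \<nu>))" by auto
  have "a < n" "a + 1 < n" "a + 2 < n" "a \<noteq> a + 1" "a \<noteq> a + 2" "a + 1 \<noteq> a + 2" using a by auto
  note br = tsig_braid[OF a(1), unfolded beta_Qsum[OF this]]
  show ?case
    unfolding a(2) fhom_diff fhom_mult fhom_sum fhom_bdd fhom_gen fhom_uminus RC_to_SK.simps T_diff T_mult T_sum br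
    by simp
qed

lemma fvalid_sigma_img: "Suc a < n \<Longrightarrow> fvalid (svalid n) (sigma_img c n a)"
  unfolding sigma_img_def Let_def by (auto intro!: fvalid_sum fvalid_mult fvalid_gen fvalid_add fvalid_diff simp: Jn_def)

lemma fvalid_RC_to_SK: "rvalid n g \<Longrightarrow> fvalid (svalid n) (RC_to_SK c n g)"
  by (cases g) (auto simp: fvalid_sigma_img)

lemma fvalid_if: "fvalid P x \<Longrightarrow> fvalid P y \<Longrightarrow> fvalid P (if b then x else y)"
  by simp

lemmas fvalid_intros = fvalid_add fvalid_diff fvalid_uminus fvalid_mult fvalid_if fvalid_sum fvalid_power
  fvalid_beval fvalid_bdd fvalid_gen fvalid_0 fvalid_1 fvalid_2

lemma fvalid_RC_rels: "r \<in> RC_rels c Q n \<Longrightarrow> fvalid (rvalid n) r"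
  unfolding RC_rels_def MA_rels_def Let_def
  by (elim UnE; (elim CollectE exE conjE singletonE)?; hypsubst;
      intro fvalid_intros; auto simp: Jn_def capp_def sw_def)

lemma fvalid_SK_rels: "r \<in> SK_rels c Q n \<Longrightarrow> fvalid (svalid n) r"
  unfolding SK_rels_def MA_rels_def Let_def
proof (elim UnE, goal_cases)
  case 14
  then show ?case unfolding Rab_def Let_def
    by (elim CollectE exE conjE; hypsubst; intro fvalid_intros; auto simp: Jn_def)
next
  case 15
  then obtain k g where kg: "r = gen (ST k) * gen g - gen (sact k g) * gen (ST k)"
      "Suc k < n" "svalid n g" by auto
  then have "svalid n (sact k g)"
    by (cases g) (auto simp: sw_less dest: arg_cong[of _ _ "sw k"])
  then show ?case unfolding kg(1) by (intro fvalid_intros) (use kg in simp_all)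
qed ((elim CollectE exE conjE singletonE)?; hypsubst; intro fvalid_intros; auto simp: Jn_def capp_def)+

theorem RC_rels_hold:
  assumes r: "r \<in> RC_rels c Q n"
  shows "fhom (RC_to_SK c n) r \<in> SK_ideal c Q n"
  unfolding SK_ideal_def
proof (rule gen_ideal_retract)
  show "fhom (RC_to_SK c n) r \<in> gen_ideal (\<lambda>_. True) (SK_rels c Q n)"
    using fhom_RC_rel[OF r] T_eq_0_iff by blast
  show "fvalid (svalid n) (fhom (RC_to_SK c n) r)"
    using fvalid_RC_rels[OF r] fvalid_RC_to_SK by (rule fvalid_fhom)
qed (rule fvalid_SK_rels)

end

section \<open>Reduced words of the symmetric group\<close>

fun wact :: "nat list \<Rightarrow> 'a list \<Rightarrow> 'a list" where
  "wact [] x = x"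
| "wact (a # u) x = wact u (lsw a x)"

definition invs :: "nat list \<Rightarrow> nat" where
  "invs xs = card {(i, j). i < j \<and> j < length xs \<and> xs ! j < xs ! i}"

text \<open>A permutation is represented by the list that the word sorts. A swap of unequal
  neighbours changes \<open>invs\<close> by one, so for distinct entries no shorter word sorts
  \<open>xs\<close>.\<close>

definition reduced :: "nat list \<Rightarrow> nat list \<Rightarrow> bool" where
  "reduced u xs \<longleftrightarrow> (\<forall>a\<in>set u. Suc a < length xs) \<and> sorted (wact u xs) \<and> length u = invs xs"

text \<open>Tails are built into \<open>far\<close> and \<open>braid\<close>, so closure under a
  letter in front suffices for arbitrary contexts.\<close>

inductive braid_equiv :: "nat list \<Rightarrow> nat list \<Rightarrow> bool" (infix "\<simeq>" 50) where
  refl: "u \<simeq> u"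
| sym: "u \<simeq> v \<Longrightarrow> v \<simeq> u"
| trans: "u \<simeq> v \<Longrightarrow> v \<simeq> w \<Longrightarrow> u \<simeq> w"
| Cons: "u \<simeq> v \<Longrightarrow> a # u \<simeq> a # v"
| far: "a + 1 < b \<or> b + 1 < a \<Longrightarrow> a # b # s \<simeq> b # a # s"
| braid: "a # Suc a # a # s \<simeq> Suc a # a # Suc a # s"

lemma braid_equiv_same: "u \<simeq> v \<Longrightarrow> length u = length v \<and> set u = set v"
  by (induction rule: braid_equiv.induct) auto

lemma length_wact [simp]: "length (wact u x) = length x"
  by (induction u arbitrary: x) auto

lemma wact_append: "wact (u @ v) x = wact v (wact u x)"
  by (induction u arbitrary: x) auto

lemma wact_rev: "(\<forall>a\<in>set u. Suc a < length x) \<Longrightarrow> wact u (wact (rev u) x) = x"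
  by (induction u arbitrary: x) (auto simp: wact_append)

lemma wact_inj:
  "(\<forall>a\<in>set u. Suc a < length x) \<Longrightarrow> length x = length y \<Longrightarrow> wact u x = wact u y \<Longrightarrow> x = y"
proof (induction u arbitrary: x y)
  case (Cons a u)
  then have l: "Suc a < length x" "Suc a < length y" by auto
  have "lsw a x = lsw a y"
    by (rule Cons.IH) (use Cons.prems in simp_all)
  then have "lsw a (lsw a x) = lsw a (lsw a y)" by (rule arg_cong)
  then show ?case unfolding lsw_lsw[OF l(1)] lsw_lsw[OF l(2)] .
qed simp

lemma set_lsw: "Suc a < length x \<Longrightarrow> set (lsw a x) = set x"
  unfolding lsw_def by (rule set_swap) auto

lemma distinct_lsw: "Suc a < length x \<Longrightarrow> distinct (lsw a x) = distinct x"
  unfolding lsw_def by (rule distinct_swap) auto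

lemma wact_set_distinct:
  "(\<forall>a\<in>set u. Suc a < length x) \<Longrightarrow> set (wact u x) = set x \<and> distinct (wact u x) = distinct x"
  by (induction u arbitrary: x) (auto simp: set_lsw distinct_lsw)

lemma nth_lsw_at:
  assumes "Suc a < length x"
  shows "lsw a x ! a = x ! Suc a" "lsw a x ! Suc a = x ! a"
    "p < length x \<Longrightarrow> p \<noteq> a \<Longrightarrow> p \<noteq> Suc a \<Longrightarrow> lsw a x ! p = x ! p"
  using assms by (auto simp: nth_lsw sw_def)

lemma finite_inversions: "finite {(i, j). i < j \<and> j < length xs \<and> xs ! j < (xs ! i :: nat)}"
  by (rule finite_subset[of _ "{..<length xs} \<times> {..<length xs}"]) auto

text \<open>Relabelling pairs by the swap maps the inversions of \<open>xs\<close> bijectively onto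
  those of \<open>lsw a xs\<close> other than \<open>(a, Suc a)\<close>, the one new
  inversion.\<close>

lemma invs_lsw_ascent:
  assumes a: "Suc a < length xs" and lt: "xs ! a < xs ! Suc a"
  shows "invs (lsw a xs) = Suc (invs xs)"
proof -
  define I where "I ys = {(i, j). i < j \<and> j < length ys \<and> ys ! j < (ys ! i :: nat)}" for ys
  define f where "f = (\<lambda>(i, j). (sw a i, sw a j))"
  have fin: "finite (I ys)" for ys unfolding I_def by (rule finite_inversions)
  have ff: "f (f z) = z" for z by (cases z) (simp add: f_def)
  have mono: "sw a i < sw a j" if "i < j" "(i, j) \<noteq> (a, Suc a)" for i j
    using that by (auto simp: sw_def)
  have "f ` I xs = I (lsw a xs) - {(a, Suc a)}"
  proof
    show "f ` I xs \<subseteq> I (lsw a xs) - {(a, Suc a)}"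
    proof
      fix z assume "z \<in> f ` I xs"
      then obtain i j where ij: "z = (sw a i, sw a j)" "i < j" "j < length xs" "xs ! j < xs ! i"
        by (auto simp: I_def f_def)
      then have "(i, j) \<noteq> (a, Suc a)" "(i, j) \<noteq> (Suc a, a)" using lt by auto
      moreover from this have "z \<noteq> (a, Suc a)" using ij(1) by (metis Pair_inject sw_def sw_sw)
      ultimately show "z \<in> I (lsw a xs) - {(a, Suc a)}"
        using ij a mono[of i j] by (auto simp: I_def nth_lsw sw_less)
    qed
    show "I (lsw a xs) - {(a, Suc a)} \<subseteq> f ` I xs"
    proof
      fix z assume z: "z \<in> I (lsw a xs) - {(a, Suc a)}"
      then obtain i j where ij: "z = (i, j)" "i < j" "j < length xs" "lsw a xs ! j < lsw a xs ! i"
        "(i, j) \<noteq> (a, Suc a)"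
        by (auto simp: I_def)
      then have "f z \<in> I xs"
        using a mono[of i j] by (auto simp: I_def f_def nth_lsw sw_less)
      then show "z \<in> f ` I xs" using ff[of z] by (metis image_eqI)
    qed
  qed
  moreover have "(a, Suc a) \<in> I (lsw a xs)"
    using a lt by (simp add: I_def nth_lsw_at)
  moreover have "inj_on f (I xs)" by (metis ff inj_onI)
  ultimately have "card (I (lsw a xs)) = Suc (card (I xs))"
    using fin by (metis card_image card_Suc_Diff1)
  then show ?thesis by (simp add: invs_def I_def)
qed

lemma invs_lsw_descent:
  assumes a: "Suc a < length xs" and gt: "xs ! Suc a < xs ! a"
  shows "invs xs = Suc (invs (lsw a xs))"
  using invs_lsw_ascent[of a "lsw a xs"] a gt by (simp add: nth_lsw_at)

lemma invs_sorted: "sorted xs \<Longrightarrow> invs xs = 0"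
proof -
  assume "sorted xs"
  then have "\<not> (i < j \<and> j < length xs \<and> xs ! j < xs ! i)" for i j
    using sorted_nth_mono[of xs i j] by auto
  then have "{(i, j). i < j \<and> j < length xs \<and> xs ! j < xs ! i} = {}" by blast
  then show "invs xs = 0" unfolding invs_def by (simp only: card.empty)
qed

lemma invs_le_length:
  "(\<forall>a\<in>set u. Suc a < length xs) \<Longrightarrow> distinct xs \<Longrightarrow> sorted (wact u xs) \<Longrightarrow> invs xs \<le> length u"
proof (induction u arbitrary: xs)
  case Nil
  then show ?case by (simp add: invs_sorted)
next
  case (Cons a u)
  then have "invs (lsw a xs) \<le> length u" by (intro Cons.IH) (auto simp: distinct_lsw)
  moreover have "xs ! a \<noteq> xs ! Suc a" using Cons.prems by (simp add: nth_eq_iff_index_eq)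
  ultimately show ?case
    using invs_lsw_ascent[of a xs] invs_lsw_descent[of a xs] Cons.prems by (auto simp: neq_iff)
qed

lemma reduced_ConsI:
  "Suc a < length xs \<Longrightarrow> xs ! Suc a < xs ! a \<Longrightarrow> reduced u (lsw a xs) \<Longrightarrow> reduced (a # u) xs"
  using invs_lsw_descent[of a xs] by (auto simp: reduced_def)

text \<open>If the first letter were an ascent, it would create an inversion, and the remaining
  \<open>invs xs - 1\<close> letters would have to remove \<open>invs xs + 1\<close> of
  them.\<close>

lemma reduced_ConsD:
  assumes "reduced (a # u) xs" "distinct xs"
  shows "Suc a < length xs" "xs ! Suc a < xs ! a" "reduced u (lsw a xs)"
proof -
  have r: "\<forall>b\<in>set u. Suc b < length (lsw a xs)" "sorted (wact u (lsw a xs))" "Suc (length u) = invs xs"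
    using assms by (auto simp: reduced_def)
  show a: "Suc a < length xs" using assms by (auto simp: reduced_def)
  have le: "invs (lsw a xs) \<le> length u"
    using r a assms(2) by (intro invs_le_length) (auto simp: distinct_lsw)
  have "xs ! a \<noteq> xs ! Suc a" using a assms(2) by (simp add: nth_eq_iff_index_eq)
  then show d: "xs ! Suc a < xs ! a"
    using invs_lsw_ascent[OF a] le r(3) by (metis linorder_neqE_nat not_less_eq_eq le_SucI Suc_n_not_le_n)
  show "reduced u (lsw a xs)"
    using r invs_lsw_descent[OF a d] by (auto simp: reduced_def)
qed

lemma reduced_exists: "\<exists>u. reduced u xs"
proof (induction "invs xs" arbitrary: xs rule: less_induct)
  case less
  show ?case
  proof (cases "sorted xs")
    case True
    then have "reduced [] xs" by (simp add: reduced_def invs_sorted)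
    then show ?thesis ..
  next
    case False
    then obtain a where a: "Suc a < length xs" "xs ! Suc a < xs ! a"
      by (auto simp: sorted_iff_nth_Suc not_le)
    then obtain u where "reduced u (lsw a xs)"
      using less[of "lsw a xs"] invs_lsw_descent[of a xs] by auto
    then show ?thesis using reduced_ConsI a by blast
  qed
qed

text \<open>Matsumoto's theorem: two distinct left descents of \<open>xs\<close> can be removed one after the
  other, which connects any two reduced words.\<close>
theorem reduced_braid_equiv:
  "reduced u xs \<Longrightarrow> reduced v xs \<Longrightarrow> distinct xs \<Longrightarrow> u \<simeq> v"
proof (induction "length u" arbitrary: u v xs rule: less_induct)
  case less
  note IH = less.hyps
  have len: "length u = length v" using less.prems by (simp add: reduced_def)
  show ?case
  proof (cases u)
    case Nil
    then show ?thesis using len by (auto intro: braid_equiv.refl)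
  next
    case u: (Cons a u')
    then obtain b v' where v: "v = b # v'" using len by (cases v) auto
    note ra = reduced_ConsD[OF less.prems(1)[unfolded u] less.prems(3)]
    note rb = reduced_ConsD[OF less.prems(2)[unfolded v] less.prems(3)]
    have dist: "distinct (lsw a xs)" "distinct (lsw b xs)"
      using less.prems(3) ra(1) rb(1) by (simp_all add: distinct_lsw)
    have len': "length u' < length u" "length v' < length u" using u v len by auto
    \<comment> \<open>Descents at \<open>p\<close> and \<open>Suc p\<close> mean three decreasing
      entries, which both braid words reverse. With \<open>w\<close> sorting the result, induction
      compares \<open>x\<close> and \<open>y\<close> with two continuations that differ by one braid
      move.\<close>
    have sym_case: "p # x \<simeq> Suc p # y"
      if "reduced x (lsw p xs)" "reduced y (lsw (Suc p) xs)" "length x < length u" "length y < length u"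
        "Suc (Suc p) < length xs" "xs ! Suc p < xs ! p" "xs ! Suc (Suc p) < xs ! Suc p" for p x y
    proof -
      obtain w where w: "reduced w (lsw p (lsw (Suc p) (lsw p xs)))" using reduced_exists by blast
      have d: "distinct (lsw p xs)" "distinct (lsw (Suc p) xs)" using that less.prems(3) by (simp_all add: distinct_lsw)
      have "reduced (Suc p # p # w) (lsw p xs)"
        by (intro reduced_ConsI) (use that w in \<open>simp_all add: nth_lsw sw_less\<close>, simp_all add: sw_def)
      from IH[OF that(3) that(1) this d(1)] have x: "x \<simeq> Suc p # p # w" .
      have "reduced (p # Suc p # w) (lsw (Suc p) xs)"
        by (intro reduced_ConsI) (use that w lsw_braid[where i = p and x = xs] in \<open>simp_all add: nth_lsw sw_less\<close>, simp_all add: sw_def)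
      from IH[OF that(4) that(2) this d(2)] have y: "y \<simeq> p # Suc p # w" .
      show ?thesis
        using braid_equiv.Cons[OF x, of p] braid_equiv.Cons[OF y, of "Suc p"] braid_equiv.braid[of p w]
        by (meson braid_equiv.sym braid_equiv.trans)
    qed
    consider "a = b" | "a + 1 < b \<or> b + 1 < a" | "b = Suc a" | "a = Suc b" by linarith
    then show ?thesis
    proof cases
      case 1
      then show ?thesis using IH[OF len'(1) ra(3) _ dist(1), of v'] rb(3) u v by (auto intro: braid_equiv.Cons)
    next
      case 2
      obtain w where w: "reduced w (lsw b (lsw a xs))" using reduced_exists by blast
      have "lsw b (lsw a xs) = lsw a (lsw b xs)"
        using 2 ra(1) rb(1) by (intro lsw_far) auto
      with w have w': "reduced w (lsw a (lsw b xs))" by simp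
      have "reduced (b # w) (lsw a xs)"
        by (rule reduced_ConsI) (use 2 ra rb w in \<open>simp_all add: nth_lsw sw_less\<close>, auto simp: sw_def)
      from IH[OF len'(1) ra(3) this dist(1)] have x: "u' \<simeq> b # w" .
      have "reduced (a # w) (lsw b xs)"
        by (rule reduced_ConsI) (use 2 ra rb w' in \<open>simp_all add: nth_lsw sw_less\<close>, auto simp: sw_def)
      from IH[OF len'(2) rb(3) this dist(2)] have y: "v' \<simeq> a # w" .
      show ?thesis unfolding u v
        using braid_equiv.Cons[OF x, of a] braid_equiv.Cons[OF y, of b] braid_equiv.far[OF 2, of w]
        by (meson braid_equiv.sym braid_equiv.trans)
    next
      case 3
      then show ?thesis unfolding u v using sym_case[of u' a v'] ra rb len' by simp
    next
      case 4
      then show ?thesis unfolding u v using sym_case[of v' b u'] ra rb len' by (simp add: braid_equiv.sym)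
    qed
  qed
qed

text \<open>The exchange property: if \<open>u\<close> is reduced and \<open>a\<close> is an ascent
  of \<open>xs\<close>, then \<open>a\<close> is a descent of \<open>lsw a xs\<close>, so some
  reduced word for \<open>lsw a xs\<close> begins with \<open>a\<close>. By Matsumoto's theorem
  \<open>u\<close> is equivalent to it, and \<open>a # u\<close> acquires a repeated letter.\<close>

lemma word_dichotomy:
  assumes "\<forall>a\<in>set u. Suc a < length xs" "distinct xs" "sorted (wact u xs)"
  shows "reduced u xs \<or> (\<exists>p a s. u \<simeq> p @ a # a # s)"
  using assms
proof (induction u arbitrary: xs)
  case Nil
  then have "invs xs \<le> 0" using invs_le_length[of "[]" xs] by simp
  then show ?case using Nil by (simp add: reduced_def)
next
  case (Cons a u)
  then have a: "Suc a < length xs" by simp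
  have ne: "xs ! a \<noteq> xs ! Suc a" using Cons.prems by (simp add: nth_eq_iff_index_eq)
  have dist: "distinct (lsw a xs)" using Cons.prems a by (simp add: distinct_lsw)
  have "reduced u (lsw a xs) \<or> (\<exists>p a s. u \<simeq> p @ a # a # s)"
    by (rule Cons.IH) (use Cons.prems dist in auto)
  then show ?case
  proof
    assume u: "reduced u (lsw a xs)"
    show ?thesis
    proof (cases "xs ! Suc a < xs ! a")
      case True
      then show ?thesis using reduced_ConsI[OF a _ u] by blast
    next
      case False
      obtain w where w: "reduced w xs" using reduced_exists by blast
      have "reduced (a # w) (lsw a xs)"
        by (rule reduced_ConsI) (use False ne w a in \<open>simp_all add: nth_lsw_at\<close>)
      then have "u \<simeq> a # w" using reduced_braid_equiv[OF u _ dist] by blast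
      then have "a # u \<simeq> [] @ a # a # w" by (simp add: braid_equiv.Cons)
      then show ?thesis by blast
    qed
  next
    assume "\<exists>p a s. u \<simeq> p @ a # a # s"
    then obtain p b s where "u \<simeq> p @ b # b # s" by blast
    then have "a # u \<simeq> (a # p) @ b # b # s" by (simp add: braid_equiv.Cons)
    then show ?thesis by blast
  qed
qed

section \<open>A spanning set\<close>

lemma RC_relsI:
  fixes c :: "'j::finite \<Rightarrow> 'j" and Q :: "'j \<Rightarrow> 'j \<Rightarrow> 'k::comm_ring_1 poly poly"
  shows "r \<in> MA_rels c n (\<lambda>p. gen (RY p)) (\<lambda>p. gen (RCl p)) (\<lambda>\<nu>. gen (RE \<nu>)) \<Longrightarrow> r \<in> RC_rels c Q n"
  "Suc a < n \<Longrightarrow> \<nu> \<in> Jn n \<Longrightarrow> gen (RS a) * gen (RE \<nu>) - gen (RE (lsw a \<nu>)) * gen (RS a) \<in> RC_rels c Q n"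
  "Suc a < n \<Longrightarrow> p < n \<Longrightarrow> gen (RS a) * gen (RCl p) - gen (RCl (sw a p)) * gen (RS a) \<in> RC_rels c Q n"
  "Suc a < n \<Longrightarrow> p < n \<Longrightarrow> p \<noteq> a \<Longrightarrow> p \<noteq> Suc a \<Longrightarrow> gen (RS a) * gen (RY p) - gen (RY p) * gen (RS a) \<in> RC_rels c Q n"
  "Suc a < n \<Longrightarrow> gen (RS a) * gen (RY (Suc a)) - gen (RY a) * gen (RS a)
     - ((\<Sum>\<nu> \<in> {\<nu> \<in> Jn n. \<nu> ! a = \<nu> ! Suc a}. gen (RE \<nu>))
       - (\<Sum>\<nu> \<in> {\<nu> \<in> Jn n. \<nu> ! a = c (\<nu> ! Suc a)}. gen (RCl a) * gen (RCl (Suc a)) * gen (RE \<nu>))) \<in> RC_rels c Q n"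
  "Suc a < n \<Longrightarrow> gen (RY (Suc a)) * gen (RS a) - gen (RS a) * gen (RY a)
     - ((\<Sum>\<nu> \<in> {\<nu> \<in> Jn n. \<nu> ! a = \<nu> ! Suc a}. gen (RE \<nu>))
       + (\<Sum>\<nu> \<in> {\<nu> \<in> Jn n. \<nu> ! a = c (\<nu> ! Suc a)}. gen (RCl a) * gen (RCl (Suc a)) * gen (RE \<nu>))) \<in> RC_rels c Q n"
  "Suc a < n \<Longrightarrow> \<nu> \<in> Jn n \<Longrightarrow> gen (RS a) * gen (RS a) * gen (RE \<nu>)
     - beval (Q (\<nu> ! a) (\<nu> ! Suc a)) (gen (RY a)) (gen (RY (Suc a))) * gen (RE \<nu>) \<in> RC_rels c Q n"
  "Suc a < n \<Longrightarrow> Suc b < n \<Longrightarrow> a + 1 < b \<or> b + 1 < a \<Longrightarrow> gen (RS a) * gen (RS b) - gen (RS b) * gen (RS a) \<in> RC_rels c Q n"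
  "a + 2 < n \<Longrightarrow> gen (RS (a + 1)) * gen (RS a) * gen (RS (a + 1)) - gen (RS a) * gen (RS (a + 1)) * gen (RS a)
          - (\<Sum>\<nu> \<in> {\<nu> \<in> Jn n. \<nu> ! a = \<nu> ! (a + 2)}.
               bdd (Q (\<nu> ! a) (\<nu> ! (a + 1))) (gen (RY (a + 2))) (gen (RY a)) (gen (RY (a + 1))) * gen (RE \<nu>))
          - (\<Sum>\<nu> \<in> {\<nu> \<in> Jn n. \<nu> ! a = c (\<nu> ! (a + 2))}.
               bdd (Q (\<nu> ! a) (\<nu> ! (a + 1))) (gen (RY (a + 2))) (- gen (RY a)) (gen (RY (a + 1)))
                 * gen (RCl a) * gen (RCl (a + 2)) * gen (RE \<nu>)) \<in> RC_rels c Q n"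
  unfolding RC_rels_def Let_def by blast+

fun MAgen :: "'j rgen \<Rightarrow> bool" where
  "MAgen (RS a) = False"
| "MAgen _ = True"

context rc_data
begin

definition U :: "('j rgen, 'k) falg \<Rightarrow> ('j rgen, 'k) falg quots" where
  "U = proj (gen_ideal (\<lambda>_. True) (RC_rels c Q n))"

lemma U_add [simp]: "U (x + y) = U x + U y"
  and U_uminus [simp]: "U (- x) = - U x"
  and U_diff [simp]: "U (x - y) = U x - U y"
  and U_mult [simp]: "U (x * y) = U x * U y"
  and U_0 [simp]: "U 0 = 0"
  and U_sum: "U (\<Sum>i\<in>A. f i) = (\<Sum>i\<in>A. U (f i))"
  by (simp_all add: U_def proj_add proj_uminus proj_diff proj_mult proj_0 proj_sum)

lemma U_one [simp]: "U 1 * U x = U x" "U 1 * (U x * z) = U x * z" "U x * U 1 = U x" "U x * (U 1 * z) = U x * z"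
  by (simp_all only: U_def proj_one_left proj_one_right)

lemma U_eq_0_iff: "U x = 0 \<longleftrightarrow> x \<in> gen_ideal (\<lambda>_. True) (RC_rels c Q n)"
  unfolding U_def by (rule proj_eq_0_iff) (rule two_sided_gen_ideal)

lemma U_rel: "r \<in> RC_rels c Q n \<Longrightarrow> U r = 0"
  using U_eq_0_iff gen_ideal_rel by blast

lemmas U_MA_rel = U_rel[OF RC_relsI(1)]

lemma U_sc_commute: "U (sc a) * U x = U x * U (sc a)"
  by (metis U_mult sc_commute)

abbreviation "uY p \<equiv> U (gen (RY p))"
abbreviation "uC p \<equiv> U (gen (RCl p))"
abbreviation "uE \<nu> \<equiv> U (gen (RE \<nu>))"
abbreviation "uS a \<equiv> U (gen (RS a))"

definition sword :: "nat list \<Rightarrow> ('j rgen, 'k) falg" where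
  "sword u = prod_list (map (\<lambda>a. gen (RS a)) u)"

lemma sword_simps [simp]: "sword [] = 1" "sword (a # u) = gen (RS a) * sword u"
  "sword (u @ v) = sword u * sword v"
  by (simp_all add: sword_def)

text \<open>The left MA_n-span of the sigma-words of length less than \<open>l\<close>. The strict
  bound lets \<open>filt (length u)\<close> hold the error terms of a word \<open>u\<close>.\<close>

inductive filt :: "nat \<Rightarrow> ('j rgen, 'k) falg quots \<Rightarrow> bool" for l where
  word: "length u < l \<Longrightarrow> \<forall>a\<in>set u. Suc a < n \<Longrightarrow> filt l (U (sword u))"
| zero: "filt l 0"
| add: "filt l x \<Longrightarrow> filt l y \<Longrightarrow> filt l (x + y)"
| gen: "filt l x \<Longrightarrow> rvalid n g \<Longrightarrow> MAgen g \<Longrightarrow> filt l (U (gen g) * x)"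
| scal: "filt l x \<Longrightarrow> filt l (U (sc k) * x)"

lemma filt_mono: "filt l x \<Longrightarrow> l \<le> l' \<Longrightarrow> filt l' x"
  by (induction rule: filt.induct) (auto intro: filt.intros)

lemma filt_uminus: "filt l x \<Longrightarrow> filt l (- x)"
proof (induction rule: filt.induct)
  case (word u)
  have "filt l (U (sc (- 1)) * U (sword u))" using word by (intro filt.intros) auto
  then show ?case by (simp add: sc_minus)
qed (simp_all add: filt.intros flip: mult_minus_right del: mult_minus_right, metis add_uminus_conv_diff filt.add minus_add_distrib)

lemma filt_diff: "filt l x \<Longrightarrow> filt l y \<Longrightarrow> filt l (x - y)"
  using filt.add[OF _ filt_uminus] by fastforce

lemma filt_sum: "(\<And>i. i \<in> A \<Longrightarrow> filt l (f i)) \<Longrightarrow> filt l (\<Sum>i\<in>A. f i)"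
  by (induction A rule: infinite_finite_induct) (auto intro: filt.intros)

lemma filt_MA:
  assumes "fvalid (\<lambda>g. rvalid n g \<and> MAgen g) m" "filt l x"
  shows "filt l (U m * x)"
proof -
  have *: "filt l (U (prod_list (map gen w)) * x)" if "\<And>g. g \<in> set w \<Longrightarrow> rvalid n g \<and> MAgen g" for w
    using that
  proof (induction w)
    case Nil
    \<comment> \<open>\<open>U 1\<close> is a unit only on this factor of the product ring, so the
      equation is derived from how \<open>x\<close> was built.\<close>
    have "U 1 * x = x" using assms(2)
      by (induction rule: filt.induct) (simp_all add: distrib_left)
    then show ?case using assms(2) by simp
  next
    case (Cons g w)
    then show ?case using filt.gen[of l "U (prod_list (map gen w)) * x" g] by (simp add: mult.assoc)
  qed
  have "U m * x = (\<Sum>w\<in>Poly_Mapping.keys m. U (sc (Poly_Mapping.lookup m w)) * (U (prod_list (map gen (unWd w))) * x))"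
    by (subst falg_as_sum[of m]) (simp add: U_sum sum_distrib_right mult.assoc)
  also have "filt l \<dots>"
    using assms(1) by (intro filt_sum filt.scal *) (auto simp: fvalid_def)
  finally show ?thesis .
qed

lemma filt_right: "filt l x \<Longrightarrow> \<forall>a\<in>set s. Suc a < n \<Longrightarrow> filt (l + length s) (x * U (sword s))"
proof (induction rule: filt.induct)
  case (word u)
  have "filt (l + length s) (U (sword (u @ s)))" using word by (intro filt.word) auto
  then show ?case by simp
qed (simp_all add: distrib_right mult.assoc filt.intros)

text \<open>Moving \<open>\<sigma>\<^sub>a\<close> past \<open>y\<^sub>p\<close>, \<open>c\<^sub>p\<close> and \<open>e(\<nu>)\<close> produces corrections without \<open>\<sigma>\<^sub>a\<close>, which
  do not raise the filtration.\<close>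
lemma filt_sigma:
  assumes a: "Suc a < n" and x: "filt l x"
  shows "filt (Suc l) (uS a * x)"
  using x
proof (induction rule: filt.induct)
  case (word u)
  have "filt (Suc l) (U (sword (a # u)))" using word a by (intro filt.word) auto
  then show ?case by simp
next
  case zero
  then show ?case by (simp add: filt.zero)
next
  case (add x y)
  then show ?case by (simp add: distrib_left filt.add)
next
  case (scal x k)
  have "uS a * (U (sc k) * x) = U (sc k) * (uS a * x)"
    unfolding mult_assoc_left[OF U_sc_commute[symmetric]] by (rule mult.assoc)
  then show ?case using scal filt.scal by simp
next
  case (gen x g)
  have x: "filt (Suc l) x" using gen(1) filt_mono by simp
  let ?P = "\<lambda>g. rvalid n g \<and> MAgen g"
  define E where "E = (\<Sum>\<nu> \<in> {\<nu> \<in> Jn n. \<nu> ! a = \<nu> ! Suc a}. gen (RE \<nu>) :: ('j rgen, 'k) falg)"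
  define C where "C = (\<Sum>\<nu> \<in> {\<nu> \<in> Jn n. \<nu> ! a = c (\<nu> ! Suc a)}. gen (RCl a) * gen (RCl (Suc a)) * gen (RE \<nu>) :: ('j rgen, 'k) falg)"
  have EC: "fvalid ?P E" "fvalid ?P C"
    unfolding E_def C_def using a by (intro fvalid_intros; simp add: Jn_def)+
  show ?case
  proof (cases g)
    case (RY p)
    then have p: "p < n" using gen by simp
    consider "p = Suc a" | "p = a" | "p \<noteq> a" "p \<noteq> Suc a" by blast
    then show ?thesis
    proof cases
      case 1
      have "uS a * uY (Suc a) = uY a * uS a + U (E - C)"
        using U_rel[OF RC_relsI(5)[OF a], folded E_def C_def] by (simp add: algebra_simps)
      then have "uS a * (uY (Suc a) * x) = uY a * (uS a * x) + U (E - C) * x"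
        by (drule_tac z = x in mult_assoc_left) (simp add: distrib_right mult.assoc)
      moreover have "filt (Suc l) (uY a * (uS a * x) + U (E - C) * x)"
        by (rule filt.add[OF filt.gen[OF gen.IH] filt_MA[OF fvalid_diff[OF EC] x]]) (use a in auto)
      ultimately show ?thesis using RY 1 by simp
    next
      case 2
      have "uS a * uY a = uY (Suc a) * uS a - U (E + C)"
        using U_rel[OF RC_relsI(6)[OF a], folded E_def C_def] by (simp add: algebra_simps)
      then have "uS a * (uY a * x) = uY (Suc a) * (uS a * x) - U (E + C) * x"
        by (drule_tac z = x in mult_assoc_left) (simp add: left_diff_distrib mult.assoc)
      moreover have "filt (Suc l) (uY (Suc a) * (uS a * x) - U (E + C) * x)"
        by (rule filt_diff[OF filt.gen[OF gen.IH] filt_MA[OF fvalid_add[OF EC] x]]) (use a in auto)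
      ultimately show ?thesis using RY 2 by simp
    next
      case 3
      have "uS a * uY p = uY p * uS a" using U_rel[OF RC_relsI(4)[OF a p 3]] by simp
      then have "uS a * (uY p * x) = uY p * (uS a * x)" by (drule_tac z = x in mult_assoc_left) (simp add: mult.assoc)
      then show ?thesis using RY gen.IH p by (simp add: filt.gen)
    qed
  next
    case (RCl p)
    then have p: "p < n" using gen by simp
    have "uS a * uC p = uC (sw a p) * uS a" using U_rel[OF RC_relsI(3)[OF a p]] by simp
    then have "uS a * (uC p * x) = uC (sw a p) * (uS a * x)" by (drule_tac z = x in mult_assoc_left) (simp add: mult.assoc)
    then show ?thesis using RCl gen.IH p a by (simp add: filt.gen sw_less)
  next
    case (RE \<nu>)
    then have \<nu>: "\<nu> \<in> Jn n" using gen by (simp add: Jn_def)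
    have "uS a * uE \<nu> = uE (lsw a \<nu>) * uS a" using U_rel[OF RC_relsI(2)[OF a \<nu>]] by simp
    then have "uS a * (uE \<nu> * x) = uE (lsw a \<nu>) * (uS a * x)" by (drule_tac z = x in mult_assoc_left) (simp add: mult.assoc)
    then show ?thesis using RE gen.IH \<nu> by (simp add: filt.gen Jn_def)
  qed (use gen in simp)
qed

lemma filt_word_left:
  "\<forall>a\<in>set p. Suc a < n \<Longrightarrow> filt l x \<Longrightarrow> filt (length p + l) (U (sword p) * x)"
proof (induction p)
  case Nil
  have "U 1 * x = x" using Nil(2)
    by (induction rule: filt.induct) (simp_all add: distrib_left)
  then show ?case using Nil by simp
next
  case (Cons a p)
  then show ?case using filt_sigma[of a "length p + l" "U (sword p) * x"] by (simp add: mult.assoc)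
qed

lemma filt_one: "filt (Suc 0) (U 1)"
  using filt.word[of "[]" "Suc 0"] by simp

lemma U_one_Jn: "U 1 = (\<Sum>\<nu>\<in>Jn n. uE \<nu>)"
  using U_MA_rel[OF MA_relsI(2)] by (simp add: U_sum)

text \<open>sigma_a^2 lies in MA_n, so a repeated letter shortens the word; moving the result to the
  left past \<open>p\<close> does not raise the filtration further.\<close>

lemma filt_square:
  assumes "\<forall>b\<in>set (p @ a # a # s). Suc b < n"
  shows "filt (length (p @ a # a # s)) (U (sword (p @ a # a # s)))"
proof -
  have a: "Suc a < n" using assms by simp
  have "uS a * uS a = (\<Sum>\<nu>\<in>Jn n. uS a * uS a * uE \<nu>)"
    by (metis U_mult U_one(3) U_one_Jn sum_distrib_left)
  also have "\<dots> = (\<Sum>\<nu>\<in>Jn n. U (beval (Q (\<nu> ! a) (\<nu> ! Suc a)) (gen (RY a)) (gen (RY (Suc a))) * gen (RE \<nu>)) * U 1)"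
    using U_rel[OF RC_relsI(7)[OF a]] by (intro sum.cong) (auto simp: mult.assoc)
  also have "filt (Suc 0) \<dots>"
    using a by (intro filt_sum filt_MA filt_one fvalid_intros) (auto simp: Jn_def)
  finally have "filt (Suc 0) (uS a * uS a)" .
  then have "filt (Suc 0 + length s) (uS a * uS a * U (sword s))"
    using assms by (intro filt_right) auto
  then have "filt (length p + (Suc 0 + length s)) (U (sword p) * (uS a * uS a * U (sword s)))"
    using assms by (intro filt_word_left) auto
  then have "filt (length (p @ a # a # s)) (U (sword p) * (uS a * uS a * U (sword s)))"
    by (rule filt_mono) simp
  then show ?thesis by (simp add: mult.assoc)
qed

text \<open>Distant generators commute exactly; a braid move costs an element of MA_n times the
  tail, three letters shorter than the word.\<close>

lemma filt_braid_equiv: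
  "u \<simeq> v \<Longrightarrow> \<forall>a\<in>set u. Suc a < n \<Longrightarrow> filt (length u) (U (sword u) - U (sword v))"
proof (induction rule: braid_equiv.induct)
  case (refl u)
  then show ?case by (simp add: filt.zero)
next
  case (sym u v)
  then have "filt (length u) (U (sword u) - U (sword v))" using braid_equiv_same[OF sym(1)] by auto
  from filt_uminus[OF this] show ?case using braid_equiv_same[OF sym(1)] by simp
next
  case (trans u v w)
  have "filt (length u) (U (sword u) - U (sword v))" "filt (length u) (U (sword v) - U (sword w))"
    using trans braid_equiv_same[OF trans.hyps(1)] by auto
  from filt.add[OF this] show ?case by simp
next
  case (Cons u v a)
  then have "filt (Suc (length u)) (uS a * (U (sword u) - U (sword v)))"
    by (intro filt_sigma) auto
  then show ?case by (simp add: right_diff_distrib)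
next
  case (far a b s)
  then have "uS a * uS b = uS b * uS a" using U_rel[OF RC_relsI(8)[of a n b]] by simp
  then have "U (sword (a # b # s)) = U (sword (b # a # s))" by (simp flip: mult.assoc)
  then show ?case by (simp add: filt.zero)
next
  case (braid a s)
  then have a: "a + 2 < n" by auto
  let ?P = "\<lambda>g. rvalid n g \<and> MAgen g"
  define d where "d = (\<Sum>\<nu> \<in> {\<nu> \<in> Jn n. \<nu> ! a = \<nu> ! (a + 2)}.
               bdd (Q (\<nu> ! a) (\<nu> ! (a + 1))) (gen (RY (a + 2))) (gen (RY a)) (gen (RY (a + 1))) * gen (RE \<nu>))
          + (\<Sum>\<nu> \<in> {\<nu> \<in> Jn n. \<nu> ! a = c (\<nu> ! (a + 2))}.
               bdd (Q (\<nu> ! a) (\<nu> ! (a + 1))) (gen (RY (a + 2))) (- gen (RY a)) (gen (RY (a + 1)))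
                 * gen (RCl a) * gen (RCl (a + 2)) * gen (RE \<nu>) :: ('j rgen, 'k) falg)"
  have d: "fvalid ?P d"
    unfolding d_def using a by (intro fvalid_intros) (auto simp: Jn_def)
  have "uS (Suc a) * uS a * uS (Suc a) - uS a * uS (Suc a) * uS a - U d = 0"
    using U_rel[OF RC_relsI(9)[OF a]] by (simp add: d_def diff_diff_eq)
  then have "U (sword (a # Suc a # a # s)) - U (sword (Suc a # a # Suc a # s)) = - (U d * U 1 * U (sword s))"
    by (simp add: algebra_simps)
      (metis (no_types, opaque_lifting) add_diff_cancel_left' diff_eq_eq distrib_right mult.assoc)
  moreover have "filt (Suc 0 + length s) (- (U d * U 1 * U (sword s)))"
    using braid d by (intro filt_uminus filt_right filt_MA filt_one) auto
  ultimately show ?case by (metis filt_mono add_Suc add_0 le_SucI length_Cons order_refl)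
qed

end

section \<open>Normal forms\<close>

definition perms :: "nat \<Rightarrow> nat list set" where
  "perms n = {xs. length xs = n \<and> distinct xs \<and> set xs = {..<n}}"

definition redword :: "nat list \<Rightarrow> nat list" where
  "redword xs = (SOME u. reduced u xs)"

lemma reduced_redword: "reduced (redword xs) xs"
  unfolding redword_def using reduced_exists by (rule someI_ex)

text \<open>Left multiplication by c_p on sorted Clifford monomials, up to sign: since c_p^2 = 1,
  the index is either inserted or removed.\<close>

fun toggle :: "nat \<Rightarrow> nat list \<Rightarrow> nat list" where
  "toggle p [] = [p]"
| "toggle p (q # qs) = (if p < q then p # q # qs else if p = q then qs else q # toggle p qs)"

lemma set_toggle: "set (toggle p qs) \<subseteq> insert p (set qs)"
  by (induction qs) auto

lemma sorted_toggle: "sorted_wrt (<) qs \<Longrightarrow> sorted_wrt (<) (toggle p qs)"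
proof (induction qs)
  case (Cons q qs)
  then show ?case using set_toggle[of p qs] by fastforce
qed simp

text \<open>Exponents of \<open>y\<close> as a sorted list with repetitions, the Clifford monomial as a strictly
  sorted list, the idempotent, and the permutation.\<close>
type_synonym 'j nfindex = "nat list \<times> nat list \<times> 'j list \<times> nat list"

definition yword :: "nat list \<Rightarrow> ('j rgen, 'k::comm_ring_1) falg" where
  "yword ps = prod_list (map (\<lambda>p. gen (RY p)) ps)"

definition cword :: "nat list \<Rightarrow> ('j rgen, 'k::comm_ring_1) falg" where
  "cword qs = prod_list (map (\<lambda>p. gen (RCl p)) qs)"

lemma yword_simps [simp]: "yword [] = 1" "yword (p # ps) = gen (RY p) * yword ps"
  and cword_simps [simp]: "cword [] = 1" "cword (p # ps) = gen (RCl p) * cword ps"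
  by (simp_all add: yword_def cword_def)

context rc_data
begin

definition nfset :: "'j nfindex set" where
  "nfset = {(ps, qs, \<nu>, xs). sorted ps \<and> set ps \<subseteq> {..<n} \<and> sorted_wrt (<) qs \<and> set qs \<subseteq> {..<n}
     \<and> \<nu> \<in> Jn n \<and> xs \<in> perms n}"

fun nfmono :: "'j nfindex \<Rightarrow> ('j rgen, 'k) falg" where
  "nfmono (ps, qs, \<nu>, xs) = yword ps * cword qs * gen (RE \<nu>) * sword (redword xs)"

inductive nf :: "('j rgen, 'k) falg quots \<Rightarrow> bool" where
  mono: "b \<in> nfset \<Longrightarrow> nf (U (sc k) * U (nfmono b))"
| zero: "nf 0"
| add: "nf x \<Longrightarrow> nf y \<Longrightarrow> nf (x + y)"

lemma nf_sum: "(\<And>i. i \<in> A \<Longrightarrow> nf (f i)) \<Longrightarrow> nf (\<Sum>i\<in>A. f i)"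
  by (induction A rule: infinite_finite_induct) (auto intro: nf.intros)

lemma uE_uE: "\<mu> \<in> Jn n \<Longrightarrow> \<nu> \<in> Jn n \<Longrightarrow> uE \<mu> * uE \<nu> = (if \<mu> = \<nu> then uE \<mu> else 0)"
  by (drule (1) U_MA_rel[OF MA_relsI(1)]) (simp split: if_splits)

lemma uY_uE: "p < n \<Longrightarrow> \<nu> \<in> Jn n \<Longrightarrow> uE \<nu> * uY p = uY p * uE \<nu>"
  by (drule (1) U_MA_rel[OF MA_relsI(3)]) simp

lemma uC_uE: "p < n \<Longrightarrow> \<nu> \<in> Jn n \<Longrightarrow> uE \<nu> * uC p = uC p * uE (capp c p \<nu>)"
  using U_MA_rel[OF MA_relsI(4), of p "capp c p \<nu>"] by simp

lemma uY_uY: "p < n \<Longrightarrow> q < n \<Longrightarrow> uY p * uY q = uY q * uY p"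
  by (drule (1) U_MA_rel[OF MA_relsI(5)]) simp

lemma uC_uC: "p < n \<Longrightarrow> q < n \<Longrightarrow> p \<noteq> q \<Longrightarrow> uC p * uC q = - (uC q * uC p)"
  by (drule (1) U_MA_rel[OF MA_relsI(6)]) (simp add: eq_neg_iff_add_eq_0)

lemma uC_square: "p < n \<Longrightarrow> uC p * uC p = U 1"
proof -
  assume p: "p < n"
  obtain u :: 'k where "2 * u = 1" using two_inv by blast
  then have u: "sc u + sc u = (1 :: ('j rgen, 'k) falg)"
    by (metis mult_2 sc_1 sc_add)
  have half: "U (sc u) * (U x + U x) = U x" for x
    by (metis U_add U_mult U_one(1) distrib_left distrib_right u)
  have "U (gen (RCl p) * gen (RCl p)) + U (gen (RCl p) * gen (RCl p)) = U 1 + U 1"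
    using U_MA_rel[OF MA_relsI(6)[OF p p]] U_add[of 1 1] by simp
  then show ?thesis using half by (metis U_mult)
qed

lemma uC_uY: "p < n \<Longrightarrow> q < n \<Longrightarrow> uC p * uY q = (if p = q then - (uY q * uC p) else uY q * uC p)"
  by (drule (1) U_MA_rel[OF MA_relsI(7)]) (simp add: eq_neg_iff_add_eq_0 split: if_splits)

lemma uY_yword:
  "p < n \<Longrightarrow> set ps \<subseteq> {..<n} \<Longrightarrow> uY p * U (yword ps) = U (yword (insort p ps))"
proof (induction ps)
  case (Cons q ps)
  then show ?case
    using mult_assoc_left[OF uY_uY[of p q], of "U (yword ps)"] by (simp add: mult.assoc)
qed simp

lemma uE_yword: "set ps \<subseteq> {..<n} \<Longrightarrow> \<nu> \<in> Jn n \<Longrightarrow> uE \<nu> * U (yword ps) = U (yword ps) * uE \<nu>"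
proof (induction ps)
  case (Cons q ps)
  then show ?case
    using mult_assoc_left[OF uY_uE[of q \<nu>], of "U (yword ps)"] by (simp add: mult.assoc)
qed simp

lemma uE_cword:
  "set qs \<subseteq> {..<n} \<Longrightarrow> \<nu> \<in> Jn n \<Longrightarrow> \<exists>\<mu>\<in>Jn n. uE \<nu> * U (cword qs) = U (cword qs) * uE \<mu>"
proof (induction qs arbitrary: \<nu>)
  case (Cons q qs)
  then have "\<exists>\<mu>\<in>Jn n. uE (capp c q \<nu>) * U (cword qs) = U (cword qs) * uE \<mu>"
    by (intro Cons.IH) simp_all
  then obtain \<mu> where "\<mu> \<in> Jn n" "uE (capp c q \<nu>) * U (cword qs) = U (cword qs) * uE \<mu>" ..
  then show ?case
    using Cons.prems mult_assoc_left[OF uC_uE[of q \<nu>], of "U (cword qs)"]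
    by (auto simp: mult.assoc intro!: bexI[of _ \<mu>])
qed auto

lemma uC_yword:
  "p < n \<Longrightarrow> set ps \<subseteq> {..<n} \<Longrightarrow> \<exists>k. uC p * U (yword ps) = U (sc k) * (U (yword ps) * uC p)"
proof (induction ps)
  case Nil
  show ?case by (rule exI[of _ 1]) simp
next
  case (Cons q ps)
  then obtain k where k: "uC p * U (yword ps) = U (sc k) * (U (yword ps) * uC p)" by auto
  have q: "q < n" using Cons by simp
  have "uC p * U (yword (q # ps)) = U (sc (if p = q then - 1 else 1)) * (uY q * (uC p * U (yword ps)))"
    using mult_assoc_left[OF uC_uY[OF Cons.prems(1) q], of "U (yword ps)"] by (simp add: mult.assoc sc_minus)
  also have "uY q * (uC p * U (yword ps)) = U (sc k) * (U (yword (q # ps)) * uC p)"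
    unfolding k using mult_assoc_left[OF U_sc_commute[symmetric, of "gen (RY q)" k]] by (simp add: mult.assoc)
  finally have "uC p * U (yword (q # ps)) = U (sc ((if p = q then - 1 else 1) * k)) * (U (yword (q # ps)) * uC p)"
    by (simp only: sc_mult U_mult mult.assoc)
  then show ?case by blast
qed

lemma uC_cword:
  "p < n \<Longrightarrow> set qs \<subseteq> {..<n} \<Longrightarrow> \<exists>k. uC p * U (cword qs) = U (sc k) * U (cword (toggle p qs))"
proof (induction qs)
  case Nil
  show ?case by (rule exI[of _ 1]) simp
next
  case (Cons q qs)
  then obtain k where k: "uC p * U (cword qs) = U (sc k) * U (cword (toggle p qs))" by auto
  have q: "q < n" using Cons by simp
  consider "p < q" | "p = q" | "q < p" by linarith
  then show ?case
  proof cases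
    case 1
    then show ?thesis by (intro exI[of _ 1]) simp
  next
    case 2
    then show ?thesis
      using mult_assoc_left[OF uC_square[OF q], of "U (cword qs)"] by (intro exI[of _ 1]) simp
  next
    case 3
    have "uC p * U (cword (q # qs)) = U (sc (- 1)) * (uC q * (uC p * U (cword qs)))"
      using 3 mult_assoc_left[OF uC_uC[OF Cons.prems(1) q], of "U (cword qs)"] by (simp add: mult.assoc sc_minus)
    also have "uC q * (uC p * U (cword qs)) = U (sc k) * U (cword (toggle p (q # qs)))"
      unfolding k using 3 mult_assoc_left[OF U_sc_commute[symmetric, of "gen (RCl q)" k]] by (simp add: mult.assoc)
    finally have "uC p * U (cword (q # qs)) = U (sc (- 1 * k)) * U (cword (toggle p (q # qs)))"
      by (simp only: sc_mult U_mult mult.assoc)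
    then show ?thesis by blast
  qed
qed

lemma nf_sc: "nf x \<Longrightarrow> nf (U (sc l) * x)"
proof (induction rule: nf.induct)
  case (mono b k)
  have "U (sc l) * (U (sc k) * U (nfmono b)) = U (sc (l * k)) * U (nfmono b)"
    by (simp add: sc_mult mult.assoc)
  then show ?case using nf.mono[OF mono] by metis
qed (auto simp: distrib_left intro: nf.intros)

text \<open>A generator of MA_n takes a normal monomial to a multiple of a normal monomial or to
  zero; no sigma has to be moved.\<close>

lemma nf_gen: "nf x \<Longrightarrow> rvalid n g \<Longrightarrow> MAgen g \<Longrightarrow> nf (U (gen g) * x)"
proof (induction rule: nf.induct)
  case (mono b k)
  obtain ps qs \<nu> xs where b: "b = (ps, qs, \<nu>, xs)" by (cases b)
  have b': "sorted ps" "set ps \<subseteq> {..<n}" "sorted_wrt (<) qs" "set qs \<subseteq> {..<n}" "\<nu> \<in> Jn n" "xs \<in> perms n"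
    using mono(1) by (simp_all add: b nfset_def)
  have "nf (U (gen g) * U (nfmono b))"
  proof (cases g)
    case (RY p)
    then have "U (gen g) * U (nfmono b) = U (sc 1) * U (nfmono (insort p ps, qs, \<nu>, xs))"
      using mono b' mult_assoc_left[OF uY_yword[of p ps]] by (simp add: b mult.assoc)
    moreover have "(insort p ps, qs, \<nu>, xs) \<in> nfset"
      using b' RY mono by (auto simp: nfset_def sorted_insort set_insort_key)
    ultimately show ?thesis using nf.mono by metis
  next
    case (RCl p)
    then have p: "p < n" using mono by simp
    obtain k where k: "uC p * U (yword ps) = U (sc k) * (U (yword ps) * uC p)"
      using uC_yword[OF p b'(2)] by blast
    obtain k' where k': "uC p * U (cword qs) = U (sc k') * U (cword (toggle p qs))"
      using uC_cword[OF p b'(4)] by blast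
    have "U (gen g) * U (nfmono b) = U (sc k) * (U (sc k') * U (nfmono (ps, toggle p qs, \<nu>, xs)))"
      using mult_assoc_left[OF k] mult_assoc_left[OF k']
        mult_assoc_left[OF U_sc_commute[symmetric, of "yword ps" k']]
      by (simp add: b RCl mult.assoc)
    moreover have "(ps, toggle p qs, \<nu>, xs) \<in> nfset"
      using b' p set_toggle[of p qs] by (auto simp: nfset_def sorted_toggle)
    ultimately show ?thesis using nf.mono nf_sc by metis
  next
    case (RE \<mu>)
    then have \<mu>: "\<mu> \<in> Jn n" using mono by (simp add: Jn_def)
    obtain \<mu>' where \<mu>': "\<mu>' \<in> Jn n" "uE \<mu> * U (cword qs) = U (cword qs) * uE \<mu>'"
      using uE_cword[OF b'(4) \<mu>] by blast
    have "U (gen g) * U (nfmono b) = (if \<mu>' = \<nu> then U (sc 1) * U (nfmono b) else 0)"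
      using mult_assoc_left[OF \<mu>'(2)] mult_assoc_left[OF uE_yword[OF b'(2) \<mu>]]
        mult_assoc_left[OF uE_uE[OF \<mu>'(1) b'(5)]]
      by (simp add: b RE mult.assoc)
    then show ?thesis using nf.mono[OF mono(1)] nf.zero by metis
  qed (use mono in simp)
  moreover have "U (gen g) * (U (sc k) * U (nfmono b)) = U (sc k) * (U (gen g) * U (nfmono b))"
    using mult_assoc_left[OF U_sc_commute[symmetric, of "gen g" k]] by (simp add: mult.assoc)
  ultimately show ?case using nf_sc by metis
qed (auto simp: distrib_left intro: nf.intros)

lemma nf_redword: "xs \<in> perms n \<Longrightarrow> nf (U (sword (redword xs)))"
proof -
  assume xs: "xs \<in> perms n"
  have "U (sword (redword xs)) = U 1 * U (sword (redword xs))" by simp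
  also have "\<dots> = (\<Sum>\<nu>\<in>Jn n. uE \<nu> * U (sword (redword xs)))"
    unfolding U_one_Jn by (rule sum_distrib_right)
  also have "\<dots> = (\<Sum>\<nu>\<in>Jn n. U (sc 1) * U (nfmono ([], [], \<nu>, xs)))"
    by (rule sum.cong) simp_all
  also have "nf \<dots>"
    by (intro nf_sum nf.mono) (simp add: xs nfset_def)
  finally show ?thesis .
qed

text \<open>Presents an arbitrary word as a sorting word of some permutation, as
  \<open>word_dichotomy\<close> requires.\<close>

lemma perms_rev_word:
  assumes "\<forall>a\<in>set u. Suc a < n"
  shows "wact (rev u) [0..<n] \<in> perms n" "wact u (wact (rev u) [0..<n]) = [0..<n]"
  using assms wact_set_distinct[of "rev u" "[0..<n]"] wact_rev[of u "[0..<n]"]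
  by (auto simp: perms_def)

text \<open>Modulo shorter words, a word of maximal length is either replaced by the chosen reduced
  word of its permutation or by one with a repeated letter, which is itself a combination of shorter
  words.\<close>

lemma filt_nf: "filt l x \<Longrightarrow> nf x"
proof (induction l arbitrary: x)
  case 0
  then show ?case by (induction rule: filt.induct) (auto intro: nf.intros nf_gen nf_sc)
next
  case (Suc l)
  from Suc.prems show ?case
  proof (induction rule: filt.induct)
    case (word u)
    show ?case
    proof (cases "length u < l")
      case True
      then show ?thesis using Suc.IH filt.word word by blast
    next
      case False
      then have len: "length u = l" using word by simp
      define xs where "xs = wact (rev u) [0..<n]"
      have xs: "xs \<in> perms n" "wact u xs = [0..<n]"
        using perms_rev_word[OF word(2)] by (simp_all add: xs_def)
      have "reduced u xs \<or> (\<exists>p a s. u \<simeq> p @ a # a # s)"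
        by (rule word_dichotomy) (use xs word in \<open>auto simp: perms_def\<close>)
      then obtain v where v: "u \<simeq> v" "nf (U (sword v))"
      proof
        assume "reduced u xs"
        then have "u \<simeq> redword xs"
          using xs reduced_braid_equiv reduced_redword by (auto simp: perms_def)
        then show ?thesis using that nf_redword[OF xs(1)] by blast
      next
        assume "\<exists>p a s. u \<simeq> p @ a # a # s"
        then obtain p a s where v: "u \<simeq> p @ a # a # s" by blast
        then have "filt l (U (sword (p @ a # a # s)))"
          using filt_square[of p a s] braid_equiv_same[OF v] word(2) len by simp
        then show ?thesis using that v Suc.IH by blast
      qed
      have "filt l (U (sword u) - U (sword v))"
        using filt_braid_equiv[OF v(1) word(2)] len by simp
      from nf.add[OF Suc.IH[OF this] v(2)] show ?thesis by simp
    qed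
  qed (auto intro: nf.intros nf_gen nf_sc)
qed

lemma nf_form:
  "nf z \<Longrightarrow> \<exists>S k. finite S \<and> S \<subseteq> nfset \<and> z = U (\<Sum>b\<in>S. sc (k b) * nfmono b)"
proof (induction rule: nf.induct)
  case (mono b k)
  then show ?case by (intro exI[of _ "{b}"] exI[of _ "\<lambda>_. k"]) simp
next
  case zero
  then show ?case by (intro exI[of _ "{}"]) simp
next
  case (add x y)
  then obtain S k S' k' where x: "finite S" "S \<subseteq> nfset" "x = U (\<Sum>b\<in>S. sc (k b) * nfmono b)"
    and y: "finite S'" "S' \<subseteq> nfset" "y = U (\<Sum>b\<in>S'. sc (k' b) * nfmono b)" by blast
  let ?k = "\<lambda>b. (if b \<in> S then k b else 0)" and ?k' = "\<lambda>b. (if b \<in> S' then k' b else 0)"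
  have 1: "(\<Sum>b\<in>S. sc (k b) * nfmono b) = (\<Sum>b\<in>S \<union> S'. sc (?k b) * nfmono b)"
    using x(1) y(1) by (intro sum.mono_neutral_cong_left) auto
  have 2: "(\<Sum>b\<in>S'. sc (k' b) * nfmono b) = (\<Sum>b\<in>S \<union> S'. sc (?k' b) * nfmono b)"
    using x(1) y(1) by (intro sum.mono_neutral_cong_left) auto
  have "x + y = U (\<Sum>b\<in>S \<union> S'. sc (?k b + ?k' b) * nfmono b)"
    unfolding x(3) y(3) U_add[symmetric] 1 2 sum.distrib[symmetric] sc_add distrib_right ..
  then show ?case using x(1,2) y(1,2)
    by (intro exI[of _ "S \<union> S'"] exI[of _ "\<lambda>b. ?k b + ?k' b"]) auto
qed

lemma filt_word_valid:
  "(\<And>g. g \<in> set w \<Longrightarrow> rvalid n g) \<Longrightarrow> \<exists>l. filt l (U (prod_list (map gen w)))"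
proof (induction w)
  case Nil
  then show ?case using filt_one by auto
next
  case (Cons g w)
  then obtain l where l: "filt l (U (prod_list (map gen w)))" by auto
  show ?case
  proof (cases "MAgen g")
    case True
    then show ?thesis using filt.gen[OF l _ True] Cons.prems by auto
  next
    case False
    then obtain a where a: "g = RS a" by (cases g) auto
    then have "Suc a < n" using Cons.prems[of g] by simp
    from filt_sigma[OF this l] show ?thesis by (auto simp: a)
  qed
qed

lemma normal_form:
  assumes "fvalid (rvalid n) x"
  shows "\<exists>S k. finite S \<and> S \<subseteq> nfset \<and> U x = U (\<Sum>b\<in>S. sc (k b) * nfmono b)"
proof (rule nf_form)
  have "U x = (\<Sum>w\<in>Poly_Mapping.keys x. U (sc (Poly_Mapping.lookup x w)) * U (prod_list (map gen (unWd w))))"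
    by (subst falg_as_sum[of x]) (simp add: U_sum)
  also have "nf \<dots>"
    using assms filt_word_valid filt_nf by (intro nf_sum nf_sc) (fastforce simp: fvalid_def)
  finally show "nf (U x)" .
qed

end

section \<open>Linear independence of the normal forms\<close>

fun flips :: "('j \<Rightarrow> 'j) \<Rightarrow> nat list \<Rightarrow> 'j site list \<Rightarrow> 'j site list" where
  "flips c [] p = p"
| "flips c (q # qs) p = flips c qs (p[q := sflip c (p ! q)])"

lemma flips_append: "flips c (qs @ rs) p = flips c rs (flips c qs p)"
  by (induction qs arbitrary: p) auto

lemma flips_pts: "p \<in> pts n \<Longrightarrow> flips c qs p \<in> pts n"
  by (induction qs arbitrary: p) (auto simp: pts_flip)

lemma map_fst_flips [simp]: "map fst (flips c qs p) = map fst p"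
  by (induction qs arbitrary: p) (auto simp: map_fst_flip)

lemma length_flips [simp]: "length (flips c qs p) = length p"
  by (induction qs arbitrary: p) auto

lemma sneg_flips:
  "distinct qs \<Longrightarrow> i < length p \<Longrightarrow> sneg (flips c qs p ! i) = (sneg (p ! i) \<noteq> (i \<in> set qs))"
proof (induction qs arbitrary: p)
  case (Cons q qs)
  have "sneg (p[q := sflip c (p ! q)] ! i) = (sneg (p ! i) \<noteq> (i = q))"
    using Cons.prems by (cases "i = q") auto
  then show ?case using Cons by auto
qed simp

lemma digits_unique:
  fixes d d' :: "nat \<Rightarrow> nat"
  assumes "(\<Sum>j<n. d j * B ^ j) = (\<Sum>j<n. d' j * B ^ j)" "\<And>j. d j < B" "\<And>j. d' j < B" "j < n"
  shows "d j = d' j"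
  using assms
proof (induction n arbitrary: d d' j)
  case (Suc n)
  have B: "0 < B" using Suc.prems(2)[of 0] by simp
  have *: "(\<Sum>j<Suc n. d j * B ^ j) = d 0 + B * (\<Sum>j<n. d (Suc j) * B ^ j)" for d :: "nat \<Rightarrow> nat"
    by (simp only: sum.lessThan_Suc_shift sum_distrib_left) (simp add: algebra_simps)
  have eq: "d 0 + B * (\<Sum>j<n. d (Suc j) * B ^ j) = d' 0 + B * (\<Sum>j<n. d' (Suc j) * B ^ j)"
    using Suc.prems(1) unfolding * .
  have "d 0 = d' 0"
    using arg_cong[OF eq, of "\<lambda>z. z mod B"] Suc.prems(2,3) by simp
  moreover have "(\<Sum>j<n. d (Suc j) * B ^ j) = (\<Sum>j<n. d' (Suc j) * B ^ j)"
    using eq calculation B by simp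
  then have "j = Suc i \<Longrightarrow> d (Suc i) = d' (Suc i)" for i
    using Suc.IH[of "\<lambda>j. d (Suc j)" "\<lambda>j. d' (Suc j)" i] Suc.prems by simp
  ultimately show ?case by (cases j) auto
qed simp

lemma sum_list_count:
  fixes f :: "nat \<Rightarrow> nat"
  shows "set rs \<subseteq> {..<n} \<Longrightarrow> sum_list (map f rs) = (\<Sum>j<n. count (mset rs) j * f j)"
proof (induction rs)
  case (Cons r rs)
  have "(\<Sum>j<n. count (mset (r # rs)) j * f j) = (\<Sum>j<n. (if j = r then f j else 0) + count (mset rs) j * f j)"
    by (rule sum.cong) auto
  then show ?case using Cons by (simp add: sum.distrib sum.delta)
qed simp

lemma count_mset_le_length: "count (mset rs) j \<le> length rs"
  by (metis count_le_size size_mset)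

text \<open>The multiplicities are the base-\<open>B\<close> digits of the sum, since they are
  bounded by the lengths of the lists.\<close>

lemma sum_powers_inj:
  fixes B :: nat
  assumes "set rs \<subseteq> {..<n}" "set rs' \<subseteq> {..<n}" "length rs < B" "length rs' < B"
    and eq: "sum_list (map (\<lambda>j. B ^ j) rs) = sum_list (map (\<lambda>j. B ^ j) rs')"
  shows "mset rs = mset rs'"
proof (rule multiset_eqI)
  fix j
  show "count (mset rs) j = count (mset rs') j"
  proof (cases "j < n")
    case True
    show ?thesis
    proof (rule digits_unique[OF _ _ _ True])
      show "(\<Sum>j<n. count (mset rs) j * B ^ j) = (\<Sum>j<n. count (mset rs') j * B ^ j)"
        using eq by (simp add: sum_list_count[OF assms(1)] sum_list_count[OF assms(2)])
    qed (use assms count_mset_le_length[of rs] count_mset_le_length[of rs'] le_less_trans in blast)+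
  next
    case False
    then have "j \<notin> set rs" "j \<notin> set rs'" using assms by auto
    then have "count (mset rs) j = 0" "count (mset rs') j = 0" by (simp_all add: count_eq_zero_iff)
    then show ?thesis by (simp only:)
  qed
qed

lemma sval_prod:
  "\<exists>\<sigma>\<in>{1, - 1}. prod_list (map (\<lambda>i. sval (p ! i)) ps)
    = \<sigma> * (fls_X_intpow (int (sum_list (map (\<lambda>i. fst (p ! i)) ps))) :: 'k::comm_ring_1 fls)"
proof (induction ps)
  case (Cons i ps)
  then obtain \<sigma> where \<sigma>: "\<sigma> \<in> {1, - 1}" "prod_list (map (\<lambda>i. sval (p ! i)) ps)
    = \<sigma> * (fls_X_intpow (int (sum_list (map (\<lambda>i. fst (p ! i)) ps))) :: 'k fls)" by blast
  define e where "e = (if sneg (p ! i) then - 1 else 1 :: 'k fls)"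
  have v: "sval (p ! i) = e * fls_X_intpow (int (fst (p ! i)))"
    by (simp add: sval_def e_def)
  have X: "fls_X_intpow (int a) * fls_X_intpow (int b) = (fls_X_intpow (int (a + b)) :: 'k fls)" for a b
    unfolding fls_X_intpow_times_fls_X_intpow by simp
  have "prod_list (map (\<lambda>i. sval (p ! i)) (i # ps))
    = (e * \<sigma>) * (fls_X_intpow (int (fst (p ! i))) * fls_X_intpow (int (sum_list (map (\<lambda>i. fst (p ! i)) ps))))"
    unfolding list.map prod_list.Cons \<sigma>(2) v by (simp only: mult_ac)
  then have "prod_list (map (\<lambda>i. sval (p ! i)) (i # ps))
    = (e * \<sigma>) * fls_X_intpow (int (sum_list (map (\<lambda>i. fst (p ! i)) (i # ps))))"
    unfolding X by simp
  moreover have "e * \<sigma> \<in> {1, - 1}" using \<sigma>(1) by (auto simp: e_def)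
  ultimately show ?case by blast
qed simp

lemma jw_sign: "jw q p \<in> {1, - 1 :: 'k::comm_ring_1 fls}"
proof (induction q)
  case (Suc q)
  have "jw (Suc q) p = jw q p * (ssgn (p ! q) :: 'k fls)" by (simp add: jw_def)
  then show ?case using Suc by (auto simp: ssgn_def)
qed (simp add: jw_def)

lemma map_wact: "(\<forall>a\<in>set u. Suc a < length x) \<Longrightarrow> map f (wact u x) = wact u (map f x)"
  by (induction u arbitrary: x) (simp_all add: map_lsw)

lemma invs_map:
  assumes "strict_mono (h :: nat \<Rightarrow> nat)"
  shows "invs (map h xs) = invs xs"
proof -
  have "{(i, j). i < j \<and> j < length (map h xs) \<and> map h xs ! j < map h xs ! i}
    = {(i, j). i < j \<and> j < length xs \<and> xs ! j < xs ! i}"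
    using strict_mono_less[OF assms] by auto
  then show ?thesis unfolding invs_def by simp
qed

context rc_data
begin

definition rep :: "('j rgen, 'k) falg \<Rightarrow> ('j site list \<Rightarrow> 'k fls) \<Rightarrow> 'j site list \<Rightarrow> 'k fls" where
  "rep x F = act (sop c Q) (fhom (RC_to_SK c n) x) F"

lemma rep_mult: "rep (x * y) F = rep x (rep y F)"
  unfolding rep_def by (rule ext) simp

lemma rep_1: "rep 1 F = F"
  unfolding rep_def by (rule ext) simp

lemma rep_yword: "rep (yword ps) F p = prod_list (map (\<lambda>i. sval (p ! i)) ps) * F p"
proof (induction ps)
  case (Cons i ps)
  then show ?case unfolding yword_simps rep_mult by (simp add: rep_def mult.assoc)
qed (simp add: rep_1)

lemma rep_cword: "\<exists>\<sigma>\<in>{1, - 1}. \<forall>F. rep (cword qs) F p = \<sigma> * F (flips c qs p)"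
proof (induction qs arbitrary: p)
  case Nil
  show ?case by (simp add: rep_1)
next
  case (Cons q qs)
  obtain \<sigma> where \<sigma>: "\<sigma> \<in> {1, - 1}"
    "\<forall>F. rep (cword qs) F (p[q := sflip c (p ! q)]) = \<sigma> * F (flips c (q # qs) p)"
    using Cons.IH by (metis flips.simps(2))
  have "rep (cword (q # qs)) F p = (jw q p * \<sigma>) * F (flips c (q # qs) p)" for F
  proof -
    have "rep (cword (q # qs)) F p = jw q p * rep (cword qs) F (p[q := sflip c (p ! q)])"
      unfolding cword_simps rep_mult by (simp add: rep_def)
    then show ?thesis using \<sigma>(2) by (simp add: mult.assoc)
  qed
  moreover have "jw q p * \<sigma> \<in> {1, - 1}" using \<sigma>(1) jw_sign[of q p] by auto
  ultimately show ?case by blast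
qed

lemma rep_E: "rep (gen (RE \<nu>)) F p = (if map slab p = \<nu> then F p else 0)"
  by (simp add: rep_def)

text \<open>The correction terms of sigma_a evaluate \<open>G\<close> at \<open>p\<close> and at
  \<open>p\<close> with two sites flipped. Both points have the exponents of \<open>p\<close>, so
  only the tau_a term survives.\<close>

lemma rep_S:
  assumes a: "Suc a < n" and p: "p \<in> pts n"
    and 0: "\<And>q. q \<in> pts n \<Longrightarrow> map fst q = map fst p \<Longrightarrow> G q = 0"
  shows "rep (gen (RS a)) G p = tau_weight c Q (p ! a) (p ! Suc a) * G (lsw a p)"
proof -
  let ?b = "Suc a"
  let ?f = "(p[a := sflip c (p ! a)])"
  let ?ff = "?f[?b := sflip c (?f ! ?b)]"
  have ff: "G p = 0" "G ?ff = 0"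
    using 0[of p] 0[of ?ff] p by (simp_all only: pts_flip map_fst_flip)
  let ?t = "tau_weight c Q (p ! a) (p ! Suc a)"
  have lp: "lsw a p \<in> pts n" using pts_lsw[OF p a] .
  have summand: "act (sop c Q) ((if \<not> pr_eq c (\<nu> ! a) (\<nu> ! ?b) then gen (ST a)
         else if \<nu> ! a = \<nu> ! ?b \<and> c (\<nu> ! a) \<noteq> \<nu> ! a then gen (ST a) - gen (SDm a ?b)
         else if \<nu> ! a = c (\<nu> ! ?b) \<and> c (\<nu> ! a) \<noteq> \<nu> ! a then gen (ST a) + gen (SDp a ?b) * (gen (SCl a) * gen (SCl ?b))
         else gen (ST a) - gen (SDm a ?b) + gen (SDp a ?b) * (gen (SCl a) * gen (SCl ?b))) * gen (SE \<nu>)) G p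
     = (if map slab (lsw a p) = \<nu> then ?t * G (lsw a p) else 0)" for \<nu>
    using ff by simp
  have "rep (gen (RS a)) G p = (\<Sum>\<nu>\<in>Jn n. if map slab (lsw a p) = \<nu> then ?t * G (lsw a p) else 0)"
    unfolding rep_def fhom_gen RC_to_SK.simps sigma_img_def Let_def act_sum summand ..
  also have "\<dots> = ?t * G (lsw a p)"
    using sum_Jn_delta[OF lp, where P = "\<lambda>_. True" and f = "\<lambda>_. ?t * G (lsw a p)"] by simp
  finally show ?thesis .
qed

text \<open>The possibly non-invertible factor R sits on ascents, so sorting along descents meets
  only signs.\<close>

lemma tau_weight_descent: "fst t < fst s \<Longrightarrow> tau_weight c Q s t \<in> {1, - 1}"
  by (simp add: tau_weight_def)

text \<open>Peel off the first letter. While the word is no longer than the number of inversions,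
  the rest vanishes at all points with the exponents of \<open>p\<close>, so \<open>rep_S\<close>
  applies. At an ascent the swap adds an inversion and the rest is too short to undo it; at a
  descent the count drops in step with the length and the weight is a sign.\<close>

lemma rep_sword:
  assumes F: "\<And>q. q \<in> pts n \<Longrightarrow> \<not> sorted (map fst q) \<Longrightarrow> F q = 0"
  shows "\<forall>a\<in>set u. Suc a < n \<Longrightarrow> p \<in> pts n \<Longrightarrow>
    (length u < invs (map fst p) \<longrightarrow> rep (sword u) F p = 0) \<and>
    (length u = invs (map fst p) \<longrightarrow>
      (if sorted (wact u (map fst p)) then \<exists>\<sigma>\<in>{1, - 1}. rep (sword u) F p = \<sigma> * F (wact u p)
       else rep (sword u) F p = 0))"
proof (induction u arbitrary: p)
  case Nil
  then show ?case using F[of p] invs_sorted[of "map fst p"] by (auto simp: rep_1)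
next
  case (Cons a u)
  have a: "Suc a < n" and u: "\<forall>a\<in>set u. Suc a < n" using Cons.prems by auto
  have lp: "lsw a p \<in> pts n" using pts_lsw Cons.prems a by blast
  have len: "Suc a < length p" using a Cons.prems by (simp add: pts_length)
  have m: "map fst (lsw a p) = lsw a (map fst p)" using len by (rule map_lsw)
  have ne: "map fst p ! a \<noteq> map fst p ! Suc a"
    using Cons.prems len pts_fst_neq[of p a "Suc a"] a by simp
  have dist: "distinct (map fst p)" using Cons.prems by (simp add: pts_def)
  have step: "rep (sword (a # u)) F p = tau_weight c Q (p ! a) (p ! Suc a) * rep (sword u) F (lsw a p)"
    if "length (a # u) \<le> invs (map fst p)"
    unfolding sword_simps rep_mult
  proof (rule rep_S[OF a Cons.prems(2)])
    fix q :: "'j site list" assume "q \<in> pts n" "map fst q = map fst p"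
    then show "rep (sword u) F q = 0" using Cons.IH[OF u, of q] that by auto
  qed
  show ?case
  proof (cases "map fst p ! a < map fst p ! Suc a")
    case True
    then have i: "invs (map fst (lsw a p)) = Suc (invs (map fst p))"
      unfolding m using len by (intro invs_lsw_ascent) auto
    have "\<not> reduced (a # u) (map fst p)"
      using reduced_ConsD(2)[OF _ dist, of a u] True by auto
    then have "length (a # u) = invs (map fst p) \<longrightarrow> \<not> sorted (wact (a # u) (map fst p))"
      using Cons.prems by (auto simp: reduced_def pts_length)
    moreover have "length (a # u) \<le> invs (map fst p) \<longrightarrow> rep (sword (a # u)) F p = 0"
      using step Cons.IH[OF u lp] i by auto
    ultimately show ?thesis by auto
  next
    case False
    then have gt: "map fst p ! Suc a < map fst p ! a" using ne by simp
    then have i: "invs (map fst p) = Suc (invs (map fst (lsw a p)))"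
      unfolding m using len by (intro invs_lsw_descent) auto
    have t: "tau_weight c Q (p ! a) (p ! Suc a) \<in> {1, - 1}"
      using gt len by (intro tau_weight_descent) simp
    have IH: "length u < invs (map fst (lsw a p)) \<Longrightarrow> rep (sword u) F (lsw a p) = 0"
      "length u = invs (map fst (lsw a p)) \<Longrightarrow> \<not> sorted (wact (a # u) (map fst p)) \<Longrightarrow> rep (sword u) F (lsw a p) = 0"
      "length u = invs (map fst (lsw a p)) \<Longrightarrow> sorted (wact (a # u) (map fst p)) \<Longrightarrow>
        \<exists>\<sigma>\<in>{1, - 1}. rep (sword u) F (lsw a p) = \<sigma> * F (wact (a # u) p)"
      using Cons.IH[OF u lp] by (auto simp: m)
    have "\<exists>\<sigma>\<in>{1, - 1}. rep (sword (a # u)) F p = \<sigma> * F (wact (a # u) p)"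
      if "length (a # u) = invs (map fst p)" "sorted (wact (a # u) (map fst p))"
    proof -
      have "length u = invs (map fst (lsw a p))" using that(1) i by simp
      from IH(3)[OF this that(2)]
      obtain \<sigma> where \<sigma>: "\<sigma> \<in> {1, - 1}" "rep (sword u) F (lsw a p) = \<sigma> * F (wact (a # u) p)" by blast
      have "rep (sword (a # u)) F p = (tau_weight c Q (p ! a) (p ! Suc a) * \<sigma>) * F (wact (a # u) p)"
        using step that \<sigma>(2) by (simp add: mult.assoc)
      moreover have "tau_weight c Q (p ! a) (p ! Suc a) * \<sigma> \<in> {1, - 1}" using t \<sigma>(1) by auto
      ultimately show ?thesis by blast
    qed
    then show ?thesis using step IH(1,2) i by auto
  qed
qed

text \<open>Evaluate at a generic point in the chamber of a normal form of maximal length: only normal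
  forms with the same permutation, Clifford part and idempotent contribute, and the \<open>y\<close>-monomials
  are separated by the exponents of \<open>t\<close>.\<close>
lemma nf_independent:
  assumes S: "finite S" "S \<subseteq> nfset"
    and 0: "\<And>F p. p \<in> pts n \<Longrightarrow> rep (\<Sum>b\<in>S. sc (k b) * nfmono b) F p = 0"
  shows "\<forall>b\<in>S. k b = 0"
proof (rule ccontr)
  assume "\<not> (\<forall>b\<in>S. k b = 0)"
  define S' where "S' = {b \<in> S. k b \<noteq> 0}"
  define perm where "perm = (\<lambda>b :: 'j nfindex. snd (snd (snd b)))"
  have S': "finite S'" "S' \<noteq> {}" using S \<open>\<not> _\<close> by (auto simp: S'_def)
  define N where "N = Max ((\<lambda>b. invs (perm b)) ` S')"
  have "N \<in> (\<lambda>b. invs (perm b)) ` S'" unfolding N_def using S' by (intro Max_in) auto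
  then obtain b0 where b0: "b0 \<in> S'" "invs (perm b0) = N" by auto
  have max: "invs (perm b) \<le> N" if "b \<in> S'" for b
    unfolding N_def using S' that by (intro Max_ge) auto
  obtain ps0 qs0 \<nu>0 xs0 where b0_eq: "b0 = (ps0, qs0, \<nu>0, xs0)" by (cases b0)
  have b0S: "b0 \<in> S" "k b0 \<noteq> 0" using b0 by (auto simp: S'_def)
  have v0: "sorted ps0" "set ps0 \<subseteq> {..<n}" "sorted_wrt (<) qs0" "set qs0 \<subseteq> {..<n}" "length \<nu>0 = n"
    "length xs0 = n" "distinct xs0" "set xs0 = {..<n}"
    using S(2) b0S(1) by (auto simp: b0_eq nfset_def Jn_def perms_def)
  \<comment> \<open>Larger than every y-degree in \<open>S\<close>, so that multiplicities are
    digits in base \<open>B\<close>; the summand 2 makes the powers of \<open>B\<close> strictly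
    increasing.\<close>
  define B where "B = 2 + (\<Sum>b\<in>S. length (fst b))"
  have B: "length ps < B" if "(ps, qs, \<nu>, xs) \<in> S" for ps qs \<nu> xs
    using member_le_sum[OF that, of "\<lambda>b. length (fst b)"] S(1) by (simp add: B_def)
  define h where "h = (\<lambda>i::nat. B ^ i)"
  have h: "strict_mono h" unfolding h_def strict_mono_def by (simp add: B_def)
  \<comment> \<open>Exponents in the relative order of \<open>xs0\<close>, so that
    \<open>redword xs0\<close> sorts \<open>z\<close>; all signs are positive.\<close>
  define z where "z = map (\<lambda>i. (h (xs0 ! i), False, \<nu>0 ! i)) [0..<n]"
  have z: "length z = n" "map fst z = map h xs0" "map slab z = \<nu>0" "\<And>i. i < n \<Longrightarrow> \<not> sneg (z ! i)"
    using v0 by (auto simp: z_def slab_def sneg_def intro!: nth_equalityI)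
  have z_pts: "z \<in> pts n"
  proof -
    have "distinct (map fst z)"
      unfolding z(2) using v0 strict_mono_imp_inj_on[OF h, of "set xs0"] by (simp add: distinct_map)
    then show ?thesis using z(1) by (simp only: pts_def mem_Collect_eq)
  qed
  \<comment> \<open>The flips of \<open>b0\<close> are undone in advance: its Clifford monomial
    carries \<open>x\<close> to \<open>z\<close>.\<close>
  define x where "x = flips c (rev qs0) z"
  have x_pts: "x \<in> pts n" unfolding x_def by (rule flips_pts[OF z_pts])
  have x_fst: "map fst x = map h xs0" using z by (simp add: x_def)
  have flips_rev: "(\<forall>q\<in>set qs. q < length p) \<Longrightarrow> flips c qs (flips c (rev qs) p) = p" for qs and p :: "'j site list"
    by (induction qs arbitrary: p) (auto simp: flips_append)
  have x_z: "flips c qs0 x = z" unfolding x_def using v0 z by (intro flips_rev) auto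
  define w where "w = wact (redword xs0) z"
  have letters: "\<forall>a\<in>set (redword xs). Suc a < n" if "length xs = n" for xs
    using reduced_redword[of xs] that by (simp add: reduced_def)
  have sorted_h: "sorted (map h ys) = sorted ys" for ys
    by (simp add: sorted_iff_nth_mono strict_mono_less_eq[OF h])
  have w_sorted: "sorted (wact (redword xs0) (map h xs0))"
    using reduced_redword[of xs0] letters[OF v0(6)] v0 by (simp add: map_wact[symmetric] sorted_h reduced_def)
  have w_fst: "map fst w = wact (redword xs0) (map h xs0)"
    unfolding w_def using letters[OF v0(6)] z by (simp add: map_wact)
  \<comment> \<open>The indicator of the one sorted point reached from \<open>z\<close> by the
    permutation of \<open>b0\<close>.\<close>
  define F where "F = (\<lambda>q. if q = w then 1 else 0 :: 'k fls)"
  have F: "F q = 0" if "q \<in> pts n" "\<not> sorted (map fst q)" for q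
    using that w_sorted w_fst by (auto simp: F_def)
  define E where "E = (\<lambda>ps. sum_list (map (\<lambda>i. fst (x ! i)) ps))"
  have nfmono_rep: "\<exists>\<sigma>\<in>{1, - 1}. rep (nfmono (ps, qs, \<nu>, xs)) F x
      = \<sigma> * fls_X_intpow (int (E ps)) * (if map slab (flips c qs x) = \<nu> then rep (sword (redword xs)) F (flips c qs x) else 0)"
    for ps qs \<nu> xs
  proof -
    obtain \<sigma> where \<sigma>: "\<sigma> \<in> {1, - 1}" "prod_list (map (\<lambda>i. sval (x ! i)) ps) = \<sigma> * (fls_X_intpow (int (E ps)) :: 'k fls)"
      using sval_prod[of x ps] unfolding E_def by blast
    obtain \<tau> where \<tau>: "\<tau> \<in> {1, - 1}" "\<And>F. rep (cword qs) F x = \<tau> * F (flips c qs x)"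
      using rep_cword by blast
    have "rep (nfmono (ps, qs, \<nu>, xs)) F x = (\<sigma> * \<tau>) * fls_X_intpow (int (E ps))
      * (if map slab (flips c qs x) = \<nu> then rep (sword (redword xs)) F (flips c qs x) else 0)"
      unfolding nfmono.simps rep_mult rep_yword \<sigma>(2) \<tau>(2) rep_E by (simp only: mult_ac)
    moreover have "\<sigma> * \<tau> \<in> {1, - 1}" using \<sigma>(1) \<tau>(1) by auto
    ultimately show ?thesis by blast
  qed
  \<comment> \<open>Flips keep the exponents, so at all these points words shorter than
    \<open>N\<close> give zero.\<close>
  have inv0: "invs (map fst (flips c qs x)) = N" for qs
    using b0(2) by (simp add: x_fst invs_map[OF h] perm_def b0_eq)
  have other: "rep (nfmono b) F x = 0 \<or> (\<exists>ps. b = (ps, qs0, \<nu>0, xs0) \<and>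
      (\<exists>\<sigma>\<in>{1, - 1}. rep (nfmono b) F x = \<sigma> * fls_X_intpow (int (E ps))))"
    if "b \<in> S'" for b
  proof -
    obtain ps qs \<nu> xs where b: "b = (ps, qs, \<nu>, xs)" by (cases b)
    have "b \<in> nfset" using that S(2) by (auto simp: S'_def)
    then have v: "sorted_wrt (<) qs" "set qs \<subseteq> {..<n}" "length xs = n" "distinct xs" "set xs = {..<n}"
      by (auto simp: b nfset_def perms_def)
    let ?p = "flips c qs x" and ?u = "redword xs"
    have p: "?p \<in> pts n" by (rule flips_pts[OF x_pts])
    have len: "length ?u \<le> N"
      using max[OF that] reduced_redword[of xs] by (simp add: b perm_def reduced_def)
    note rs = rep_sword[where F = F, OF F letters[OF v(3)] p, unfolded inv0]
    obtain \<sigma> where \<sigma>: "\<sigma> \<in> {1, - 1}" "rep (nfmono b) F x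
      = \<sigma> * fls_X_intpow (int (E ps)) * (if map slab ?p = \<nu> then rep (sword ?u) F ?p else 0)"
      using nfmono_rep unfolding b by blast
    show ?thesis
    proof (cases "map slab ?p = \<nu> \<and> length ?u = N \<and> sorted (wact ?u (map fst ?p)) \<and> wact ?u ?p = w")
      case False
      have "map slab ?p = \<nu> \<Longrightarrow> rep (sword ?u) F ?p = 0"
      proof (cases "length ?u = N \<and> sorted (wact ?u (map fst ?p))")
        case True
        assume "map slab ?p = \<nu>"
        then have "F (wact ?u ?p) = 0" using True False by (simp add: F_def)
        then show ?thesis using rs True by auto
      next
        case False
        then show ?thesis using rs len by (auto simp: le_less)
      qed
      then show ?thesis using \<sigma>(2) by simp
    next
      case True
      then obtain \<tau> where \<tau>: "\<tau> \<in> {1, - 1}" "rep (sword ?u) F ?p = \<tau>"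
        using rs by (auto simp: F_def)
      have "sorted (wact ?u xs0)"
        using True v v0 letters[OF v(3)] by (simp add: x_fst map_wact[symmetric] sorted_h)
      moreover have "sorted (wact ?u xs)" using reduced_redword[of xs] by (simp add: reduced_def)
      moreover have "set (wact ?u xs0) = {..<n}" "distinct (wact ?u xs0)" "set (wact ?u xs) = {..<n}" "distinct (wact ?u xs)"
        using wact_set_distinct[of ?u xs0] wact_set_distinct[of ?u xs] v v0 letters[OF v(3)] by auto
      ultimately have "wact ?u xs0 = wact ?u xs" by (intro sorted_distinct_set_unique) auto
      then have xs: "xs0 = xs" using v v0 letters[OF v(3)] by (intro wact_inj[of ?u xs0 xs]) auto
      \<comment> \<open>Both points are sorted to \<open>w\<close> by the same word, which acts
        injectively. As \<open>z\<close> has only positive signs, the negative sites of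
        \<open>x\<close> then reveal which positions were flipped.\<close>
      have pz: "?p = z"
      proof (rule wact_inj)
        show "\<forall>a\<in>set ?u. Suc a < length ?p" using letters[OF v(3)] pts_length[OF p] by simp
        show "length ?p = length z" using pts_length[OF p] z(1) by simp
        show "wact ?u ?p = wact ?u z" using True unfolding w_def xs by simp
      qed
      have sneg_x: "sneg (x ! i) \<longleftrightarrow> i \<in> set ps'" if "i < n" "flips c ps' x = z" "distinct ps'" for ps' i
        using sneg_flips[of ps' i x c] that z(4)[of i] x_pts by (simp add: pts_length)
      have dq: "distinct qs" "distinct qs0" using v v0 by (auto simp: strict_sorted_iff)
      have "set qs = set qs0"
        using sneg_x[OF _ pz dq(1)] sneg_x[OF _ x_z dq(2)] v(2) v0(4) by blast
      then have qs: "qs = qs0" using v(1) v0(3) by (simp add: strict_sorted_equal)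
      have "\<nu> = \<nu>0" using True pz z by simp
      moreover have "rep (nfmono b) F x = (\<sigma> * \<tau>) * fls_X_intpow (int (E ps))"
        using \<sigma>(2) \<tau>(2) True by (simp add: mult_ac)
      moreover have "\<sigma> * \<tau> \<in> {1, - 1}" using \<sigma>(1) \<tau>(1) by auto
      ultimately show ?thesis using b xs qs by blast
    qed
  qed
  have leading: "\<exists>\<sigma>\<in>{1, - 1}. rep (nfmono b0) F x = \<sigma> * fls_X_intpow (int (E ps0))"
  proof -
    obtain \<sigma> where \<sigma>: "\<sigma> \<in> {1, - 1}" "rep (nfmono b0) F x
      = \<sigma> * fls_X_intpow (int (E ps0)) * (if map slab z = \<nu>0 then rep (sword (redword xs0)) F z else 0)"
      using nfmono_rep[of ps0 qs0 \<nu>0 xs0] unfolding b0_eq x_z by blast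
    have "length (redword xs0) = invs (map fst z)"
      using reduced_redword[of xs0] z invs_map[OF h] by (simp add: reduced_def)
    then obtain \<tau> where \<tau>: "\<tau> \<in> {1, - 1}" "rep (sword (redword xs0)) F z = \<tau>"
      using rep_sword[where F = F, OF F letters[OF v0(6)] z_pts] w_sorted z by (auto simp: F_def w_def)
    have "rep (nfmono b0) F x = (\<sigma> * \<tau>) * fls_X_intpow (int (E ps0))"
      using \<sigma>(2) \<tau>(2) z by (simp add: mult_ac)
    moreover have "\<sigma> * \<tau> \<in> {1, - 1}" using \<sigma>(1) \<tau>(1) by auto
    ultimately show ?thesis by blast
  qed
  have E_inj: "ps = ps0" if "(ps, qs0, \<nu>0, xs0) \<in> S" "E ps = E ps0" for ps
  proof -
    have "(ps, qs0, \<nu>0, xs0) \<in> nfset" using that S by blast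
    then have v: "sorted ps" "set ps \<subseteq> {..<n}" by (auto simp: nfset_def)
    have E: "E rs = sum_list (map (\<lambda>j. B ^ j) (map (\<lambda>i. xs0 ! i) rs))" if "set rs \<subseteq> {..<n}" for rs
    proof -
      have "fst (x ! i) = B ^ (xs0 ! i)" if "i < n" for i
        using arg_cong[OF x_fst, of "\<lambda>l. l ! i"] that v0 x_pts by (simp add: h_def pts_length)
      then have "map (\<lambda>i. fst (x ! i)) rs = map (\<lambda>j. B ^ j) (map (\<lambda>i. xs0 ! i) rs)"
        using that by auto
      then show ?thesis by (simp only: E_def)
    qed
    have sub: "set (map (\<lambda>i. xs0 ! i) rs) \<subseteq> {..<n}" if "set rs \<subseteq> {..<n}" for rs
      using that v0 nth_mem by fastforce
    have "mset (map (\<lambda>i. xs0 ! i) ps) = mset (map (\<lambda>i. xs0 ! i) ps0)"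
      using B[OF that(1)] B[of ps0 qs0 \<nu>0 xs0] b0S(1) that(2) E[OF v(2)] E[OF v0(2)]
      by (intro sum_powers_inj[OF sub[OF v(2)] sub[OF v0(2)], of B]) (simp_all add: b0_eq)
    note same = this
    \<comment> \<open>Undoes the relabelling by \<open>xs0\<close>, which returns from the digits of
      the exponent to the y-monomial.\<close>
    define g where "g = the_inv_into {..<n} (\<lambda>i. xs0 ! i)"
    have "inj_on (\<lambda>i. xs0 ! i) {..<n}" using v0 by (intro inj_on_nth) auto
    then have g: "map g (map (\<lambda>i. xs0 ! i) rs) = rs" if "set rs \<subseteq> {..<n}" for rs
      using that by (auto simp: g_def subset_iff the_inv_into_f_f intro!: map_idI)
    have "mset (map g (map (\<lambda>i. xs0 ! i) ps)) = mset (map g (map (\<lambda>i. xs0 ! i) ps0))"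
      using same by (simp only: mset_map)
    then have "mset ps = mset ps0" unfolding g[OF v(2)] g[OF v0(2)] .
    then show ?thesis using v(1) v0(1) by (metis properties_for_sort)
  qed
  \<comment> \<open>Reading off the coefficient at \<open>E ps0\<close> separates \<open>b0\<close>
    from the other surviving monomials.\<close>
  have coeff0: "fls_nth (\<sigma> * fls_X_intpow (int e)) (int (E ps0)) = (if e = E ps0 then fls_nth \<sigma> 0 else 0)"
    if "\<sigma> \<in> {1, - 1}" for \<sigma> :: "'k fls" and e
    using that by auto
  have zero: "fls_nth (fls_const (k b) * rep (nfmono b) F x) (int (E ps0)) = 0" if "b \<in> S - {b0}" for b
  proof (cases "b \<in> S'")
    case True
    from other[OF this] show ?thesis
    proof
      assume "\<exists>ps. b = (ps, qs0, \<nu>0, xs0) \<and> (\<exists>\<sigma>\<in>{1, - 1}. rep (nfmono b) F x = \<sigma> * fls_X_intpow (int (E ps)))"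
      then obtain ps \<sigma> where b: "b = (ps, qs0, \<nu>0, xs0)" "\<sigma> \<in> {1, - 1}"
        "rep (nfmono b) F x = \<sigma> * fls_X_intpow (int (E ps))" by blast
      then have "E ps \<noteq> E ps0" using E_inj[of ps] that by (auto simp: b0_eq)
      then show ?thesis using coeff0[OF b(2)] by (simp add: b(3))
    qed simp
  qed (use that in \<open>simp add: S'_def\<close>)
  have "0 = rep (\<Sum>b\<in>S. sc (k b) * nfmono b) F x"
    using 0[OF x_pts] by simp
  also have "\<dots> = (\<Sum>b\<in>S. fls_const (k b) * rep (nfmono b) F x)"
    by (simp add: rep_def)
  finally have "0 = fls_nth (\<Sum>b\<in>S. fls_const (k b) * rep (nfmono b) F x) (int (E ps0))"
    by simp
  also have "\<dots> = (\<Sum>b\<in>S. fls_nth (fls_const (k b) * rep (nfmono b) F x) (int (E ps0)))"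
    by (rule fls_nth_sum)
  also have "\<dots> = fls_nth (fls_const (k b0) * rep (nfmono b0) F x) (int (E ps0))"
    using S(1) b0S(1) zero by (subst sum.remove[of S b0]) auto
  finally have "fls_nth (fls_const (k b0) * rep (nfmono b0) F x) (int (E ps0)) = 0" by simp
  moreover obtain \<sigma> where \<sigma>: "\<sigma> \<in> {1, - 1}" "rep (nfmono b0) F x = \<sigma> * fls_X_intpow (int (E ps0))"
    using leading by blast
  ultimately have "k b0 * fls_nth \<sigma> 0 = 0" using coeff0[OF \<sigma>(1), of "E ps0"] by simp
  then show False using b0S(2) \<sigma>(1) by auto
qed

text \<open>The normal form is reached only modulo the ideal that admits all generators as factors.
  Its image is brought back to \<open>SK_ideal\<close> by retraction before it acts on points, and
  the conclusion is brought back to \<open>RC_ideal\<close> in the same way.\<close>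

theorem RC_to_SK_injective:
  assumes x: "fvalid (rvalid n) x" and fx: "fhom (RC_to_SK c n) x \<in> SK_ideal c Q n"
  shows "x \<in> RC_ideal c Q n"
proof -
  obtain S k where S: "finite S" "S \<subseteq> nfset" "U x = U (\<Sum>b\<in>S. sc (k b) * nfmono b)"
    using normal_form[OF x] by blast
  define x' where "x' = (\<Sum>b\<in>S. sc (k b) * nfmono b)"
  have fT: "T (fhom (RC_to_SK c n) r) = 0" if "r \<in> gen_ideal (\<lambda>_. True) (RC_rels c Q n)" for r
    using that by (induction rule: gen_ideal.induct) (simp_all add: fhom_RC_rel)
  have "fvalid (rvalid n) (nfmono b)" if "b \<in> nfset" for b
  proof -
    obtain ps qs \<nu> xs where b: "b = (ps, qs, \<nu>, xs)" by (cases b)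
    then have "\<forall>a\<in>set (redword xs). Suc a < n"
      using that reduced_redword[of xs] by (auto simp: nfset_def perms_def reduced_def)
    then show ?thesis using that
      by (auto simp: b nfset_def yword_def cword_def sword_def Jn_def subset_iff
          intro!: fvalid_mult fvalid_prod_list fvalid_gen)
  qed
  then have "fvalid (rvalid n) x'"
    unfolding x'_def using S(2) by (intro fvalid_sum fvalid_mult) auto
  then have valid: "fvalid (svalid n) (fhom (RC_to_SK c n) x')"
    using fvalid_RC_to_SK by (rule fvalid_fhom)
  have "U (x - x') = 0" using S(3) by (simp add: x'_def)
  then have "T (fhom (RC_to_SK c n) (x - x')) = 0" using fT U_eq_0_iff by blast
  moreover have "T (fhom (RC_to_SK c n) x) = 0"
    using gen_ideal_mono[OF fx[unfolded SK_ideal_def], of "\<lambda>_. True"] T_eq_0_iff by blast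
  ultimately have "T (fhom (RC_to_SK c n) x') = 0" by simp
  then have "fhom (RC_to_SK c n) x' \<in> SK_ideal c Q n"
    unfolding SK_ideal_def T_eq_0_iff using valid fvalid_SK_rels by (rule gen_ideal_retract)
  then have "rep x' F p = 0" if "p \<in> pts n" for F p
    unfolding rep_def using that by (rule SK_ideal_act)
  then have "\<forall>b\<in>S. k b = 0"
    unfolding x'_def by (rule nf_independent[OF S(1,2)])
  then have "x' = 0" by (simp add: x'_def)
  then have "U x = 0" using S(3) by (simp add: x'_def[symmetric])
  then show ?thesis
    unfolding RC_ideal_def U_eq_0_iff using x fvalid_RC_rels by (rule gen_ideal_retract)
qed

end

theorem mainTheorem5:
  fixes c :: "'j::finite \<Rightarrow> 'j"
    and Q :: "'j \<Rightarrow> 'j \<Rightarrow> 'k::comm_ring_1 poly poly"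
    and n :: nat
  assumes two_inv: "\<exists>u::'k. 2 * u = 1"
    and c_inv: "\<forall>j. c (c j) = j"
    and Q_swap: "\<forall>i j a b. bcoeff (Q j i) a b = bcoeff (Q i j) b a"
    and Q_c1: "\<forall>i j a b. (- 1) ^ a * bcoeff (Q (c i) j) a b = bcoeff (Q i j) a b"
    and Q_c2: "\<forall>i j a b. (- 1) ^ b * bcoeff (Q i (c j)) a b = bcoeff (Q i j) a b"
    and Q_zero: "\<forall>i j. pr_eq c i j \<longrightarrow> Q i j = 0"
  shows "(\<forall>r \<in> RC_rels c Q n. fhom (RC_to_SK c n) r \<in> SK_ideal c Q n)
       \<and> (\<forall>x. fvalid (rvalid n) x \<longrightarrow> fhom (RC_to_SK c n) x \<in> SK_ideal c Q n
              \<longrightarrow> x \<in> RC_ideal c Q n)"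
proof -
  interpret rc_data c Q n
    by unfold_locales (use assms in auto)
  show ?thesis
    using RC_rels_hold RC_to_SK_injective by blast
qed

end
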